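(* Let $p>2$ be a prime and let $M$ be an oriented closed smooth manifold of dimension $d$. Let $\rho:M\times M\to\mathbb R$ be a continuous function, and let $g_1,\dots,g_d$ be $d$ elements of the group $G=Z_p$. Then there exists a nonconstant map $\phi:G\to M$ such that for all $g\in G$ and all $i=1,\dots,d$ $$\rho(\phi(g),\phi(g+g_i))=\rho(\phi(e),\phi(g_i)).$$
   Context: $Z_p=\mathbb Z/p$; the group operation in $G$ is written $+$ and $e$ denotes the neutral element of $G$. *)

theory Defs
  imports
    "HOL-Analysis.Analysis"
    "HOL-Algebra.Elementary_Groups"
    "HOL-Computational_Algebra.Primes"
begin

text \<open>Meant for open sets: in finite dimension, requiring all directional derivatives
  \<open>x \<mapsto> f'(x) v\<close> of a differentiable map to be of class \<open>C\<^sup>k\<close> is the usual \<open>C\<^sup>k\<^sup>+\<^sup>1\<close> condition.\<close>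

primrec C_k_on :: "nat \<Rightarrow> ('a::euclidean_space \<Rightarrow> 'b::euclidean_space) \<Rightarrow> 'a set \<Rightarrow> bool" where
  "C_k_on 0 f S \<longleftrightarrow> continuous_on S f"
| "C_k_on (Suc k) f S \<longleftrightarrow>
     (\<forall>x\<in>S. f differentiable (at x)) \<and>
     (\<forall>v. C_k_on k (\<lambda>x. frechet_derivative f (at x) v) S)"

definition smooth_on :: "'a set \<Rightarrow> ('a::euclidean_space \<Rightarrow> 'b::euclidean_space) \<Rightarrow> bool" where
  "smooth_on S f \<longleftrightarrow> (\<forall>k. C_k_on k f S)"

text \<open>A chart is a pair of its domain and the coordinate map; the values of the coordinate map
  outside the domain are irrelevant.\<close>

type_synonym ('a, 'n) chart = "'a set \<times> ('a \<Rightarrow> real ^ 'n)"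

definition is_chart :: "'a topology \<Rightarrow> ('a, 'n::finite) chart \<Rightarrow> bool" where
  "is_chart M c \<longleftrightarrow> (case c of (U, \<phi>) \<Rightarrow>
     openin M U \<and> open (\<phi> ` U) \<and>
     homeomorphic_map (subtopology M U) (top_of_set (\<phi> ` U)) \<phi>)"

definition transition ::
    "('a, 'n::finite) chart \<Rightarrow> ('a, 'n) chart \<Rightarrow> real ^ 'n \<Rightarrow> real ^ 'n" where
  "transition c c' = snd c' \<circ> inv_into (fst c) (snd c)"

definition transition_domain ::
    "('a, 'n::finite) chart \<Rightarrow> ('a, 'n) chart \<Rightarrow> (real ^ 'n) set" where
  "transition_domain c c' = snd c ` (fst c \<inter> fst c')"

text \<open>Manifolds have dimension \<open>CARD('n)\<close>, hence positive dimension. They have no boundary,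
  since chart images are open in \<open>\<real>\<^sup>n\<close>, and they need not be connected. The atlas
  need not be maximal.\<close>

locale smooth_manifold =
  fixes M :: "'a topology" and A :: "('a, 'n::finite) chart set"
  assumes Hausdorff: "Hausdorff_space M"
    and second_countable: "second_countable M"
    and charts: "\<And>c. c \<in> A \<Longrightarrow> is_chart M c"
    and cover: "(\<Union>c\<in>A. fst c) = topspace M"
    and smooth_transition:
      "\<And>c c'. c \<in> A \<Longrightarrow> c' \<in> A \<Longrightarrow> smooth_on (transition_domain c c') (transition c c')"

text \<open>The orientation is the one for which every chart of the atlas is orientation preserving.\<close>

locale oriented_smooth_manifold = smooth_manifold M A
  for M :: "'a topology" and A :: "('a, 'n::finite) chart set" +
  assumes positive_Jacobian:
    "\<And>c c' y. c \<in> A \<Longrightarrow> c' \<in> A \<Longrightarrow> y \<in> transition_domain c c' \<Longrightarrow>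
       det (matrix (frechet_derivative (transition c c') (at y))) > 0"

locale oriented_closed_smooth_manifold = oriented_smooth_manifold M A
  for M :: "'a topology" and A :: "('a, 'n::finite) chart set" +
  assumes compact: "compact_space M"

end

theory Submission
  imports Defs "HOL-Homology.Homology"
begin

text \<open>
  The group \<open>\<int>\<^sub>p\<close> acts on the space \<open>Y\<close> of nonconstant maps \<open>\<phi> : {0, ..., p - 1} \<rightarrow> M\<close> by cyclic
  shifts, freely because \<open>p\<close> is prime. Subtracting from \<open>\<rho> (\<phi> h, \<phi> (h + g\<^sub>i))\<close> its mean over \<open>h\<close> gives an
  equivariant map \<open>F\<close> from \<open>Y\<close> to a real vector space of dimension \<open>n = d (p - 1)\<close>, and the zeros of
  \<open>F\<close> are exactly the maps asked for. So the theorem is a Borsuk-Ulam statement: \<open>F\<close> has a zero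
  (\<open>equivariant_zero\<close>).

  Such a statement needs \<open>Y\<close> to be highly connected in an equivariant sense. This is expressed by
  singular chains \<open>\<alpha>\<^sub>0, ..., \<alpha>\<^sub>n\<close> of \<open>Y\<close> in degrees \<open>0, ..., n\<close>, where \<open>\<alpha>\<^sub>0\<close> is a point and the boundary of
  \<open>\<alpha>\<^sub>j\<^sub>+\<^sub>1\<close> is obtained from \<open>\<alpha>\<^sub>j\<close> by applying alternately \<open>T - 1\<close> and \<open>1 + T + ... + T\<^sup>p\<^sup>-\<^sup>1\<close>, with \<open>T\<close> the
  shift (\<open>equivariant_chains_conf\<close>). Nonconstant maps into \<open>\<real>\<^sup>d\<close> form a space homotopy equivalent to
  \<open>\<real>\<^sup>n - {0}\<close>, that is, to a sphere of dimension \<open>n - 1\<close>; hence the chains exist there up to degree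
  \<open>n - 1\<close>, and a parametrization \<open>\<real>\<^sup>d \<rightarrow> M\<close> carries them to \<open>Y\<close>. The last chain has to fill a cycle of
  dimension \<open>n - 1\<close>, and it is here that \<open>M\<close> being closed and oriented enters. Up to homology, the cycle
  comes from the link of a point of \<open>N = M\<^sup>p\<^sup>-\<^sup>1\<close>, under the map \<open>\<psi> \<mapsto> (x\<^sub>0, \<psi>)\<close> which sends
  \<open>N - {(x\<^sub>0, ..., x\<^sub>0)}\<close> to \<open>Y\<close>. The manifold \<open>N\<close> is closed and oriented, so it has a fundamental
  class, and removing a small ball around the point from it shows that the link bounds in the complement of the
  point (\<open>fundamental_class\<close>, \<open>link_bounds\<close>, \<open>local_cycles_bound\<close>).

  Suppose that \<open>F\<close> has no zero. Label \<open>\<phi>\<close> equivariantly by an index \<open>(h, i)\<close> at which \<open>F \<phi>\<close> is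
  largest. The label is a coordinate with a positive value, and because the values of \<open>F \<phi>\<close> over any fixed \<open>i\<close> add
  up to zero, the labels near any given configuration miss at least one of the \<open>p\<close> indices over each \<open>i\<close>. So there are
  at most \<open>n\<close> of them, and no nonempty set of them is invariant under a nontrivial
  shift. After subdividing the \<open>\<alpha>\<^sub>j\<close> and replacing simplices by barycentric flags of label sets, one obtains
  chains of the same kind in which a flag in degree \<open>n\<close> would need \<open>n + 1\<close> labels; so the last of the chains
  vanishes. On the other hand the shift permutes the flags freely, and
  a free action makes the alternating complex exact. Descending from degree \<open>n\<close> to degree \<open>0\<close> then gives
  \<open>1 \<equiv> 0\<close> modulo \<open>p\<close> (\<open>no_short_resolution\<close>, \<open>no_equivariant_labelling\<close>).
\<close>

section \<open>Free cyclic actions\<close>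

lemma funpow_funpow: "(f ^^ a) ((f ^^ b) x) = (f ^^ (a + b)) x"
  by (simp add: funpow_add)

text \<open>The set \<open>R\<close> picks one representative from each orbit. Every point of \<open>\<Omega>\<close> then reaches it after
  exactly one number of steps below \<open>p\<close>.\<close>

lemma fundamental_domain:
  fixes \<tau> :: "'x \<Rightarrow> 'x" and p :: nat
  assumes "p > 0" and closed: "\<And>x. x \<in> \<Omega> \<Longrightarrow> \<tau> x \<in> \<Omega>"
    and per: "\<And>x. x \<in> \<Omega> \<Longrightarrow> (\<tau> ^^ p) x = x"
    and free: "\<And>x k. \<lbrakk>x \<in> \<Omega>; 0 < k; k < p\<rbrakk> \<Longrightarrow> (\<tau> ^^ k) x \<noteq> x"
  obtains R where "\<And>x. x \<in> \<Omega> \<Longrightarrow> \<exists>!k. k < p \<and> (\<tau> ^^ k) x \<in> R"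
proof -
  define orb where "orb x = {(\<tau> ^^ k) x |k. True}" for x
  define rep where "rep x = (SOME y. y \<in> orb x)" for x
  have clk: "(\<tau> ^^ k) x \<in> \<Omega>" if "x \<in> \<Omega>" for k x
    using that by (induction k) (auto simp: closed)
  have mult: "(\<tau> ^^ (p * m)) x = x" if "x \<in> \<Omega>" for m x
    using that by (induction m) (auto simp: funpow_add per)
  have modp: "(\<tau> ^^ k) x = (\<tau> ^^ (k mod p)) x" if "x \<in> \<Omega>" for k x
  proof -
    have "(\<tau> ^^ k) x = (\<tau> ^^ (k mod p + p * (k div p))) x" by simp
    also have "\<dots> = (\<tau> ^^ (k mod p)) x" unfolding funpow_add using mult that by simp
    finally show ?thesis .
  qed
  have orb_eq: "orb ((\<tau> ^^ k) x) = orb x" if "x \<in> \<Omega>" for k x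
  proof -
    have "(\<tau> ^^ j) x \<in> orb ((\<tau> ^^ k) x)" for j
    proof -
      have "p * k - k + k = p * k" using \<open>p > 0\<close> by (cases p) auto
      then have "(\<tau> ^^ (j + (p * k - k))) ((\<tau> ^^ k) x) = (\<tau> ^^ (j + p * k)) x"
        by (simp add: funpow_funpow add.assoc)
      also have "\<dots> = (\<tau> ^^ j) x"
        unfolding funpow_add using mult that by simp
      finally show ?thesis unfolding orb_def by (metis (mono_tags, lifting) mem_Collect_eq)
    qed
    then show ?thesis
      unfolding orb_def by (auto simp: funpow_funpow)
  qed
  have rep: "\<exists>k<p. rep x = (\<tau> ^^ k) x" if "x \<in> \<Omega>" for x
  proof -
    have "x \<in> orb x" unfolding orb_def by (auto intro: exI[of _ 0])
    then have "rep x \<in> orb x" unfolding rep_def by (rule someI)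
    then obtain k where "rep x = (\<tau> ^^ k) x" by (auto simp: orb_def)
    then show ?thesis using modp [OF that, of k] \<open>p > 0\<close> by (metis mod_less_divisor)
  qed
  have inj: "k = l" if "x \<in> \<Omega>" "k < p" "l < p" "(\<tau> ^^ k) x = (\<tau> ^^ l) x" "k \<le> l" for x k l
  proof (rule ccontr)
    assume "k \<noteq> l"
    have "x = (\<tau> ^^ (p - l)) ((\<tau> ^^ l) x)"
      using per [OF \<open>x \<in> \<Omega>\<close>] \<open>l < p\<close> by (simp add: funpow_funpow)
    also have "\<dots> = (\<tau> ^^ (p - l + k)) x" by (simp add: funpow_funpow flip: that(4))
    finally show False using free [of x "p - l + k"] that \<open>k \<noteq> l\<close> by force
  qed
  show thesis
  proof (rule that [of "rep ` \<Omega>"])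
    fix x assume x: "x \<in> \<Omega>"
    have key: "(\<tau> ^^ l) x = rep x" if "(\<tau> ^^ l) x \<in> rep ` \<Omega>" for l
    proof -
      obtain z where z: "z \<in> \<Omega>" "(\<tau> ^^ l) x = rep z" using \<open>(\<tau> ^^ l) x \<in> rep ` \<Omega>\<close> by auto
      obtain j where "rep z = (\<tau> ^^ j) z" using rep z by blast
      then have "orb x = orb z" using orb_eq x z by metis
      then show ?thesis using z by (simp add: rep_def)
    qed
    obtain k where k: "k < p" "rep x = (\<tau> ^^ k) x" using rep x by blast
    show "\<exists>!k. k < p \<and> (\<tau> ^^ k) x \<in> rep ` \<Omega>"
    proof (intro ex1I [of _ k] conjI)
      show "(\<tau> ^^ k) x \<in> rep ` \<Omega>" using k x by (metis imageI)
      fix l assume l: "l < p \<and> (\<tau> ^^ l) x \<in> rep ` \<Omega>"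
      then have "(\<tau> ^^ l) x = (\<tau> ^^ k) x" using key k by simp
      then show "l = k" using inj [OF x] l k by (metis nat_le_linear)
    qed (use k in auto)
  qed
qed

text \<open>On a free action a selection may be made arbitrarily on a fundamental domain and transported
  along orbits.\<close>

lemma equivariant_selection:
  fixes \<tau> :: "'x \<Rightarrow> 'x" and g :: "'l \<Rightarrow> 'l" and p :: nat
  assumes "p > 0" and closed: "\<And>x. x \<in> \<Omega> \<Longrightarrow> \<tau> x \<in> \<Omega>"
    and per: "\<And>x. x \<in> \<Omega> \<Longrightarrow> (\<tau> ^^ p) x = x"
    and free: "\<And>x k. \<lbrakk>x \<in> \<Omega>; 0 < k; k < p\<rbrakk> \<Longrightarrow> (\<tau> ^^ k) x \<noteq> x"
    and ne: "\<And>x. x \<in> \<Omega> \<Longrightarrow> A x \<noteq> {}"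
    and equi: "\<And>x l. \<lbrakk>x \<in> \<Omega>; l \<in> A x\<rbrakk> \<Longrightarrow> g l \<in> A (\<tau> x)"
    and gper: "\<And>x l. \<lbrakk>x \<in> \<Omega>; l \<in> A x\<rbrakk> \<Longrightarrow> (g ^^ p) l = l"
  obtains f where "\<And>x. x \<in> \<Omega> \<Longrightarrow> f x \<in> A x" "\<And>x. x \<in> \<Omega> \<Longrightarrow> f (\<tau> x) = g (f x)"
proof -
  obtain R where R: "\<And>x. x \<in> \<Omega> \<Longrightarrow> \<exists>!k. k < p \<and> (\<tau> ^^ k) x \<in> R"
    by (rule fundamental_domain [OF \<open>p > 0\<close> closed per free]) (auto intro: that)
  define n where "n x = (THE k. k < p \<and> (\<tau> ^^ k) x \<in> R)" for x
  have n: "n x < p" "(\<tau> ^^ n x) x \<in> R" if "x \<in> \<Omega>" for x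
    using theI' [OF R [OF that]] by (auto simp: n_def)
  have n_eq: "n x = k" if "x \<in> \<Omega>" "k < p" "(\<tau> ^^ k) x \<in> R" for x k
    using R [OF that(1)] n [OF that(1)] that by blast
  define s where "s x = (SOME l. l \<in> A x)" for x
  have s: "s x \<in> A x" if "x \<in> \<Omega>" for x
    unfolding s_def using ne [OF that] by (simp add: some_in_eq)
  have clk: "(\<tau> ^^ k) x \<in> \<Omega>" if "x \<in> \<Omega>" for k x
    using that by (induction k) (auto simp: closed)
  have gk: "(g ^^ k) l \<in> A ((\<tau> ^^ k) x)" if "x \<in> \<Omega>" "l \<in> A x" for k l x
    using that by (induction k) (auto intro: equi clk)
  define f where "f x = (g ^^ (p - n x)) (s ((\<tau> ^^ n x) x))" for x
  show thesis
  proof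
    fix x assume x: "x \<in> \<Omega>"
    have "f x \<in> A ((\<tau> ^^ (p - n x)) ((\<tau> ^^ n x) x))"
      unfolding f_def by (intro gk clk s x)
    also have "(\<tau> ^^ (p - n x)) ((\<tau> ^^ n x) x) = (\<tau> ^^ (p - n x + n x)) x"
      by (simp only: funpow_add o_apply)
    also have "\<dots> = x" using n [OF x] per [OF x] by simp
    finally show "f x \<in> A x" .
    show "f (\<tau> x) = g (f x)"
    proof (cases "n x")
      case 0
      have "n (\<tau> x) = p - 1"
      proof (rule n_eq)
        have "(\<tau> ^^ (p - 1)) (\<tau> x) = (\<tau> ^^ p) x"
          using \<open>p > 0\<close> by (metis Suc_pred' diff_Suc_1 funpow_Suc_right o_apply)
        then show "(\<tau> ^^ (p - 1)) (\<tau> x) \<in> R" using n(2) [OF x] 0 per [OF x] by simp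
      qed (use \<open>p > 0\<close> closed x in auto)
      moreover have "(\<tau> ^^ (p - 1)) (\<tau> x) = x"
        using \<open>p > 0\<close> per [OF x] by (metis Suc_pred' diff_Suc_1 funpow_Suc_right o_apply)
      ultimately have "f (\<tau> x) = g (s x)" using \<open>p > 0\<close> by (simp add: f_def)
      then show ?thesis using 0 gper [OF x s [OF x]] by (simp add: f_def)
    next
      case (Suc k)
      have e: "(\<tau> ^^ k) (\<tau> x) = (\<tau> ^^ n x) x" using Suc by (simp add: funpow_swap1)
      have "n (\<tau> x) = k"
      proof (rule n_eq)
        show "(\<tau> ^^ k) (\<tau> x) \<in> R" using e n(2) [OF x] by simp
      qed (use closed x Suc n(1) [OF x] in auto)
      moreover have "p - k = Suc (p - n x)" using Suc n(1) [OF x] by simp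
      ultimately show ?thesis using e by (simp add: f_def)
    qed
  qed
qed

text \<open>Linear extension of a map of generators to the free abelian groups on them.\<close>

definition push :: "('x \<Rightarrow> 'y) \<Rightarrow> ('x \<Rightarrow>\<^sub>0 int) \<Rightarrow> ('y \<Rightarrow>\<^sub>0 int)" where
  "push f = frag_extend (frag_of \<circ> f)"

lemma push_simps [simp]:
  "push f 0 = 0" "push f (frag_of x) = frag_of (f x)" "push f (-c) = - push f c"
  "push f (b + c) = push f b + push f c" "push f (b - c) = push f b - push f c"
  by (simp_all add: push_def frag_extend_minus frag_extend_add frag_extend_diff)

lemma push_sum: "push f (sum c I) = (\<Sum>i\<in>I. push f (c i))"
  by (induction I rule: infinite_finite_induct) auto

lemma keys_push: "Poly_Mapping.keys (push f c) \<subseteq> f ` Poly_Mapping.keys c"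
  using keys_frag_extend [of "frag_of \<circ> f" c] by (auto simp: push_def)

lemma frag_all_induct [case_names zero one diff]:
  assumes "P 0" "\<And>x. P (frag_of x)" "\<And>a b. \<lbrakk>P a; P b\<rbrakk> \<Longrightarrow> P (a - b)"
  shows "P c"
  using subset_UNIV by (rule frag_induction) (use assms in auto)

lemma push_push: "push f (push g c) = push (\<lambda>x. f (g x)) c"
  by (induction c rule: frag_all_induct) auto

lemma push_funpow:
  fixes f :: "'x \<Rightarrow> 'x"
  shows "(push f ^^ k) c = push (f ^^ k) c"
proof (induction k)
  case 0
  show ?case by (induction c rule: frag_all_induct) auto
next
  case (Suc k)
  then show ?case by (simp add: push_push o_def)
qed

text \<open>With \<open>T\<close> of order \<open>p\<close>, the operators \<open>T - 1\<close> and \<open>1 + T + ... + T\<^sup>p\<^sup>-\<^sup>1\<close> annihilate each other. The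
  function \<open>alt_op\<close> takes them in turn, as in the periodic resolution of a cyclic group.\<close>

definition norm_op :: "nat \<Rightarrow> ('c \<Rightarrow> 'c) \<Rightarrow> 'c \<Rightarrow> 'c::ab_group_add" where
  "norm_op p T c = (\<Sum>k<p. (T ^^ k) c)"

definition alt_op :: "nat \<Rightarrow> ('c \<Rightarrow> 'c) \<Rightarrow> nat \<Rightarrow> 'c \<Rightarrow> 'c::ab_group_add" where
  "alt_op p T j c = (if even j then T c - c else norm_op p T c)"

text \<open>Let \<open>E\<close> keep the part of a chain that is supported on a fundamental domain. Then every chain \<open>c\<close>
  is the sum of the \<open>T\<^sup>p\<^sup>-\<^sup>k (E (T\<^sup>k c))\<close> over \<open>k < p\<close>. If \<open>T c = c\<close>, this sum is the norm of a shift of \<open>E c\<close>. If the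
  norm of \<open>c\<close> vanishes, then so does the sum of the \<open>E (T\<^sup>k c)\<close>; subtracting that sum leaves terms
  \<open>(T\<^sup>p\<^sup>-\<^sup>k - 1) e\<close>, each of which is divisible by \<open>T - 1\<close>.\<close>

lemma free_resolution_exact:
  fixes \<tau> :: "'x \<Rightarrow> 'x" and p :: nat
  assumes "p > 0" and closed: "\<And>x. x \<in> \<Omega> \<Longrightarrow> \<tau> x \<in> \<Omega>"
    and per: "\<And>x. x \<in> \<Omega> \<Longrightarrow> (\<tau> ^^ p) x = x"
    and free: "\<And>x k. \<lbrakk>x \<in> \<Omega>; 0 < k; k < p\<rbrakk> \<Longrightarrow> (\<tau> ^^ k) x \<noteq> x"
    and c: "Poly_Mapping.keys c \<subseteq> \<Omega>" and P: "alt_op p (push \<tau>) j c = 0"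
  obtains b where "Poly_Mapping.keys b \<subseteq> \<Omega>" "c = alt_op p (push \<tau>) (Suc j) b"
proof -
  define T where "T = push \<tau>"
  obtain R where R: "\<And>x. x \<in> \<Omega> \<Longrightarrow> \<exists>!k. k < p \<and> (\<tau> ^^ k) x \<in> R"
    by (rule fundamental_domain [OF \<open>p > 0\<close> closed per free]) (auto intro: that)
  define E where "E = frag_extend (\<lambda>x. if x \<in> R then frag_of x else 0)"
  have E_simps [simp]: "E 0 = 0" "E (a - b) = E a - E b" for a b
    by (simp_all add: E_def frag_extend_diff)
  have E_sum: "E (\<Sum>i\<in>I. f i) = (\<Sum>i\<in>I. E (f i))" for f :: "nat \<Rightarrow> _" and I
    by (induction I rule: infinite_finite_induct) (auto simp: E_def frag_extend_add)
  have Tk: "(T ^^ k) a = push (\<tau> ^^ k) a" for k a by (simp add: T_def push_funpow)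
  have clk: "(\<tau> ^^ k) x \<in> \<Omega>" if "x \<in> \<Omega>" for k x
    using that by (induction k) (auto simp: closed)
  have keysE: "Poly_Mapping.keys (E a) \<subseteq> Poly_Mapping.keys a" for a
  proof -
    have "Poly_Mapping.keys (E a) \<subseteq>
        (\<Union>x\<in>Poly_Mapping.keys a. Poly_Mapping.keys (if x \<in> R then frag_of x else 0))"
      unfolding E_def by (rule keys_frag_extend)
    also have "\<dots> \<subseteq> Poly_Mapping.keys a"
      by (rule UN_least) (simp add: keys_frag_of)
    finally show ?thesis .
  qed
  have keysT: "Poly_Mapping.keys ((T ^^ k) a) \<subseteq> \<Omega>" if "Poly_Mapping.keys a \<subseteq> \<Omega>" for k a
    using keys_push [of "\<tau> ^^ k" a] that clk by (auto simp: Tk)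
  have id: "(\<Sum>k<p. (T ^^ (p - k)) (E ((T ^^ k) a))) = a" if "Poly_Mapping.keys a \<subseteq> \<Omega>" for a
    using that
  proof (induction a rule: frag_induction)
    case (one x)
    then obtain k0 where k0: "k0 < p" "(\<tau> ^^ k0) x \<in> R" "\<And>k. \<lbrakk>k < p; (\<tau> ^^ k) x \<in> R\<rbrakk> \<Longrightarrow> k = k0"
      using R by metis
    have "(\<Sum>k<p. (T ^^ (p - k)) (E ((T ^^ k) (frag_of x)))) =
          (\<Sum>k<p. if k = k0 then frag_of x else 0)"
    proof (rule sum.cong)
      fix k assume "k \<in> {..<p}"
      show "(T ^^ (p - k)) (E ((T ^^ k) (frag_of x))) = (if k = k0 then frag_of x else 0)"
      proof (cases "k = k0")
        case True
        have "(\<tau> ^^ (p - k)) ((\<tau> ^^ k) x) = (\<tau> ^^ (p - k + k)) x" by (simp only: funpow_add o_apply)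
        also have "\<dots> = x" using one per k0(1) True by simp
        finally show ?thesis using True k0(2) by (simp add: Tk E_def)
      next
        case False
        then have "(\<tau> ^^ k) x \<notin> R" using k0(3) \<open>k \<in> {..<p}\<close> by blast
        then show ?thesis using False by (simp add: Tk E_def)
      qed
    qed auto
    then show ?case using k0(1) by simp
  next
    case (diff a b)
    have "(T ^^ (p - k)) (E ((T ^^ k) (a - b))) = (T ^^ (p - k)) (E ((T ^^ k) a)) - (T ^^ (p - k)) (E ((T ^^ k) b))" for k
      by (simp add: Tk)
    then show ?case using diff by (simp add: sum_subtractf)
  qed (simp add: Tk)
  have reidx: "(\<Sum>k<p. f (p - k)) = (\<Sum>k<p. f (Suc k))" for f :: "nat \<Rightarrow> ('x \<Rightarrow>\<^sub>0 int)"
    by (rule sum.reindex_bij_witness [where i = "\<lambda>k. p - Suc k" and j = "\<lambda>k. p - Suc k"])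
       (auto simp: Suc_diff_Suc)
  show thesis
  proof (cases "even j")
    case True
    then have "T c = c" using P by (simp add: alt_op_def T_def)
    then have Tc: "(T ^^ k) c = c" for k by (induction k) auto
    have "c = (\<Sum>k<p. (T ^^ (p - k)) (E c))" using id [OF c] Tc by simp
    also have "\<dots> = (\<Sum>k<p. (T ^^ k) (T (E c)))"
      by (subst reidx) (simp add: funpow_swap1)
    also have "\<dots> = alt_op p T (Suc j) (T (E c))" using True by (simp add: alt_op_def norm_op_def)
    finally show ?thesis
      using that [of "T (E c)"] keysT [of "E c" 1] order.trans [OF keysE c] by (simp add: T_def)
  next
    case False
    then have N: "(\<Sum>k<p. (T ^^ k) c) = 0" using P by (simp add: alt_op_def norm_op_def T_def)
    define u where "u m a = (\<Sum>i<m. (T ^^ i) a)" for m a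
    have tel: "(T ^^ m) a - a = T (u m a) - u m a" for m a
    proof (induction m)
      case (Suc m)
      have "(T ^^ Suc m) a - a = (T ((T ^^ m) a) - (T ^^ m) a) + ((T ^^ m) a - a)" by simp
      also have "\<dots> = (T ((T ^^ m) a) - (T ^^ m) a) + (T (u m a) - u m a)" by (simp only: Suc)
      also have "\<dots> = T (u (Suc m) a) - u (Suc m) a" by (simp add: u_def T_def)
      finally show ?case .
    qed (simp add: u_def T_def)
    define b where "b = (\<Sum>k<p. u (p - k) (E ((T ^^ k) c)))"
    \<comment> \<open>The second sum is \<open>E\<close> of the norm of \<open>c\<close>, hence zero.\<close>
    have "c = (\<Sum>k<p. (T ^^ (p - k)) (E ((T ^^ k) c)) - E ((T ^^ k) c)) + (\<Sum>k<p. E ((T ^^ k) c))"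
      using id [OF c] by (simp add: sum_subtractf)
    also have "(\<Sum>k<p. E ((T ^^ k) c)) = 0" using N by (simp flip: E_sum)
    also have "(\<Sum>k<p. (T ^^ (p - k)) (E ((T ^^ k) c)) - E ((T ^^ k) c)) = T b - b"
      unfolding tel b_def by (simp add: sum_subtractf T_def push_sum)
    finally have "c = alt_op p T (Suc j) b" using False by (simp add: alt_op_def)
    moreover have "Poly_Mapping.keys b \<subseteq> \<Omega>"
    proof -
      have ks: "Poly_Mapping.keys (\<Sum>i\<in>I. f i) \<subseteq> \<Omega>" if "\<And>i. i \<in> I \<Longrightarrow> Poly_Mapping.keys (f i) \<subseteq> \<Omega>"
        for I :: "nat set" and f :: "nat \<Rightarrow> 'x \<Rightarrow>\<^sub>0 int"
        using keys_sum [of f I] that by blast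
      show ?thesis unfolding b_def u_def
        by (intro ks keysT order.trans [OF keysE] c)
    qed
    ultimately show ?thesis using that T_def by blast
  qed
qed

section \<open>Augmented chains of lists\<close>

definition prepend :: "'x \<Rightarrow> ('x list \<Rightarrow>\<^sub>0 int) \<Rightarrow> ('x list \<Rightarrow>\<^sub>0 int)" where
  "prepend x = push (Cons x)"

text \<open>A list of length \<open>k + 1\<close> stands for an ordered simplex of dimension \<open>k\<close>. The empty list counts as the
  face of a singleton, so \<open>bd\<close> includes the augmentation.\<close>

primrec faces :: "'x list \<Rightarrow> ('x list \<Rightarrow>\<^sub>0 int)" where
  "faces [] = 0"
| "faces (x # xs) = frag_of xs - prepend x (faces xs)"

definition bd :: "('x list \<Rightarrow>\<^sub>0 int) \<Rightarrow> ('x list \<Rightarrow>\<^sub>0 int)" where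
  "bd = frag_extend faces"

lemma bd_simps [simp]:
  "bd 0 = 0" "bd (frag_of xs) = faces xs" "bd (a + b) = bd a + bd b" "bd (a - b) = bd a - bd b"
  by (simp_all add: bd_def frag_extend_add frag_extend_diff)

lemma bd_sum: "bd (\<Sum>i\<in>I. f i) = (\<Sum>i\<in>I. bd (f i))"
  by (induction I rule: infinite_finite_induct) auto

lemma prepend_0: "prepend x 0 = 0"
  by (simp add: prepend_def)

lemma bd_prepend: "bd (prepend x c) = c - prepend x (bd c)"
  by (induction c rule: frag_all_induct) (auto simp: prepend_def)

lemma bd_faces: "bd (faces xs) = 0"
  by (induction xs) (simp_all add: bd_prepend prepend_0)

lemma bd_bd: "bd (bd c) = 0"
  by (induction c rule: frag_all_induct) (auto simp: bd_faces)

lemma faces_map: "faces (map f xs) = push (map f) (faces xs)"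
  by (induction xs) (simp_all add: prepend_def push_push)

lemma bd_push: "bd (push (map f) c) = push (map f) (bd c)"
  by (induction c rule: frag_all_induct) (auto simp: faces_map)

lemma bd_push_funpow:
  fixes f :: "'x \<Rightarrow> 'x"
  shows "bd ((push (map f) ^^ k) c) = (push (map f) ^^ k) (bd c)"
  by (induction k) (auto simp: bd_push)

lemma bd_alt_op:
  fixes f :: "'x \<Rightarrow> 'x"
  shows "bd (alt_op p (push (map f)) j c) = alt_op p (push (map f)) j (bd c)"
  by (simp add: alt_op_def norm_op_def bd_push bd_sum bd_push_funpow)

lemma push_funpow_diff:
  fixes f :: "'x \<Rightarrow> 'x"
  shows "(push f ^^ k) (a - b) = (push f ^^ k) a - (push f ^^ k) b"
  by (induction k) auto

lemma alt_op_push_diff: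
  fixes f :: "'x \<Rightarrow> 'x"
  shows "alt_op p (push f) j (a - b) = alt_op p (push f) j a - alt_op p (push f) j b"
  by (simp add: alt_op_def norm_op_def sum_subtractf push_funpow_diff)

lemma keys_bd:
  assumes "Poly_Mapping.keys c \<subseteq> A" "\<And>xs. xs \<in> A \<Longrightarrow> Poly_Mapping.keys (faces xs) \<subseteq> B"
  shows "Poly_Mapping.keys (bd c) \<subseteq> B"
  using keys_frag_extend [of faces c] assms by (auto simp: bd_def)

lemma lookup_push_map_Nil: "Poly_Mapping.lookup (push (map f) c) [] = Poly_Mapping.lookup c []"
  by (induction c rule: frag_all_induct) (auto simp: lookup_minus)

text \<open>By descending induction on \<open>j\<close>, each \<open>a j\<close> is a boundary plus an element of the image of the operator
  of index \<open>j + 1\<close>: exactness lifts such an expression for \<open>a (j + 1)\<close> to one for \<open>a j\<close>, and the induction starts because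
  \<open>a n\<close> vanishes. In degree \<open>0\<close> this makes the augmentation of \<open>a 0\<close> a norm, whose coefficient at the empty list
  is a multiple of \<open>p\<close>; but it is \<open>1\<close>.\<close>

lemma no_short_resolution:
  fixes act :: "'y \<Rightarrow> 'y" and \<Omega> :: "nat \<Rightarrow> 'y list set" and a :: "nat \<Rightarrow> ('y list \<Rightarrow>\<^sub>0 int)"
  assumes "p > 1"
    and closed: "\<And>j xs. xs \<in> \<Omega> j \<Longrightarrow> map act xs \<in> \<Omega> j"
    and per: "\<And>j xs. xs \<in> \<Omega> j \<Longrightarrow> (map act ^^ p) xs = xs"
    and free: "\<And>j xs k. \<lbrakk>xs \<in> \<Omega> j; 0 < k; k < p\<rbrakk> \<Longrightarrow> (map act ^^ k) xs \<noteq> xs"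
    and face: "\<And>j xs. xs \<in> \<Omega> (Suc j) \<Longrightarrow> Poly_Mapping.keys (faces xs) \<subseteq> \<Omega> j"
    and a: "\<And>j. j \<le> n \<Longrightarrow> Poly_Mapping.keys (a j) \<subseteq> \<Omega> j"
    and bd0: "bd (a 0) = frag_of []"
    and bdS: "\<And>j. j < n \<Longrightarrow> bd (a (Suc j)) = alt_op p (push (map act)) j (a j)"
    and an: "a n = 0"
  shows False
proof -
  let ?P = "alt_op p (push (map act))"
  have "\<exists>b b'. Poly_Mapping.keys b \<subseteq> \<Omega> j \<and> Poly_Mapping.keys b' \<subseteq> \<Omega> (Suc j) \<and>
                a j = bd b' + ?P (Suc j) b" if "j \<le> n" for j
    using that
  proof (induction j rule: inc_induct)
    case base
    show ?case
      by (rule exI [of _ 0], rule exI [of _ 0])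
         (simp add: an alt_op_def norm_op_def push_funpow)
  next
    case (step j)
    then obtain b b' where b: "Poly_Mapping.keys b \<subseteq> \<Omega> (Suc j)" "Poly_Mapping.keys b' \<subseteq> \<Omega> (Suc (Suc j))"
      and eq: "a (Suc j) = bd b' + ?P (Suc (Suc j)) b" by blast
    have kb: "Poly_Mapping.keys (bd b) \<subseteq> \<Omega> j" using b(1) face by (rule keys_bd)
    have "?P j (a j) = bd (a (Suc j))" using bdS step by simp
    also have "\<dots> = ?P j (bd b)" unfolding eq by (simp add: bd_bd bd_alt_op) (simp add: alt_op_def)
    finally have z: "?P j (a j - bd b) = 0" by (simp add: alt_op_push_diff)
    have k: "Poly_Mapping.keys (a j - bd b) \<subseteq> \<Omega> j"
      using keys_diff [of "a j" "bd b"] kb a [of j] step by auto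
    obtain b2 where "Poly_Mapping.keys b2 \<subseteq> \<Omega> j" "a j - bd b = ?P (Suc j) b2"
      by (rule free_resolution_exact [OF order.strict_trans [OF zero_less_one \<open>p > 1\<close>] closed per free k z])
         (auto intro: that)
    then show ?case using b(1) by (metis add.commute diff_add_cancel)
  qed
  then obtain b b' where "a 0 = bd b' + ?P (Suc 0) b" by blast
  then have e: "frag_of [] = norm_op p (push (map act)) (bd b)"
    using bd0 by (simp add: bd_bd bd_alt_op) (simp add: alt_op_def)
  have "1 = Poly_Mapping.lookup (norm_op p (push (map act)) (bd b)) []"
    using arg_cong [OF e, of "\<lambda>c. Poly_Mapping.lookup c []"] by simp
  also have "\<dots> = (\<Sum>k<p. Poly_Mapping.lookup ((push (map act) ^^ k) (bd b)) [])"
    by (simp add: norm_op_def lookup_sum)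
  also have "\<dots> = int p * Poly_Mapping.lookup (bd b) []"
  proof -
    have "Poly_Mapping.lookup ((push (map act) ^^ k) c) [] = Poly_Mapping.lookup c []" for k and c :: "'y list \<Rightarrow>\<^sub>0 int"
      by (induction k) (auto simp: lookup_push_map_Nil)
    then show ?thesis by simp
  qed
  finally have "int p dvd 1" by (rule dvdI)
  then show False using \<open>p > 1\<close> by simp
qed

section \<open>Barycentric flags\<close>

text \<open>The cone with apex \<open>s\<close>, the largest set that occurs. Flags that already start with \<open>s\<close> would become degenerate
  and are sent to \<open>0\<close>.\<close>

definition top_cone :: "'x set \<Rightarrow> ('x set list \<Rightarrow>\<^sub>0 int) \<Rightarrow> ('x set list \<Rightarrow>\<^sub>0 int)" where
  "top_cone s = frag_extend (\<lambda>fl. if fl \<noteq> [] \<and> hd fl = s then 0 else frag_of (s # fl))"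

lemma top_cone_simps [simp]:
  "top_cone s 0 = 0" "top_cone s (a + b) = top_cone s a + top_cone s b" "top_cone s (a - b) = top_cone s a - top_cone s b"
  "top_cone s (frag_of fl) = (if fl \<noteq> [] \<and> hd fl = s then 0 else frag_of (s # fl))"
  by (simp_all add: top_cone_def frag_extend_add frag_extend_diff)

text \<open>The barycentric subdivision of an ordered simplex, with label sets as barycentres. It turns
  lists of labels, in which repetitions make any length possible, into strictly decreasing flags, whose length is bounded
  by the number of labels, and it still commutes with boundaries (\<open>bd_flag_chain\<close>).\<close>

primrec flag_chain :: "nat \<Rightarrow> 'x list \<Rightarrow> ('x set list \<Rightarrow>\<^sub>0 int)" where
  "flag_chain 0 xs = frag_of []"
| "flag_chain (Suc k) xs = top_cone (set xs) (frag_extend (flag_chain k) (faces xs))"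

definition flags :: "nat \<Rightarrow> 'x set \<Rightarrow> 'x set list set" where
  "flags k V = {fl. length fl = k \<and> sorted_wrt (\<lambda>s t. t \<subset> s) fl \<and> (\<forall>s\<in>set fl. s \<noteq> {} \<and> s \<subseteq> V)}"

lemma keys_faces:
  "ys \<in> Poly_Mapping.keys (faces xs) \<Longrightarrow> Suc (length ys) = length xs \<and> set ys \<subseteq> set xs \<and>
     (sorted_wrt R xs \<longrightarrow> sorted_wrt R ys)"
proof (induction xs arbitrary: ys)
  case (Cons x xs)
  then have "ys = xs \<or> ys \<in> Poly_Mapping.keys (prepend x (faces xs))"
    using keys_diff [of "frag_of xs" "prepend x (faces xs)"] by (auto simp: keys_frag_of)
  then show ?case
  proof
    assume "ys \<in> Poly_Mapping.keys (prepend x (faces xs))"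
    then obtain zs where "ys = x # zs" "zs \<in> Poly_Mapping.keys (faces xs)"
      using keys_push [of "Cons x" "faces xs"] by (auto simp: prepend_def)
    then show ?thesis using Cons.IH [of zs] by auto
  qed auto
qed auto

lemma top_cone_prepend: "top_cone s (prepend s c) = 0"
  by (induction c rule: frag_all_induct) (auto simp: prepend_def)

lemma flags_mono: "V \<subseteq> W \<Longrightarrow> flags k V \<subseteq> flags k W"
  unfolding flags_def by blast

lemma flags_no_top:
  assumes "fl \<in> flags k s" "\<not> (fl \<noteq> [] \<and> hd fl = s)"
  shows "s \<notin> set fl"
  using assms by (cases fl) (auto simp: flags_def)

text \<open>The usual formula for the boundary of a cone. It survives the truncation, since a flag \<open>s # gl\<close> is the cone on
  its face \<open>gl\<close>, and the cones on its other faces vanish.\<close>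

lemma bd_top_cone:
  assumes "Poly_Mapping.keys c \<subseteq> flags k s"
  shows "bd (top_cone s c) = c - top_cone s (bd c)"
  using assms
proof (induction c rule: frag_induction)
  case (one fl)
  show ?case
  proof (cases "fl \<noteq> [] \<and> hd fl = s")
    case True
    then obtain gl where fl: "fl = s # gl" by (cases fl) auto
    have "\<not> (gl \<noteq> [] \<and> hd gl = s)" using one fl by (cases gl) (auto simp: flags_def)
    then show ?thesis using fl by (simp add: top_cone_prepend)
  next
    case False
    have "top_cone s (faces fl) = frag_extend (frag_of \<circ> Cons s) (faces fl)"
      unfolding top_cone_def
    proof (rule frag_extend_eq)
      fix gl assume "gl \<in> Poly_Mapping.keys (faces fl)"
      then have "set gl \<subseteq> set fl" using keys_faces [of gl fl "\<lambda>_ _. True"] by auto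
      then have "\<not> (gl \<noteq> [] \<and> hd gl = s)" using flags_no_top [OF one False] by (cases gl) auto
      then show "(if gl \<noteq> [] \<and> hd gl = s then 0 else frag_of (s # gl)) = (frag_of \<circ> Cons s) gl"
        by auto
    qed
    then show ?thesis using False by (auto simp add: prepend_def push_def)
  qed
qed auto

lemma keys_flag_chain:
  "length xs = k \<Longrightarrow> Poly_Mapping.keys (flag_chain k xs) \<subseteq> flags k (set xs)"
proof (induction k arbitrary: xs)
  case 0
  then show ?case by (simp add: keys_frag_of flags_def)
next
  case (Suc k)
  have inner: "Poly_Mapping.keys (frag_extend (flag_chain k) (faces xs)) \<subseteq> flags k (set xs)"
  proof -
    have "Poly_Mapping.keys (flag_chain k ys) \<subseteq> flags k (set xs)" if "ys \<in> Poly_Mapping.keys (faces xs)" for ys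
    proof -
      have y: "length ys = k" "set ys \<subseteq> set xs"
        using keys_faces [OF that, of "\<lambda>_ _. True"] Suc.prems by auto
      show ?thesis by (rule order.trans [OF Suc.IH [OF y(1)] flags_mono [OF y(2)]])
    qed
    then show ?thesis using keys_frag_extend [of "flag_chain k" "faces xs"] by blast
  qed
  have "Poly_Mapping.keys (top_cone (set xs) c) \<subseteq> flags (Suc k) (set xs)"
    if c: "Poly_Mapping.keys c \<subseteq> flags k (set xs)" for c
  proof -
    have "Poly_Mapping.keys (if fl \<noteq> [] \<and> hd fl = set xs then 0 else frag_of (set xs # fl)) \<subseteq> flags (Suc k) (set xs)"
      if "fl \<in> Poly_Mapping.keys c" for fl
    proof (cases "fl \<noteq> [] \<and> hd fl = set xs")
      case False
      have fl: "fl \<in> flags k (set xs)" using that c by blast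
      then have "set xs \<notin> set fl" using False by (rule flags_no_top)
      then have "set xs # fl \<in> flags (Suc k) (set xs)" using fl Suc.prems by (fastforce simp: flags_def)
      then show ?thesis using False by (simp add: keys_frag_of)
    qed (simp del: hd_conv_nth)
    then show ?thesis
      unfolding top_cone_def by (intro order.trans [OF keys_frag_extend] UN_least)
  qed
  then show ?case using inner by simp
qed

lemma bd_flag_chain:
  fixes xs :: "'x list"
  assumes "length xs = Suc k"
  shows "bd (flag_chain (Suc k) xs) = frag_extend (flag_chain k) (faces xs)"
  using assms
proof (induction k arbitrary: xs)
  case 0
  then obtain x where "xs = [x]" by (cases xs) auto
  then show ?case by (simp add: prepend_def)
next
  case (Suc k)
  let ?c = "frag_extend (flag_chain (Suc k)) (faces xs)"
  have keys: "ys \<in> Poly_Mapping.keys (faces xs) \<Longrightarrow> length ys = Suc k \<and> set ys \<subseteq> set xs" for ys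
    using keys_faces [of ys xs "\<lambda>_ _. True"] Suc.prems by auto
  have kc: "Poly_Mapping.keys ?c \<subseteq> flags (Suc k) (set xs)"
  proof -
    have "Poly_Mapping.keys (flag_chain (Suc k) ys) \<subseteq> flags (Suc k) (set xs)"
      if "ys \<in> Poly_Mapping.keys (faces xs)" for ys
      using keys_flag_chain [of ys "Suc k"] flags_mono [of "set ys" "set xs" "Suc k"] keys [OF that] by blast
    then show ?thesis using keys_frag_extend [of "flag_chain (Suc k)" "faces xs"] by blast
  qed
  have "bd (frag_extend (flag_chain (Suc k)) c) = frag_extend (flag_chain k) (bd c)"
    if "Poly_Mapping.keys c \<subseteq> {ys. length ys = Suc k}" for c :: "'x list \<Rightarrow>\<^sub>0 int"
    using that
    by (induction c rule: frag_induction) (simp_all add: Suc.IH frag_extend_diff del: flag_chain.simps)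
  then have "bd ?c = 0" using keys bd_faces [of xs] by (simp add: subset_iff del: flag_chain.simps)
  then show ?case using bd_top_cone [OF kc] by (simp del: flag_chain.simps add: flag_chain.simps(2) [of "Suc k" xs])
qed

lemma flags_empty:
  assumes "finite V" "card V < k"
  shows "flags k V = {}"
proof -
  have "length fl \<le> card V" if "fl \<in> flags (length fl) V" "finite V" for fl :: "'a set list" and V
    using that
  proof (induction fl arbitrary: V)
    case (Cons s fl)
    then have "finite s" "s \<noteq> {}" "s \<subseteq> V" by (auto simp: flags_def intro: finite_subset)
    show ?case
    proof (cases fl)
      case Nil
      have "card V > 0" using \<open>s \<noteq> {}\<close> \<open>s \<subseteq> V\<close> Cons.prems by (metis card_gt_0_iff subset_empty)
      then show ?thesis using Nil by simp
    next
      case (Cons t gl)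
      have t: "t \<subset> s" "finite t" using Cons.prems(1) Cons \<open>finite s\<close> by (auto simp: flags_def intro: finite_subset)
      have "fl \<in> flags (length fl) t"
        using Cons.prems(1) Cons by (auto simp: flags_def)
      then have "length fl \<le> card t" using Cons.IH t by blast
      also have "card t < card s" using t \<open>finite s\<close> psubset_card_mono by blast
      also have "card s \<le> card V" using \<open>s \<subseteq> V\<close> Cons.prems(2) card_mono by blast
      finally show ?thesis by simp
    qed
  qed auto
  then have "fl \<notin> flags k V" for fl
    using assms by (metis (mono_tags, lifting) flags_def leD mem_Collect_eq)
  then show ?thesis by blast
qed

lemma flag_chain_map:
  assumes "inj_on f V" "set xs \<subseteq> V" "length xs = k"
  shows "flag_chain k (map f xs) = push (map (image f)) (flag_chain k xs)"
  using assms
proof (induction k arbitrary: xs)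
  case (Suc k)
  let ?c = "frag_extend (flag_chain k) (faces xs)"
  have keys: "ys \<in> Poly_Mapping.keys (faces xs) \<Longrightarrow> length ys = k \<and> set ys \<subseteq> set xs" for ys
    using keys_faces [of ys xs "\<lambda>_ _. True"] Suc.prems by auto
  have kc: "Poly_Mapping.keys ?c \<subseteq> flags k (set xs)"
  proof -
    have "Poly_Mapping.keys (flag_chain k ys) \<subseteq> flags k (set xs)"
      if "ys \<in> Poly_Mapping.keys (faces xs)" for ys
      using keys_flag_chain [of ys k] flags_mono [of "set ys" "set xs" k] keys [OF that] by blast
    then show ?thesis using keys_frag_extend [of "flag_chain k" "faces xs"] by blast
  qed
  have "frag_extend (flag_chain k) (push (map f) c) = push (map (image f)) (frag_extend (flag_chain k) c)"
    if "Poly_Mapping.keys c \<subseteq> {ys. length ys = k \<and> set ys \<subseteq> set xs}" for c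
    using that
    by (induction c rule: frag_induction)
       (use Suc.IH [OF Suc.prems(1)] Suc.prems(2) in \<open>auto simp: frag_extend_diff\<close>)
  then have 1: "frag_extend (flag_chain k) (faces (map f xs)) = push (map (image f)) ?c"
    using keys by (simp add: faces_map subset_iff)
  have "top_cone (f ` set xs) (push (map (image f)) c) = push (map (image f)) (top_cone (set xs) c)"
    if "Poly_Mapping.keys c \<subseteq> flags k (set xs)" for c
    using that
  proof (induction c rule: frag_induction)
    case (one fl)
    have "hd (map (image f) fl) = f ` set xs \<longleftrightarrow> hd fl = set xs" if "fl \<noteq> []"
    proof -
      have "hd fl \<subseteq> set xs" using one that by (auto simp: flags_def)
      then show ?thesis using that Suc.prems by (simp add: hd_map inj_on_image_eq_iff [OF Suc.prems(1)])
    qed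
    then show ?case by auto
  qed auto
  then show ?case using 1 kc by simp
qed simp

section \<open>Homology of Euclidean space and chain-level tools\<close>

text \<open>In degree \<open>0\<close> a cycle represents a reduced homology class only if its coefficients add up to zero;
  that is the purpose of the last assumption.\<close>

lemma trivial_reduced_imp_relboundary:
  assumes triv: "trivial_group (reduced_homology_group (int j) X)"
    and c: "singular_relcycle j X {} c"
    and aug: "j = 0 \<Longrightarrow> chain_map 0 (\<lambda>x. ()) c = 0"
  shows "singular_relboundary j X {} c"
proof -
  have "homologous_rel_set j X {} c \<in> carrier (reduced_homology_group (int j) X)"
  proof (cases "j = 0")
    case True
    have "hom_induced (int j) X {} (discrete_topology {()}) {} (\<lambda>x. ()) (homologous_rel_set j X {} c)
        = homologous_rel_set j (discrete_topology {()}) {} (chain_map j (\<lambda>x. ()) c)"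
      by (rule hom_induced_chain_map) (use c in auto)
    also have "\<dots> = singular_relboundary_set j (discrete_topology {()}) {}"
      using aug True by (simp add: homologous_rel_set_eq_relboundary)
    finally show ?thesis
      using c by (simp add: carrier_reduced_homology_group kernel_def carrier_relative_homology_group)
  next
    case False
    then show ?thesis
      using c by (simp add: un_reduced_homology_group carrier_relative_homology_group)
  qed
  then have "homologous_rel_set j X {} c = \<one>\<^bsub>reduced_homology_group (int j) X\<^esub>"
    using triv by (simp add: trivial_group_def)
  then show ?thesis
    by (simp add: one_reduced_homology_group homologous_rel_set_eq_relboundary)
qed

lemma trivial_relative_imp_relboundary:
  assumes "trivial_group (relative_homology_group (int j) X S)" "singular_relcycle j X S c"
  shows "singular_relboundary j X S c"
proof -
  have "homologous_rel_set j X S c \<in> carrier (relative_homology_group (int j) X S)"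
    using assms by (simp add: carrier_relative_homology_group)
  then have "homologous_rel_set j X S c = \<one>\<^bsub>relative_homology_group (int j) X S\<^esub>"
    using assms by (simp add: trivial_group_def)
  then show ?thesis by (simp add: homologous_rel_set_eq_relboundary)
qed

text \<open>Euclidean space as a set of sequences, because this is the model for which relative homology groups
  of complements of points are available for all dimensions at once.\<close>

definition Rn :: "nat \<Rightarrow> (nat \<Rightarrow> real) set" where
  "Rn n = {x. \<forall>i\<ge>n. x i = 0}"

definition origin :: "nat \<Rightarrow> real" where "origin = (\<lambda>i. 0)"

lemma origin_apply [simp]: "origin i = 0" by (simp add: origin_def)
lemma origin_Rn [simp]: "origin \<in> Rn n" by (simp add: Rn_def)

lemma Euclidean_space_eq: "Euclidean_space n = top_of_set (Rn n)"
  by (simp add: Euclidean_space_def euclidean_product_topology Rn_def)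

text \<open>At the origin this is an \<open>n\<close>-fold suspension of the case of dimension \<open>0\<close>, where \<open>\<real>\<^sup>0\<close> is a point.
  Complements of different points have isomorphic relative homology.\<close>

lemma trivial_relative_homology_Rn:
  assumes "j \<noteq> int n" and x: "x \<in> Rn n"
  shows "trivial_group (relative_homology_group j (top_of_set (Rn n)) (Rn n - {x}))"
proof -
  have cl: "closedin (Euclidean_space m) {y}" if "y \<in> Rn m" for m y
  proof -
    have "y \<in> topspace (Euclidean_space m)" using that by (simp add: Euclidean_space_eq)
    then show ?thesis using closedin_Hausdorff_sing_eq [OF Hausdorff_Euclidean_space] by blast
  qed
  have z0: "Rn 0 = {origin}" by (auto simp: Rn_def origin_def)
  have "relative_homology_group (j - int n) (Euclidean_space 0) (topspace (Euclidean_space 0) - {origin})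
     \<cong> relative_homology_group (j - int n + int n) (Euclidean_space (0 + n)) (topspace (Euclidean_space (0 + n)) - {origin})"
    by (rule relative_homology_group_Euclidean_complement_step) (simp add: cl)
  then have 1: "homology_group (j - int n) (Euclidean_space 0)
     \<cong> relative_homology_group j (Euclidean_space n) (topspace (Euclidean_space n) - {origin})"
    by (simp add: Euclidean_space_eq z0)
  have "trivial_group (homology_group (j - int n) (Euclidean_space 0))"
    by (rule homology_dimension_axiom [of _ origin]) (use assms in \<open>auto simp: Euclidean_space_eq z0\<close>)
  then have 2: "trivial_group (relative_homology_group j (Euclidean_space n) (topspace (Euclidean_space n) - {origin}))"
    using 1 isomorphic_group_triviality by (metis group_relative_homology_group)
  have hs: "subtopology X {a} homeomorphic_space subtopology X {b}" if "a \<in> topspace X" "b \<in> topspace X"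
    for X :: "(nat \<Rightarrow> real) topology" and a b
    unfolding homeomorphic_space_def homeomorphic_maps_def
    by (rule exI [of _ "\<lambda>_. b"], rule exI [of _ "\<lambda>_. a"]) (use that in auto)
  have "relative_homology_group j (Euclidean_space n) (topspace (Euclidean_space n) - {origin})
      \<cong> relative_homology_group j (Euclidean_space n) (topspace (Euclidean_space n) - {x})"
    by (rule isomorphic_relative_homology_groups_Euclidean_complements)
       (use x in \<open>auto simp: cl intro!: hs simp: Euclidean_space_eq\<close>)
  then have "trivial_group (relative_homology_group j (Euclidean_space n) (topspace (Euclidean_space n) - {x}))"
    using 2 isomorphic_group_triviality by (metis group_relative_homology_group)
  then show ?thesis by (simp add: Euclidean_space_eq)
qed

lemma trivial_reduced_homology_punctured:
  assumes "n > 0" "j \<noteq> int n - 1"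
  shows "trivial_group (reduced_homology_group j (top_of_set (Rn n - {origin})))"
proof -
  have ne: "Rn n \<inter> (Rn n - {origin}) \<noteq> {}"
  proof -
    have "(\<lambda>i. if i = 0 then 1 else 0) \<in> Rn n - {origin}"
      using assms by (auto simp: Rn_def origin_def fun_eq_iff)
    then show ?thesis by blast
  qed
  have "contractible_space (top_of_set (Rn n))"
    using contractible_Euclidean_space [of n] by (simp add: Euclidean_space_eq)
  then have "hom_boundary (j + 1) (top_of_set (Rn n)) (Rn n - {origin})
      \<in> iso (relative_homology_group (j + 1) (top_of_set (Rn n)) (Rn n - {origin}))
            (reduced_homology_group (j + 1 - 1) (subtopology (top_of_set (Rn n)) (Rn n - {origin})))"
    by (rule iso_relative_homology_of_contractible) (use ne in simp)
  then have "relative_homology_group (j + 1) (top_of_set (Rn n)) (Rn n - {origin})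
      \<cong> reduced_homology_group j (top_of_set (Rn n - {origin}))"
    by (simp add: subtopology_subtopology Int_absorb1 is_isoI)
  moreover have "trivial_group (relative_homology_group (j + 1) (top_of_set (Rn n)) (Rn n - {origin}))"
    by (rule trivial_relative_homology_Rn) (use assms in auto)
  ultimately show ?thesis
    using isomorphic_group_triviality by (metis group_relative_homology_group group_reduced_homology_group)
qed

lemma homologous_rel_chain_map:
  assumes "homologous_rel k X S c c'" "continuous_map X Y f" "f \<in> S \<rightarrow> T"
  shows "homologous_rel k Y T (chain_map k f c) (chain_map k f c')"
  using singular_relboundary_chain_map [OF _ assms(2,3)] assms(1)
  by (simp add: homologous_rel_def flip: chain_map_diff)

lemma homologous_rel_mono:
  assumes "homologous_rel k X S c c'" "S \<subseteq> T"
  shows "homologous_rel k X T c c'"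
  using assms singular_chain_mono unfolding homologous_rel_def singular_relboundary by blast

lemma singular_relboundary_mono:
  assumes "singular_relboundary k X S c" "S \<subseteq> T"
  shows "singular_relboundary k X T c"
  using assms singular_chain_mono unfolding singular_relboundary by blast

lemma singular_relcycle_mono:
  assumes "singular_relcycle k X S c" "S \<subseteq> T"
  shows "singular_relcycle k X T c"
  using assms singular_chain_mono unfolding singular_relcycle by blast

lemma homotopy_imp_homologous_rel:
  fixes S :: "'a::topological_space set" and U :: "'b::topological_space set"
  assumes c: "singular_relcycle k (top_of_set S) T c" and "T \<subseteq> S"
    and cont: "continuous_on ({0..1::real} \<times> S) (\<lambda>z. h (fst z) (snd z))"
    and U: "\<And>t x. \<lbrakk>0 \<le> t; t \<le> 1; x \<in> S\<rbrakk> \<Longrightarrow> h t x \<in> U"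
    and V: "\<And>t x. \<lbrakk>0 \<le> t; t \<le> 1; x \<in> T\<rbrakk> \<Longrightarrow> h t x \<in> V"
  shows "homologous_rel k (top_of_set U) V (chain_map k (h 0) c) (chain_map k (h 1) c)"
proof -
  have "homotopic_with (\<lambda>f. f \<in> T \<rightarrow> V) (top_of_set S) (top_of_set U) (h 0) (h 1)"
    unfolding homotopic_with_def prod_topology_subtopology_eu
    by (rule exI [of _ "\<lambda>z. h (fst z) (snd z)"]) (use cont U V in auto)
  then show ?thesis using c by (rule homotopic_imp_homologous_rel_chain_maps)
qed

text \<open>Subdivide \<open>t\<close> until each simplex misses \<open>A\<close> or misses \<open>B\<close>. Subdivision changes the boundary, but the chain homotopy
  that connects it to the identity preserves supports, so the change in the boundary can be attributed to the two parts
  \<open>\<alpha>\<close> and \<open>\<beta>\<close> separately.\<close>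

lemma split_chain:
  assumes A: "closedin X A" and B: "closedin X B" and "i \<ge> 1"
    and t: "singular_chain i (subtopology X (topspace X - A \<inter> B)) t"
    and bt: "chain_boundary i t = \<alpha> + \<beta>"
    and \<alpha>: "singular_chain (i - 1) (subtopology X (topspace X - A)) \<alpha>"
    and \<beta>: "singular_chain (i - 1) (subtopology X (topspace X - B)) \<beta>"
  obtains tA tB w where "singular_chain i (subtopology X (topspace X - A)) tA" "singular_chain i (subtopology X (topspace X - B)) tB"
    "singular_chain (Suc i) (subtopology X (topspace X - A \<inter> B)) w" "t = tA + tB + chain_boundary (Suc i) w"
proof -
  let ?X = "subtopology X (topspace X - A \<inter> B)"
  let ?C = "{topspace X - A, topspace X - B}"
  have op: "openin ?X U" if "U \<in> ?C" for U
  proof -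
    have "openin X U" "U \<subseteq> topspace X - A \<inter> B" using that A B by (auto simp: closedin_def)
    then show ?thesis by (auto simp: openin_subtopology)
  qed
  have cover: "topspace ?X \<subseteq> \<Union>?C" by auto
  obtain m where m': "\<And>m' f. \<lbrakk>m \<le> m'; f \<in> Poly_Mapping.keys ((singular_subdivision i ^^ m') t)\<rbrakk> \<Longrightarrow>
       \<exists>V\<in>?C. f \<in> standard_simplex i \<rightarrow> V"
    by (rule sufficient_iterated_singular_subdivision_exists [OF op cover t]) (assumption, rule that)
  note m = m' [OF order_refl]
  obtain h where h0: "\<And>p. h p 0 = (0 :: 'a chain)"
    and hd: "\<And>p c1 c2. h p (c1 - c2) = h p c1 - h p c2"
    and hs: "\<And>p X c. singular_chain p X c \<Longrightarrow> singular_chain (Suc p) X (h p c)"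
    and hb: "\<And>p X c. singular_chain p X c \<Longrightarrow>
         chain_boundary (Suc p) (h p c) + h (p - Suc 0) (chain_boundary p c) = (singular_subdivision p ^^ m) c - c"
    using chain_homotopic_iterated_singular_subdivision [of m] by blast
  let ?s = "(singular_subdivision i ^^ m) t"
  have sd: "singular_chain i ?X ?s"
    using t by (induction m) (auto simp: singular_chain_singular_subdivision)
  have "Poly_Mapping.keys ?s \<subseteq> {f. singular_simplex i (subtopology X (topspace X - A)) f} \<union> {f. singular_simplex i (subtopology X (topspace X - B)) f}"
  proof
    fix f assume f: "f \<in> Poly_Mapping.keys ?s"
    then have "singular_simplex i X f"
      using sd by (auto simp: singular_chain_def singular_simplex_subtopology)
    then show "f \<in> {f. singular_simplex i (subtopology X (topspace X - A)) f} \<union> {f. singular_simplex i (subtopology X (topspace X - B)) f}"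
      using m [OF f] by (auto simp: singular_simplex_subtopology Pi_iff)
  qed
  then obtain sA sB where s: "Poly_Mapping.keys sA \<subseteq> {f. singular_simplex i (subtopology X (topspace X - A)) f}"
    "Poly_Mapping.keys sB \<subseteq> {f. singular_simplex i (subtopology X (topspace X - B)) f}" "sA + sB = ?s"
    by (rule frag_split)
  have eq: "chain_boundary (Suc i) (h i t) + h (i - 1) (\<alpha> + \<beta>) = ?s - t"
    using hb [OF t] bt by simp
  have hadd: "h (i - 1) (\<alpha> + \<beta>) = h (i - 1) \<alpha> + h (i - 1) \<beta>"
    using hd [of "i - 1" \<alpha> "0 - \<beta>"] hd [of "i - 1" 0 \<beta>] h0 by simp
  show thesis
  proof
    show "singular_chain i (subtopology X (topspace X - A)) (sA - h (i - 1) \<alpha>)"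
      using hs [OF \<alpha>] s(1) \<open>i \<ge> 1\<close> by (intro singular_chain_diff) (auto simp: singular_chain_def)
    show "singular_chain i (subtopology X (topspace X - B)) (sB - h (i - 1) \<beta>)"
      using hs [OF \<beta>] s(2) \<open>i \<ge> 1\<close> by (intro singular_chain_diff) (auto simp: singular_chain_def)
    show "singular_chain (Suc i) ?X (- h i t)" using hs [OF t] by (simp add: singular_chain_minus)
    show "t = sA - h (i - 1) \<alpha> + (sB - h (i - 1) \<beta>) + chain_boundary (Suc i) (- h i t)"
      using eq [unfolded hadd] s(3) by (simp add: chain_boundary_minus algebra_simps)
  qed
qed

section \<open>Detecting relative classes at points\<close>

text \<open>A class relative to the complement of \<open>A\<close>, in degrees from the dimension upwards, vanishes as soon as it vanishes locally
  at each point of \<open>A\<close>. This is the uniqueness half of the construction of fundamental classes.\<close>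

definition detects :: "nat \<Rightarrow> (nat \<Rightarrow> real) set \<Rightarrow> bool" where
  "detects n A \<longleftrightarrow> (\<forall>i\<ge>n. \<forall>c. singular_relcycle i (top_of_set (Rn n)) (Rn n - A) c \<and>
      (\<forall>x\<in>A. singular_relboundary i (top_of_set (Rn n)) (Rn n - {x}) c) \<longrightarrow>
      singular_relboundary i (top_of_set (Rn n)) (Rn n - A) c)"

lemma detectsD:
  assumes "detects n A" "n \<le> i" "singular_relcycle i (top_of_set (Rn n)) (Rn n - A) c"
    and "\<And>x. x \<in> A \<Longrightarrow> singular_relboundary i (top_of_set (Rn n)) (Rn n - {x}) c"
  shows "singular_relboundary i (top_of_set (Rn n)) (Rn n - A) c"
  using assms unfolding detects_def by blast

lemma subtopology_Rn [simp]: "subtopology (top_of_set (Rn n)) (Rn n - A) = top_of_set (Rn n - A)"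
  by (simp add: subtopology_subtopology Int_absorb1)

lemma relboundary_at_point:
  assumes "n < i" "x \<in> Rn n" "singular_relcycle i (top_of_set (Rn n)) (Rn n - {x}) c"
  shows "singular_relboundary i (top_of_set (Rn n)) (Rn n - {x}) c"
  by (rule trivial_relative_imp_relboundary [OF trivial_relative_homology_Rn]) (use assms in auto)

lemma singular_relboundaryE:
  assumes "singular_relboundary i X S c"
  obtains d e where "singular_chain (Suc i) X d" "singular_chain i (subtopology X S) e"
    "c = chain_boundary (Suc i) d + e"
  using assms unfolding singular_relboundary by metis

lemma singular_relboundaryI:
  assumes "singular_chain (Suc i) X d" "singular_chain i (subtopology X S) e"
    "c = chain_boundary (Suc i) d + e"
  shows "singular_relboundary i X S c"
  using assms unfolding singular_relboundary by metis

lemma singular_chain_sub: "singular_chain i (subtopology X S) c \<Longrightarrow> singular_chain i X c"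
  by (simp add: singular_chain_subtopology)

text \<open>A Mayer-Vietoris argument carried out on chains. Let \<open>eA\<close> and \<open>eB\<close> be fillings relative to the complements of \<open>A\<close> and
  \<open>B\<close>. Their difference is a cycle of degree one higher relative to the complement of \<open>A \<inter> B\<close>; local homology at
  points vanishes there, so the hypothesis on \<open>A \<inter> B\<close> applies and allows the fillings to be adjusted until they agree.\<close>

lemma detects_Un:
  assumes "n > 0" and A: "closedin (top_of_set (Rn n)) A" and B: "closedin (top_of_set (Rn n)) B"
    and dA: "detects n A" and dB: "detects n B" and dAB: "detects n (A \<inter> B)"
  shows "detects n (A \<union> B)"
  unfolding detects_def
proof (intro allI impI, elim conjE)
  fix i c
  let ?X = "top_of_set (Rn n)"
  assume "n \<le> i" and c: "singular_relcycle i ?X (Rn n - (A \<union> B)) c"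
    and loc: "\<forall>x\<in>A \<union> B. singular_relboundary i ?X (Rn n - {x}) c"
  have AR: "A \<subseteq> Rn n" "B \<subseteq> Rn n" using A B closedin_subset by force+
  have "singular_relboundary i ?X (Rn n - A) c"
    by (rule detectsD [OF dA \<open>n \<le> i\<close> singular_relcycle_mono [OF c]]) (use loc in auto)
  then obtain eA sA where A': "singular_chain (Suc i) ?X eA" "singular_chain i (top_of_set (Rn n - A)) sA"
    "c = chain_boundary (Suc i) eA + sA"
    by (metis singular_relboundaryE subtopology_Rn)
  have "singular_relboundary i ?X (Rn n - B) c"
    by (rule detectsD [OF dB \<open>n \<le> i\<close> singular_relcycle_mono [OF c]]) (use loc in auto)
  then obtain eB sB where B': "singular_chain (Suc i) ?X eB" "singular_chain i (top_of_set (Rn n - B)) sB"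
    "c = chain_boundary (Suc i) eB + sB"
    by (metis singular_relboundaryE subtopology_Rn)
  let ?u = "eA - eB"
  have bu: "chain_boundary (Suc i) ?u = (- sA) + sB"
    using A'(3) B'(3) by (simp add: chain_boundary_diff algebra_simps)
  have up: "singular_chain i (top_of_set (Rn n - A \<inter> B)) sA" "singular_chain i (top_of_set (Rn n - A \<inter> B)) sB"
  proof -
    have mono: "singular_chain i (top_of_set (Rn n - A \<inter> B)) s"
      if "singular_chain i (top_of_set (Rn n - C)) s" "A \<inter> B \<subseteq> C" for s C
      using singular_chain_mono [of i ?X "Rn n - C" s "Rn n - A \<inter> B"] that unfolding subtopology_Rn by blast
    show "singular_chain i (top_of_set (Rn n - A \<inter> B)) sA" by (rule mono [OF A'(2)]) blast
    show "singular_chain i (top_of_set (Rn n - A \<inter> B)) sB" by (rule mono [OF B'(2)]) blast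
  qed
  have u: "singular_relcycle (Suc i) ?X (Rn n - A \<inter> B) ?u"
    unfolding singular_relcycle using A'(1) B'(1) up
    by (auto simp: bu singular_chain_diff intro: singular_chain_diff)
  have "singular_relboundary (Suc i) ?X (Rn n - {x}) ?u" if "x \<in> A \<inter> B" for x
  proof (rule relboundary_at_point)
    show "singular_relcycle (Suc i) ?X (Rn n - {x}) ?u"
      by (rule singular_relcycle_mono [OF u]) (use that in auto)
  qed (use \<open>n \<le> i\<close> AR that in auto)
  from detectsD [OF dAB _ u this] have "singular_relboundary (Suc i) ?X (Rn n - A \<inter> B) ?u"
    using \<open>n \<le> i\<close> by simp
  then obtain q t where q: "singular_chain (Suc (Suc i)) ?X q"
    "singular_chain (Suc i) (subtopology ?X (topspace ?X - A \<inter> B)) t"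
    "?u = chain_boundary (Suc (Suc i)) q + t"
    using singular_relboundaryE [of "Suc i" ?X "Rn n - A \<inter> B" ?u]
    unfolding topspace_euclidean_subtopology by metis
  have bt: "chain_boundary (Suc i) t = (- sA) + sB"
    using bu arg_cong [OF q(3), of "chain_boundary (Suc i)"] chain_boundary_boundary_alt [OF q(1)]
    by (simp add: chain_boundary_add)
  obtain tA tB w where w: "singular_chain (Suc i) (subtopology ?X (topspace ?X - A)) tA"
     "singular_chain (Suc i) (subtopology ?X (topspace ?X - B)) tB"
     "singular_chain (Suc (Suc i)) (subtopology ?X (topspace ?X - A \<inter> B)) w"
     "t = tA + tB + chain_boundary (Suc (Suc i)) w"
  proof (rule split_chain [OF A B _ q(2) bt])
  qed (use A'(2) B'(2) in \<open>auto simp: singular_chain_minus\<close>)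
  let ?e = "eA - tA - chain_boundary (Suc (Suc i)) (q + w)"
  have e2: "?e = eB + tB" using q(3) w(4) by (simp add: chain_boundary_add algebra_simps)
  let ?r = "c - chain_boundary (Suc i) ?e"
  have qw: "singular_chain (Suc (Suc i)) ?X (q + w)" using q(1) w(3) singular_chain_sub by (blast intro: singular_chain_add)
  have r1: "?r = sA + chain_boundary (Suc i) tA"
    using A'(3) chain_boundary_boundary_alt [OF qw] by (simp add: chain_boundary_diff)
  have r2: "?r = sB - chain_boundary (Suc i) tB"
    unfolding e2 using B'(3) by (simp add: chain_boundary_add)
  have "singular_chain i (top_of_set (Rn n - A)) ?r" unfolding r1
    using A'(2) singular_chain_boundary_alt [OF w(1)] by (auto intro: singular_chain_add)
  moreover have "singular_chain i (top_of_set (Rn n - B)) ?r" unfolding r2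
    using B'(2) singular_chain_boundary_alt [OF w(2)] by (auto intro: singular_chain_diff)
  ultimately have "singular_chain i (top_of_set (Rn n - (A \<union> B))) ?r"
    unfolding singular_chain_subtopology by blast
  moreover have "singular_chain (Suc i) ?X ?e"
    using A'(1) w(1) singular_chain_boundary_alt [OF qw] singular_chain_sub by (blast intro: singular_chain_diff)
  ultimately show "singular_relboundary i ?X (Rn n - (A \<union> B)) c"
    by (intro singular_relboundaryI [of i ?X ?e _ ?r]) auto
qed

definition l1_norm :: "nat \<Rightarrow> (nat \<Rightarrow> real) \<Rightarrow> real" where "l1_norm n x = (\<Sum>i<n. \<bar>x i\<bar>)"

lemma l1_norm_pos: "\<lbrakk>x \<in> Rn n; y \<in> Rn n; x \<noteq> y\<rbrakk> \<Longrightarrow> l1_norm n (\<lambda>i. x i - y i) > 0"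
proof -
  assume *: "x \<in> Rn n" "y \<in> Rn n" "x \<noteq> y"
  then obtain i where "x i \<noteq> y i" by auto
  moreover then have "i < n" using * by (auto simp: Rn_def intro: leI)
  ultimately show ?thesis unfolding l1_norm_def by (intro sum_pos2 [of _ i]) auto
qed

text \<open>For \<open>A\<close> bounded and star-shaped about \<open>a\<close>, moving every point away from \<open>a\<close> by more than the size of \<open>A\<close> deforms the
  complement of \<open>a\<close> into the complement of \<open>A\<close>, and preserves the complement of \<open>A\<close> on the way.\<close>

lemma radial_push:
  assumes AR: "A \<subseteq> Rn n" and a: "a \<in> A"
    and bnd: "\<And>x. x \<in> A \<Longrightarrow> l1_norm n (\<lambda>i. x i - a i) \<le> R"
    and star: "\<And>y s. \<lbrakk>y \<in> Rn n - A; s \<ge> 1\<rbrakk> \<Longrightarrow> (\<lambda>i. a i + s * (y i - a i)) \<notin> A"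
  obtains r where "continuous_map (top_of_set (Rn n - {a})) (top_of_set (Rn n - A)) r"
    "\<And>k c. singular_relcycle k (top_of_set (Rn n - A)) {} c \<Longrightarrow>
        homologous_rel k (top_of_set (Rn n - A)) {} c (chain_map k r c)"
    "\<And>k c. singular_relcycle k (top_of_set (Rn n - {a})) {} c \<Longrightarrow>
        homologous_rel k (top_of_set (Rn n - {a})) {} c (chain_map k r c)"
proof -
  \<comment> \<open>At time \<open>1\<close> the \<open>l1\<close>-distance from \<open>a\<close> has grown by exactly \<open>R + 1\<close>.\<close>
  define h where "h t y = (\<lambda>i. a i + (1 + t * ((R + 1) / l1_norm n (\<lambda>i. y i - a i))) * (y i - a i))"
    for t :: real and y :: "nat \<Rightarrow> real"
  have "R \<ge> 0" using bnd [OF a] by (simp add: l1_norm_def)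
  have aR: "a \<in> Rn n" using a AR by blast
  have hR: "h t y \<in> Rn n" if "y \<in> Rn n" for t y
    using that aR by (simp add: h_def Rn_def)
  have pos: "l1_norm n (\<lambda>i. y i - a i) > 0" if "y \<in> Rn n - {a}" for y
    using that aR l1_norm_pos by auto
  have h1: "h 1 y \<in> Rn n - A" if "y \<in> Rn n - {a}" for y
  proof -
    have p: "l1_norm n (\<lambda>i. y i - a i) > 0" by (rule pos [OF that])
    have "l1_norm n (\<lambda>i. h 1 y i - a i) = (1 + (R + 1) / l1_norm n (\<lambda>i. y i - a i)) * l1_norm n (\<lambda>i. y i - a i)"
      using p \<open>R \<ge> 0\<close> by (simp add: h_def l1_norm_def abs_mult sum_distrib_left)
    also have "\<dots> = l1_norm n (\<lambda>i. y i - a i) + (R + 1)" using p by (simp add: field_simps)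
    finally have "l1_norm n (\<lambda>i. h 1 y i - a i) > R" using p by simp
    then show ?thesis using bnd hR that by fastforce
  qed
  have hA: "h t y \<in> Rn n - A" if "0 \<le> t" "y \<in> Rn n - A" for t y
  proof -
    have "y \<in> Rn n - {a}" using that a by auto
    then have "1 + t * ((R + 1) / l1_norm n (\<lambda>i. y i - a i)) \<ge> 1"
      using that pos \<open>R \<ge> 0\<close> by (simp add: less_imp_le)
    then show ?thesis using star that hR unfolding h_def by auto
  qed
  have cont: "continuous_on ({0..1::real} \<times> (Rn n - {a})) (\<lambda>z. h (fst z) (snd z))"
  proof (rule continuous_on_coordinatewise_then_product)
    fix j
    have pr: "continuous_on S (\<lambda>z. snd z k)" for S :: "(real \<times> (nat \<Rightarrow> real)) set" and k
      by (rule continuous_on_compose2 [OF continuous_on_product_coordinates continuous_on_snd [OF continuous_on_id]]) auto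
    show "continuous_on ({0..1::real} \<times> (Rn n - {a})) (\<lambda>z. h (fst z) (snd z) j)"
      unfolding h_def l1_norm_def
      by (intro continuous_intros pr) (use pos in \<open>force simp: l1_norm_def\<close>)
  qed
  have contr: "continuous_on (Rn n - {a}) (h 1)"
  proof -
    have "continuous_on (Rn n - {a}) (\<lambda>y. h (fst (1::real, y)) (snd (1::real, y)))"
      by (rule continuous_on_compose2 [OF cont]) (intro continuous_on_Pair continuous_on_const continuous_on_id, auto)
    then show ?thesis by simp
  qed
  have ha: "h t y \<in> Rn n - {a}" if "0 \<le> t" "y \<in> Rn n - {a}" for t y
  proof -
    have "y \<noteq> a" using that by auto
    then obtain i where i: "y i \<noteq> a i" by (auto simp: fun_eq_iff)
    have "1 + t * ((R + 1) / l1_norm n (\<lambda>i. y i - a i)) > 0"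
      using that pos \<open>R \<ge> 0\<close> by (simp add: less_imp_le add_pos_nonneg)
    then have "h t y i \<noteq> a i" using i by (simp add: h_def)
    then show ?thesis using hR that by auto
  qed
  have hom: "homologous_rel k (top_of_set S) {} c (chain_map k (h 1) c)"
    if "singular_relcycle k (top_of_set S) {} c" "S \<subseteq> Rn n - {a}"
      "\<And>t y. \<lbrakk>0 \<le> t; y \<in> S\<rbrakk> \<Longrightarrow> h t y \<in> S" for S k c
  proof -
    have "homologous_rel k (top_of_set S) {} (chain_map k (h 0) c) (chain_map k (h 1) c)"
      by (rule homotopy_imp_homologous_rel [OF that(1) _ continuous_on_subset [OF cont]]) (use that in auto)
    moreover have "chain_map k (h 0) c = c"
      by (rule chain_map_id_gen [of _ "top_of_set S"]) (use that(1) in \<open>auto simp: singular_cycle h_def\<close>)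
    ultimately show ?thesis by simp
  qed
  show thesis
  proof
    show "continuous_map (top_of_set (Rn n - {a})) (top_of_set (Rn n - A)) (h 1)"
      using h1 contr by (auto simp: image_subset_iff)
    show "homologous_rel k (top_of_set (Rn n - A)) {} c (chain_map k (h 1) c)"
      if "singular_relcycle k (top_of_set (Rn n - A)) {} c" for k c
      by (rule hom [OF that]) (use a hA in auto)
    show "homologous_rel k (top_of_set (Rn n - {a})) {} c (chain_map k (h 1) c)"
      if "singular_relcycle k (top_of_set (Rn n - {a})) {} c" for k c
      by (rule hom [OF that]) (use ha in auto)
  qed
qed

text \<open>The radial push shows that the boundary of \<open>c\<close>, which bounds off \<open>a\<close>, also bounds off \<open>A\<close>. Correcting \<open>c\<close> by
  such a filling gives an absolute cycle, and \<open>\<real>\<^sup>n\<close> is contractible.\<close>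

lemma radial_detects:
  assumes "i > 0" and AR: "A \<subseteq> Rn n" and a: "a \<in> A"
    and bnd: "\<And>x. x \<in> A \<Longrightarrow> l1_norm n (\<lambda>i. x i - a i) \<le> R"
    and star: "\<And>y s. \<lbrakk>y \<in> Rn n - A; s \<ge> 1\<rbrakk> \<Longrightarrow> (\<lambda>i. a i + s * (y i - a i)) \<notin> A"
    and c: "singular_relcycle i (top_of_set (Rn n)) (Rn n - A) c"
    and loc: "singular_relboundary i (top_of_set (Rn n)) (Rn n - {a}) c"
  shows "singular_relboundary i (top_of_set (Rn n)) (Rn n - A) c"
proof -
  let ?X = "top_of_set (Rn n)"
  obtain r where r: "continuous_map (top_of_set (Rn n - {a})) (top_of_set (Rn n - A)) r"
    "\<And>k c. singular_relcycle k (top_of_set (Rn n - A)) {} c \<Longrightarrow>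
        homologous_rel k (top_of_set (Rn n - A)) {} c (chain_map k r c)"
    using radial_push [OF AR a bnd star] by metis
  obtain e s where es: "singular_chain (Suc i) ?X e" "singular_chain i (top_of_set (Rn n - {a})) s"
    "c = chain_boundary (Suc i) e + s"
    using loc by (metis singular_relboundaryE subtopology_Rn)
  let ?b = "chain_boundary i c"
  have bs: "?b = chain_boundary i s"
    using es(3) chain_boundary_boundary_alt [OF es(1)] by (simp add: chain_boundary_add)
  have b0: "chain_boundary (i - 1) ?b = 0"
    using c chain_boundary_boundary unfolding singular_relcycle by fastforce
  have bA: "singular_relcycle (i - 1) (top_of_set (Rn n - A)) {} ?b"
    unfolding singular_cycle using c b0 by (auto simp: singular_relcycle)
  have "homologous_rel (i - 1) (top_of_set (Rn n - A)) {} ?b (chain_map (i - 1) r ?b)"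
    by (rule r(2) [OF bA])
  moreover have "singular_relboundary (i - 1) (top_of_set (Rn n - A)) {} (chain_map (i - 1) r ?b)"
  proof (rule singular_relboundary_chain_map [OF _ r(1)])
    show "singular_relboundary (i - 1) (top_of_set (Rn n - {a})) {} ?b"
      unfolding singular_boundary bs using es(2) \<open>i > 0\<close> by auto
  qed auto
  ultimately have "singular_relboundary (i - 1) (top_of_set (Rn n - A)) {} ?b"
    unfolding homologous_rel_def by (metis diff_add_cancel singular_relboundary_add)
  then obtain s' where s': "singular_chain i (top_of_set (Rn n - A)) s'" "chain_boundary i s' = ?b"
    unfolding singular_boundary using \<open>i > 0\<close> by auto
  have "singular_relcycle i ?X {} (c - s')"
  proof -
    have "singular_chain i ?X s'" using s'(1) by (metis singular_chain_sub subtopology_Rn)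
    then show ?thesis using c s'(2)
      by (auto simp: singular_cycle singular_relcycle chain_boundary_diff intro: singular_chain_diff)
  qed
  then have "singular_relboundary i ?X {} (c - s')"
    by (rule trivial_reduced_imp_relboundary [rotated])
       (use \<open>i > 0\<close> contractible_Euclidean_space [of n] in
         \<open>auto simp: Euclidean_space_eq intro: trivial_reduced_homology_group_contractible_space\<close>)
  then obtain d where "singular_chain (Suc i) ?X d" "chain_boundary (Suc i) d = c - s'"
    unfolding singular_boundary by blast
  then show ?thesis using s'(1) by (intro singular_relboundaryI [of i ?X d _ s']) auto
qed

definition box_in :: "nat \<Rightarrow> (nat \<Rightarrow> real) \<Rightarrow> (nat \<Rightarrow> real) \<Rightarrow> (nat \<Rightarrow> real) set" where
  "box_in n l u = {x \<in> Rn n. \<forall>i<n. l i \<le> x i \<and> x i \<le> u i}"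

lemma box_in_Int: "box_in n l u \<inter> box_in n l' u' = box_in n (\<lambda>i. max (l i) (l' i)) (\<lambda>i. min (u i) (u' i))"
  by (auto simp: box_in_def)

lemma closed_coord: "closed {x :: nat \<Rightarrow> real. l \<le> x i \<and> x i \<le> u}"
  unfolding Collect_conj_eq
  by (intro closed_Int closed_Collect_le continuous_on_const continuous_on_product_coordinates)

lemma closed_Rn: "closed (Rn n)"
proof -
  have "Rn n = (\<Inter>i\<in>{n..}. {x. 0 \<le> x i \<and> x i \<le> 0})"
    by (auto simp: Rn_def) (metis atLeast_iff order_antisym)
  then show ?thesis by (simp only:) (intro closed_INT ballI closed_coord)
qed

lemma closed_box_in: "closed (box_in n l u)"
proof -
  have "box_in n l u = Rn n \<inter> (\<Inter>i\<in>{..<n}. {x. l i \<le> x i \<and> x i \<le> u i})"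
    by (auto simp: box_in_def)
  then show ?thesis by (simp only:) (intro closed_INT closed_Int closed_Rn ballI closed_coord)
qed

lemma box_in_radial_detects:
  assumes "i > 0" and a: "a \<in> box_in n l u"
    and c: "singular_relcycle i (top_of_set (Rn n)) (Rn n - box_in n l u) c"
    and loc: "singular_relboundary i (top_of_set (Rn n)) (Rn n - {a}) c"
  shows "singular_relboundary i (top_of_set (Rn n)) (Rn n - box_in n l u) c"
proof (rule radial_detects [OF \<open>i > 0\<close> _ a _ _ c loc])
  show "box_in n l u \<subseteq> Rn n" by (auto simp: box_in_def)
  show "l1_norm n (\<lambda>i. x i - a i) \<le> (\<Sum>i<n. u i - l i)" if "x \<in> box_in n l u" for x
    unfolding l1_norm_def
  proof (rule sum_mono)
    fix i assume "i \<in> {..<n}"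
    then have "l i \<le> x i" "x i \<le> u i" "l i \<le> a i" "a i \<le> u i" using a that by (auto simp: box_in_def)
    then show "\<bar>x i - a i\<bar> \<le> u i - l i" by linarith
  qed
  show "(\<lambda>i. a i + s * (y i - a i)) \<notin> box_in n l u" if y: "y \<in> Rn n - box_in n l u" and s: "s \<ge> 1" for y s
  proof
    assume z: "(\<lambda>i. a i + s * (y i - a i)) \<in> box_in n l u"
    have "l i \<le> y i \<and> y i \<le> u i" if "i < n" for i
    proof -
      define z where "z = a i + s * (y i - a i)"
      have zz: "l i \<le> z" "z \<le> u i" "l i \<le> a i" "a i \<le> u i"
        using z a that by (auto simp: box_in_def z_def)
      have "y i = (1 - 1 / s) * a i + (1 / s) * z" using s by (simp add: z_def field_simps)
      moreover have "0 \<le> 1 / s" "1 / s \<le> 1" using s by auto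
      ultimately show ?thesis
        using convex_bound_le [of "- a i" "- l i" "- z" "1 - 1/s" "1/s"] convex_bound_le [of "a i" "u i" z "1 - 1/s" "1/s"] zz
        by (simp add: algebra_simps)
    qed
    then show False using y by (auto simp: box_in_def)
  qed
qed

lemma detects_empty: "detects n {}"
  unfolding detects_def
  by (auto simp: singular_relcycle subtopology_subtopology intro!: singular_chain_imp_relboundary)

lemma detects_box_in: "n > 0 \<Longrightarrow> detects n (box_in n l u)"
proof (cases "box_in n l u = {}")
  case False
  then obtain a where "a \<in> box_in n l u" by blast
  moreover assume "n > 0"
  ultimately have "singular_relboundary i (top_of_set (Rn n)) (Rn n - box_in n l u) c"
    if "n \<le> i" "singular_relcycle i (top_of_set (Rn n)) (Rn n - box_in n l u) c"
      "\<forall>x\<in>box_in n l u. singular_relboundary i (top_of_set (Rn n)) (Rn n - {x}) c" for i c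
    using that by (intro box_in_radial_detects [of i a]) auto
  then show ?thesis by (simp add: detects_def)
qed (simp add: detects_empty)

text \<open>Boxes are closed under intersection, so \<open>detects_Un\<close> can be iterated: both the union of the remaining boxes and its
  intersection with the removed box involve fewer boxes.\<close>

lemma detects_Union_boxes:
  assumes "n > 0" "finite F" "\<And>A. A \<in> F \<Longrightarrow> \<exists>l u. A = box_in n l u"
  shows "detects n (\<Union>F)"
  using assms(2,3)
proof (induction "card F" arbitrary: F rule: less_induct)
  case less
  show ?case
  proof (cases "F = {}")
    case False
    then obtain A where A: "A \<in> F" by blast
    define F' where "F' = F - {A}"
    obtain l u where lu: "A = box_in n l u" using less.prems A by blast
    have F': "finite F'" "card F' < card F" "F = insert A F'" "\<And>B. B \<in> F' \<Longrightarrow> \<exists>l u. B = box_in n l u"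
      using less.prems A card_Diff1_less [OF less.prems(1) A] by (auto simp: F'_def simp del: card_Diff_singleton)
    have cl: "closedin (top_of_set (Rn n)) B" if "closed B" "B \<subseteq> Rn n" for B
      using that by (simp add: closed_subset)
    have sub: "B \<subseteq> Rn n" "closed B" if "B \<in> F" for B
      using less.prems(2) [OF that] closed_box_in by (auto simp: box_in_def)
    have "detects n (A \<union> \<Union>F')"
    proof (rule detects_Un [OF \<open>n > 0\<close>])
      show "closedin (top_of_set (Rn n)) A" using A sub cl by blast
      show "closedin (top_of_set (Rn n)) (\<Union>F')" using F' sub by (intro cl closed_Union) auto
      show "detects n A" using lu detects_box_in \<open>n > 0\<close> by simp
      show "detects n (\<Union>F')" by (rule less.hyps) (use F' in auto)
      have "detects n (\<Union>((\<inter>) A ` F'))"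
      proof (rule less.hyps)
        show "card ((\<inter>) A ` F') < card F" by (rule le_less_trans [OF card_image_le [OF F'(1)] F'(2)])
        fix C assume "C \<in> (\<inter>) A ` F'"
        then obtain B l' u' where "C = A \<inter> B" "B = box_in n l' u'" using F'(4) by blast
        then show "\<exists>l u. C = box_in n l u" using lu by (auto simp: box_in_Int)
      qed (use F' in auto)
      moreover have "\<Union>((\<inter>) A ` F') = A \<inter> \<Union>F'" by blast
      ultimately show "detects n (A \<inter> \<Union>F')" by simp
    qed
    then show ?thesis using F'(3) by simp
  qed (simp add: detects_empty)
qed

definition sbox :: "nat \<Rightarrow> (nat \<Rightarrow> real) \<Rightarrow> real \<Rightarrow> (nat \<Rightarrow> real) set" where
  "sbox n x r = box_in n (\<lambda>i. x i - r) (\<lambda>i. x i + r)"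

lemma mem_sbox: "y \<in> sbox n x r \<longleftrightarrow> y \<in> Rn n \<and> (\<forall>i<n. \<bar>y i - x i\<bar> \<le> r)"
  by (auto simp: sbox_def box_in_def abs_le_iff algebra_simps)

lemma sbox_inside_open:
  assumes "open U" "x \<in> U" "x \<in> Rn n"
  obtains r where "r > 0" "sbox n x r \<subseteq> U"
proof -
  obtain X where X: "x \<in> Pi\<^sub>E UNIV X" "\<And>i. open (X i)" "Pi\<^sub>E UNIV X \<subseteq> U"
  proof -
    have "openin (product_topology (\<lambda>_. euclidean) UNIV) U"
      using assms(1) by (simp add: open_fun_def)
    from product_topology_open_contains_basis [OF this assms(2)] show thesis
      using that by (auto simp del: PiE_UNIV_domain)
  qed
  have "\<exists>e>0. cball (x i) e \<subseteq> X i" for i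
    using X open_contains_cball by (metis PiE_mem UNIV_I)
  then obtain e where e: "\<And>i. e i > 0" "\<And>i. cball (x i) (e i) \<subseteq> X i" by metis
  define r where "r = Min (insert 1 (e ` {..<n}))"
  have r: "r > 0" "\<And>i. i < n \<Longrightarrow> r \<le> e i" using e by (auto simp: r_def)
  have "y i \<in> X i" if "y \<in> sbox n x r" for y i
  proof (cases "i < n")
    case True
    then have "y i \<in> cball (x i) (e i)" using that r(2) [of i]
      by (fastforce simp: mem_sbox dist_real_def abs_minus_commute)
    then show ?thesis using e by blast
  next
    case False
    then have "y i = x i" using that assms by (simp add: mem_sbox Rn_def)
    then show ?thesis using X by (metis PiE_mem UNIV_I)
  qed
  then have "sbox n x r \<subseteq> U" using X by blast
  then show thesis using r that by blast
qed

text \<open>The images of the finitely many simplices of a chain are compact.\<close>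

lemma closed_chain_support:
  assumes "singular_chain k (top_of_set S) (c :: (nat \<Rightarrow> real) chain)"
  obtains T where "closed T" "T \<subseteq> S" "singular_chain k (top_of_set T) c"
proof -
  define T where "T = (\<Union>f\<in>Poly_Mapping.keys c. f ` standard_simplex k)"
  have ss: "singular_simplex k (top_of_set S) f" if "f \<in> Poly_Mapping.keys c" for f
    using assms that by (auto simp: singular_chain_def)
  have "compact (f ` standard_simplex k)" if "f \<in> Poly_Mapping.keys c" for f
  proof -
    have "compactin (top_of_set S) (f ` standard_simplex k)"
    proof (rule image_compactin)
      show "compactin (subtopology (powertop_real UNIV) (standard_simplex k)) (standard_simplex k)"
        using compactin_standard_simplex by (simp add: compactin_subtopology)
      show "continuous_map (subtopology (powertop_real UNIV) (standard_simplex k)) (top_of_set S) f"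
        using ss [OF that] by (simp add: singular_simplex_def)
    qed
    then show ?thesis by (simp add: compactin_subtopology)
  qed
  then have "closed T" unfolding T_def by (intro closed_UN) (auto intro: compact_imp_closed)
  moreover have "T \<subseteq> S"
    using ss unfolding T_def singular_simplex_def continuous_map_def
    by (fastforce simp: topspace_standard_simplex)
  moreover have "singular_chain k (top_of_set T) c"
  proof -
    have "singular_simplex k (subtopology euclidean T) f" if "f \<in> Poly_Mapping.keys c" for f
      using ss [OF that] that unfolding singular_simplex_subtopology T_def by auto
    then show ?thesis by (auto simp: singular_chain_def)
  qed
  ultimately show thesis using that by blast
qed

text \<open>Only the closed support of the boundary of \<open>c\<close> must be avoided. So \<open>K\<close> can be thickened to a finite union of boxes, on each
  of which local triviality at the centre spreads to the whole box.\<close>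

lemma detects_compact:
  assumes "n > 0" "compact K" "K \<subseteq> Rn n"
  shows "detects n K"
  unfolding detects_def
proof (intro allI impI, elim conjE)
  fix i c
  let ?X = "top_of_set (Rn n)"
  assume "n \<le> i" and c: "singular_relcycle i ?X (Rn n - K) c"
    and loc: "\<forall>x\<in>K. singular_relboundary i ?X (Rn n - {x}) c"
  have bc: "singular_chain (i - 1) (top_of_set (Rn n - K)) (chain_boundary i c)"
    using c by (simp add: singular_relcycle)
  obtain T where T: "closed T" "T \<subseteq> Rn n - K" "singular_chain (i - 1) (top_of_set T) (chain_boundary i c)"
    by (rule closed_chain_support [OF bc])
  have "\<exists>r>0. sbox n x r \<subseteq> - T" if "x \<in> K" for x
  proof -
    have "open (- T)" "x \<in> - T" "x \<in> Rn n" using that T assms(3) by auto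
    then show ?thesis by (rule sbox_inside_open) blast
  qed
  then obtain r where r: "\<And>x. x \<in> K \<Longrightarrow> r x > 0" "\<And>x. x \<in> K \<Longrightarrow> sbox n x (r x) \<subseteq> - T" by metis
  define O' where "O' x = {y. \<forall>i<n. \<bar>y i - x i\<bar> < r x}" for x
  have "open (O' x)" for x
  proof -
    have "O' x = (\<Inter>i\<in>{..<n}. {y. \<bar>y i - x i\<bar> < r x})" by (auto simp: O'_def)
    moreover have "open {y :: nat \<Rightarrow> real. \<bar>y i - x i\<bar> < r x}" for i
      by (intro open_Collect_less continuous_intros continuous_on_product_coordinates)
    ultimately show ?thesis by (simp only:) (intro open_INT ballI finite_lessThan)
  qed
  moreover have "K \<subseteq> (\<Union>x\<in>K. O' x)" using r by (fastforce simp: O'_def)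
  ultimately obtain K0 where K0: "K0 \<subseteq> K" "finite K0" "K \<subseteq> (\<Union>x\<in>K0. O' x)"
    using compactE_image [OF \<open>compact K\<close>, of K O'] by metis
  define A where "A = (\<Union>x\<in>K0. sbox n x (r x))"
  have KA: "K \<subseteq> A"
  proof
    fix y assume "y \<in> K"
    then obtain x where "x \<in> K0" "y \<in> O' x" using K0 by blast
    then show "y \<in> A" using \<open>y \<in> K\<close> assms(3) by (force simp: A_def mem_sbox O'_def)
  qed
  have cyc: "singular_relcycle i ?X (Rn n - B) c" if "B \<subseteq> - T" for B
  proof -
    have "singular_chain (i - 1) (top_of_set (Rn n - B)) (chain_boundary i c)"
      using T that by (intro singular_chain_mono [OF T(3)]) auto
    then show ?thesis using c by (simp add: singular_relcycle)
  qed
  have "i > 0" using \<open>n \<le> i\<close> \<open>n > 0\<close> by simp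
  have "singular_relboundary i ?X (Rn n - A) c"
  proof (rule detectsD [OF _ \<open>n \<le> i\<close>])
    show "detects n A" unfolding A_def
      by (rule detects_Union_boxes) (use assms K0 in \<open>auto simp: sbox_def\<close>)
    show "singular_relcycle i ?X (Rn n - A) c" by (rule cyc) (use r K0 in \<open>auto simp: A_def\<close>)
    fix y assume "y \<in> A"
    then obtain x where x: "x \<in> K0" "y \<in> sbox n x (r x)" by (auto simp: A_def)
    have xK: "x \<in> K" using x K0 by blast
    have "singular_relboundary i ?X (Rn n - sbox n x (r x)) c"
      unfolding sbox_def
    proof (rule box_in_radial_detects [OF \<open>i > 0\<close>, of x])
      show "x \<in> box_in n (\<lambda>i. x i - r x) (\<lambda>i. x i + r x)"
        using xK assms(3) r(1) [OF xK] by (auto simp: box_in_def)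
      show "singular_relcycle i ?X (Rn n - box_in n (\<lambda>i. x i - r x) (\<lambda>i. x i + r x)) c"
        using cyc [OF r(2) [OF xK]] by (simp add: sbox_def)
    qed (use loc xK in blast)
    then show "singular_relboundary i ?X (Rn n - {y}) c"
      by (rule singular_relboundary_mono) (use x in auto)
  qed
  then show "singular_relboundary i ?X (Rn n - K) c"
    by (rule singular_relboundary_mono) (use KA in auto)
qed

section \<open>Fundamental classes\<close>

lemma singular_relboundary_excise:
  assumes U: "openin N U" and K: "closedin N K" "K \<subseteq> U"
    and u: "singular_relcycle i (subtopology N U) (U - K) u"
    and bd: "singular_relboundary i N (topspace N - K) u"
  shows "singular_relboundary i (subtopology N U) (U - K) u"
proof -
  let ?V = "topspace N - U"
  have UN: "U \<subseteq> topspace N" using U openin_subset by blast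
  have "closedin N ?V" "openin N (topspace N - K)" using U K by auto
  then have "N closure_of ?V \<subseteq> N interior_of (topspace N - K)"
    using K by (auto simp: closure_of_closedin interior_of_openin)
  moreover have "topspace N - K \<subseteq> topspace N" by blast
  ultimately have "hom_induced i (subtopology N (topspace N - ?V)) (topspace N - K - ?V) (subtopology N (topspace N)) (topspace N - K) id
     \<in> iso (relative_homology_group i (subtopology N (topspace N - ?V)) (topspace N - K - ?V))
           (relative_homology_group i (subtopology N (topspace N)) (topspace N - K))"
    by (rule homology_excision_axiom)
  moreover have "topspace N - ?V = U" "topspace N - K - ?V = U - K" using UN by auto
  ultimately have iso: "hom_induced i (subtopology N U) (U - K) N (topspace N - K) id
     \<in> iso (relative_homology_group i (subtopology N U) (U - K)) (relative_homology_group i N (topspace N - K))"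
    by simp
  let ?G = "relative_homology_group (int i) (subtopology N U) (U - K)"
  let ?H = "relative_homology_group (int i) N (topspace N - K)"
  let ?h = "hom_induced (int i) (subtopology N U) (U - K) N (topspace N - K) id"
  let ?u = "homologous_rel_set i (subtopology N U) (U - K) u"
  have uc: "?u \<in> carrier ?G" using u by (simp add: carrier_relative_homology_group)
  have "?h ?u = homologous_rel_set i N (topspace N - K) (chain_map i id u)"
    by (rule hom_induced_chain_map) (use u UN in \<open>auto intro: continuous_map_from_subtopology\<close>)
  also have "chain_map i id u = u"
    by (rule chain_map_ident [of _ "subtopology N U"]) (use u in \<open>simp add: singular_relcycle\<close>)
  also have "homologous_rel_set i N (topspace N - K) u = \<one>\<^bsub>?H\<^esub>"
    using bd by (simp add: homologous_rel_set_eq_relboundary)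
  also have "\<dots> = ?h \<one>\<^bsub>?G\<^esub>"
    by (rule hom_one [symmetric, OF hom_induced_hom]) auto
  finally have "?h ?u = ?h \<one>\<^bsub>?G\<^esub>" .
  moreover have "inj_on ?h (carrier ?G)" using iso by (simp add: iso_def bij_betw_def)
  moreover have "\<one>\<^bsub>?G\<^esub> \<in> carrier ?G" by (intro monoid.one_closed group.is_monoid group_relative_homology_group)
  ultimately have "?u = \<one>\<^bsub>?G\<^esub>" using uc by (blast dest: inj_onD)
  then show ?thesis by (simp add: homologous_rel_set_eq_relboundary)
qed

lemma excise_relcycle:
  assumes U: "openin N U" and K: "closedin N K" "K \<subseteq> U"
    and c: "singular_relcycle i N (topspace N - K) c"
  obtains u where "singular_relcycle i (subtopology N U) (U - K) u"
    "homologous_rel i N (topspace N - K) c u"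
proof -
  let ?V = "topspace N - U"
  have UN: "U \<subseteq> topspace N" using U openin_subset by blast
  have "closedin N ?V" "openin N (topspace N - K)" using U K by auto
  then have 1: "N closure_of ?V \<subseteq> N interior_of (topspace N - K)"
    using K by (auto simp: closure_of_closedin interior_of_openin)
  have 2: "topspace N - K \<subseteq> topspace N" by blast
  have c': "singular_relcycle i (subtopology N (topspace N)) (topspace N - K) c" using c by simp
  obtain u where "singular_relcycle i (subtopology N (topspace N - ?V)) (topspace N - K - ?V) u"
    "homologous_rel i (subtopology N (topspace N)) (topspace N - K) c u"
    by (rule excised_relcycle_exists [OF 1 2 c'])
  moreover have "topspace N - ?V = U" "topspace N - K - ?V = U - K" using UN by auto
  ultimately show thesis using that by simp
qed

text \<open>A closed topological manifold covered by parametrizations defined on all of \<open>\<real>\<^sup>n\<close>. The condition \<open>compat\<close> is the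
  orientation: translating a local class at the origin to a point of the manifold gives the same local homology class there
  in any two parametrizations.\<close>

locale oriented_parametrizations =
  fixes N :: "'b topology" and n :: nat and J :: "((nat \<Rightarrow> real) \<Rightarrow> 'b) set"
  assumes n_pos: "n > 0"
    and compact: "compact_space N"
    and Hausdorff: "Hausdorff_space N"
    and cont: "\<And>\<iota>. \<iota> \<in> J \<Longrightarrow> continuous_map (top_of_set (Rn n)) N \<iota>"
    and inj: "\<And>\<iota>. \<iota> \<in> J \<Longrightarrow> inj_on \<iota> (Rn n)"
    and open_map: "\<And>\<iota>. \<iota> \<in> J \<Longrightarrow> open_map (top_of_set (Rn n)) N \<iota>"
    and cover: "\<And>x. x \<in> topspace N \<Longrightarrow> \<exists>\<iota>\<in>J. \<iota> origin = x"
    and compat: "\<And>\<iota> \<iota>' y y' b. \<lbrakk>\<iota> \<in> J; \<iota>' \<in> J; y \<in> Rn n; y' \<in> Rn n; \<iota> y = \<iota>' y';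
        singular_relcycle n (top_of_set (Rn n)) (Rn n - {origin}) b\<rbrakk> \<Longrightarrow>
      homologous_rel n N (topspace N - {\<iota> y}) (chain_map n (\<lambda>v. \<iota> (\<lambda>i. y i + v i)) b)
        (chain_map n (\<lambda>v. \<iota>' (\<lambda>i. y' i + v i)) b)"
begin

lemma param_in: "\<lbrakk>\<iota> \<in> J; v \<in> Rn n\<rbrakk> \<Longrightarrow> \<iota> v \<in> topspace N"
  using cont by (fastforce simp: continuous_map_def)

lemma open_range: "\<iota> \<in> J \<Longrightarrow> openin N (\<iota> ` Rn n)"
  using open_map [of \<iota>] unfolding open_map_def by (metis openin_topspace topspace_euclidean_subtopology)

lemma param_inverse:
  assumes "\<iota> \<in> J"
  obtains \<kappa> where "continuous_map (subtopology N (\<iota> ` Rn n)) (top_of_set (Rn n)) \<kappa>"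
    "\<And>v. v \<in> Rn n \<Longrightarrow> \<kappa> (\<iota> v) = v"
proof -
  have "embedding_map (top_of_set (Rn n)) N \<iota>"
    by (rule injective_open_imp_embedding_map) (use assms cont inj open_map in auto)
  then have "homeomorphic_map (top_of_set (Rn n)) (subtopology N (\<iota> ` Rn n)) \<iota>"
    by (simp add: embedding_map_def)
  then obtain \<kappa> where "homeomorphic_maps (top_of_set (Rn n)) (subtopology N (\<iota> ` Rn n)) \<iota> \<kappa>"
    by (auto simp: homeomorphic_map_maps)
  then have 1: "continuous_map (subtopology N (\<iota> ` Rn n)) (top_of_set (Rn n)) \<kappa>"
    and 2: "\<forall>v\<in>Rn n. \<kappa> (\<iota> v) = v" by (auto simp: homeomorphic_maps_def)
  show thesis by (rule that [OF 1]) (use 2 in blast)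
qed

text \<open>Excision moves the question into \<open>\<real>\<^sup>n\<close>, where \<open>detects_compact\<close> answers it.\<close>

lemma chart_detects:
  assumes \<iota>: "\<iota> \<in> J" and K: "compactin N K" "K \<subseteq> \<iota> ` Rn n" and "n \<le> i"
    and c: "singular_relcycle i N (topspace N - K) c"
    and loc: "\<And>x. x \<in> K \<Longrightarrow> singular_relboundary i N (topspace N - {x}) c"
  shows "singular_relboundary i N (topspace N - K) c"
proof -
  let ?U = "\<iota> ` Rn n" and ?X = "top_of_set (Rn n)"
  have U: "openin N ?U" using \<iota> by (rule open_range)
  have clK: "closedin N K" using K Hausdorff compactin_imp_closedin by blast
  obtain \<kappa> where \<kappa>: "continuous_map (subtopology N ?U) ?X \<kappa>" "\<And>v. v \<in> Rn n \<Longrightarrow> \<kappa> (\<iota> v) = v"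
    by (rule param_inverse [OF \<iota>]) (erule that, blast)
  have \<iota>\<kappa>: "\<iota> (\<kappa> x) = x" "\<kappa> x \<in> Rn n" if "x \<in> ?U" for x using that \<kappa>(2) by auto
  obtain u where u: "singular_relcycle i (subtopology N ?U) (?U - K) u"
    and cu: "homologous_rel i N (topspace N - K) c u"
    by (rule excise_relcycle [OF U clK K(2) c])
  define K' where "K' = \<kappa> ` K"
  have K'sub: "K' \<subseteq> Rn n" using K(2) \<iota>\<kappa> by (auto simp: K'_def)
  have "compactin ?X K'" unfolding K'_def
    by (rule image_compactin [OF _ \<kappa>(1)]) (use K in \<open>simp add: compactin_subtopology\<close>)
  then have "compact K'" by (simp add: compactin_subtopology)
  then have det: "detects n K'" using n_pos K'sub by (intro detects_compact)
  let ?w = "chain_map i \<kappa> u"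
  have \<kappa>avoid: "\<kappa> \<in> ?U - L \<rightarrow> Rn n - \<kappa> ` L" if "L \<subseteq> ?U" for L
    using that \<kappa>(2) by (auto simp: subset_iff)
  have w: "singular_relcycle i ?X (Rn n - K') ?w"
    unfolding K'_def by (rule singular_relcycle_chain_map [OF u \<kappa>(1) \<kappa>avoid [OF K(2)]])
  have "singular_relboundary i ?X (Rn n - K') ?w"
  proof (rule detectsD [OF det \<open>n \<le> i\<close> w])
    fix y assume "y \<in> K'"
    then obtain x where x: "x \<in> K" "y = \<kappa> x" by (auto simp: K'_def)
    have xU: "x \<in> ?U" using x K(2) by blast
    have xN: "x \<in> topspace N" using xU \<iota> param_in by blast
    have "homologous_rel i N (topspace N - {x}) c u"
      by (rule homologous_rel_mono [OF cu]) (use x in auto)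
    then have "singular_relboundary i N (topspace N - {x}) u"
      using loc [OF x(1)] unfolding homologous_rel_def
      by (metis add_diff_cancel_left' diff_add_cancel singular_relboundary_diff)
    moreover have "singular_relcycle i (subtopology N ?U) (?U - {x}) u"
      by (rule singular_relcycle_mono [OF u]) (use x in auto)
    moreover have "closedin N {x}" using xN Hausdorff by (simp add: closedin_Hausdorff_sing_eq)
    ultimately have "singular_relboundary i (subtopology N ?U) (?U - {x}) u"
      using xU by (intro singular_relboundary_excise [OF U]) auto
    then have "singular_relboundary i ?X (Rn n - \<kappa> ` {x}) ?w"
      by (rule singular_relboundary_chain_map [OF _ \<kappa>(1) \<kappa>avoid]) (use xU in auto)
    then show "singular_relboundary i ?X (Rn n - {y}) ?w" using x by simp
  qed
  then have "singular_relboundary i N (topspace N - K) (chain_map i \<iota> ?w)"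
  proof (rule singular_relboundary_chain_map [OF _ cont [OF \<iota>]])
    show "\<iota> \<in> Rn n - K' \<rightarrow> topspace N - K"
      using param_in [OF \<iota>] \<kappa>(2) by (auto simp: K'_def image_iff) metis
  qed
  moreover have "chain_map i \<iota> ?w = chain_map i (\<iota> \<circ> \<kappa>) u" by (simp add: chain_map_compose)
  moreover have "\<dots> = u"
    by (rule chain_map_id_gen [of _ "subtopology N ?U"]) (use u \<iota>\<kappa> in \<open>auto simp: singular_relcycle\<close>)
  ultimately have "singular_relboundary i N (topspace N - K) u" by simp
  then show ?thesis using cu unfolding homologous_rel_def
    by (metis diff_add_cancel singular_relboundary_add)
qed

text \<open>The local class of \<open>c\<close> at \<open>x\<close> is the one that the orientation transports there from \<open>b\<close>.\<close>

definition represents :: "(nat \<Rightarrow> real) chain \<Rightarrow> 'b chain \<Rightarrow> 'b \<Rightarrow> bool" where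
  "represents b c x \<longleftrightarrow> (\<forall>\<iota>\<in>J. \<forall>y\<in>Rn n. \<iota> y = x \<longrightarrow>
     homologous_rel n N (topspace N - {x}) c (chain_map n (\<lambda>v. \<iota> (\<lambda>i. y i + v i)) b))"

definition fundamental_on :: "(nat \<Rightarrow> real) chain \<Rightarrow> 'b set \<Rightarrow> bool" where
  "fundamental_on b A \<longleftrightarrow> (\<exists>c. singular_relcycle n N (topspace N - A) c \<and> (\<forall>x\<in>A. represents b c x))"

lemma represents_homologous:
  assumes "represents b c x" "homologous_rel n N (topspace N - {x}) c' c"
  shows "represents b c' x"
  using assms homologous_rel_trans unfolding represents_def by blast

lemma represents_unique:
  assumes "represents b c x" "represents b c' x" "x \<in> topspace N"
  shows "singular_relboundary n N (topspace N - {x}) (c - c')"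
proof -
  obtain \<iota> where \<iota>: "\<iota> \<in> J" "\<iota> origin = x" using cover assms(3) by blast
  let ?d = "chain_map n (\<lambda>v. \<iota> (\<lambda>i. origin i + v i)) b"
  have "homologous_rel n N (topspace N - {x}) c ?d" "homologous_rel n N (topspace N - {x}) c' ?d"
    by (rule assms(1,2) [unfolded represents_def, rule_format, OF \<iota>(1) origin_Rn \<iota>(2)])+
  then have "homologous_rel n N (topspace N - {x}) c c'"
    by (metis homologous_rel_sym homologous_rel_trans)
  then show ?thesis by (simp add: homologous_rel_def)
qed

text \<open>Push the boundary of \<open>b\<close> radially out of the unit cube. The modified chain is relative to the complement of the whole cube,
  and translations by the points of the segment from the origin to \<open>y\<close>, which keep that complement away from \<open>y\<close>, identify
  its class at \<open>y\<close> with the translate of \<open>b\<close>.\<close>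

lemma fundamental_on_cube:
  assumes \<iota>: "\<iota> \<in> J" and b: "singular_relcycle n (top_of_set (Rn n)) (Rn n - {origin}) b"
  shows "fundamental_on b (\<iota> ` sbox n origin 1)"
proof -
  let ?X = "top_of_set (Rn n)" and ?Q = "sbox n origin 1"
  have QR: "?Q \<subseteq> Rn n" by (auto simp: mem_sbox)
  obtain r where r: "continuous_map (top_of_set (Rn n - {origin})) (top_of_set (Rn n - ?Q)) r"
    "\<And>k c. singular_relcycle k (top_of_set (Rn n - {origin})) {} c \<Longrightarrow>
        homologous_rel k (top_of_set (Rn n - {origin})) {} c (chain_map k r c)"
  proof (rule radial_push [OF QR])
    show "origin \<in> ?Q" by (simp add: mem_sbox)
    show "l1_norm n (\<lambda>i. x i - origin i) \<le> (\<Sum>i<n. 1)" if "x \<in> ?Q" for x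
      unfolding l1_norm_def by (rule sum_mono) (use that in \<open>auto simp: mem_sbox\<close>)
    show "(\<lambda>i. origin i + s * (y i - origin i)) \<notin> ?Q" if "y \<in> Rn n - ?Q" "1 \<le> s" for y s
    proof -
      have "\<exists>i<n. \<not> \<bar>y i - origin i\<bar> \<le> 1" using that by (simp add: mem_sbox)
      then obtain i where i: "i < n" "\<bar>y i\<bar> > 1" by auto
      have "1 * \<bar>y i\<bar> \<le> \<bar>s\<bar> * \<bar>y i\<bar>" using that by (intro mult_right_mono) auto
      then have "\<bar>s * y i\<bar> > 1" using i by (simp add: abs_mult)
      then show ?thesis using i by (auto simp: mem_sbox intro!: exI [of _ i])
    qed
  qed blast
  let ?bb = "chain_boundary n b"
  have bb: "singular_relcycle (n - 1) (top_of_set (Rn n - {origin})) {} ?bb"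
    using b chain_boundary_boundary [of n ?X b] by (simp add: singular_cycle singular_relcycle)
  have "homologous_rel (n - 1) (top_of_set (Rn n - {origin})) {} ?bb (chain_map (n - 1) r ?bb)"
    by (rule r(2) [OF bb])
  then obtain w where w: "singular_chain n (top_of_set (Rn n - {origin})) w"
      "chain_boundary n w = ?bb - chain_map (n - 1) r ?bb"
    using n_pos by (auto simp: homologous_rel_def singular_boundary)
  define b1 where "b1 = b - w"
  have wX: "singular_chain n ?X w" using w(1) singular_chain_sub [of n ?X "Rn n - {origin}"] by simp
  have b1: "singular_relcycle n ?X (Rn n - ?Q) b1"
  proof -
    have "singular_chain (n - 1) (top_of_set (Rn n - ?Q)) (chain_map (n - 1) r ?bb)"
      using bb r(1) by (intro singular_chain_chain_map) (auto simp: singular_cycle)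
    then show ?thesis using b wX w(2)
      by (auto simp: singular_relcycle b1_def chain_boundary_diff intro: singular_chain_diff)
  qed
  have bb1: "homologous_rel n ?X (Rn n - {origin}) b1 b"
    unfolding homologous_rel_def b1_def
    using w(1) by (simp add: singular_relboundary_minus singular_chain_imp_relboundary)
  have tr: "continuous_on S (\<lambda>z. (\<lambda>i. snd z i + fst z * y i))" for S :: "(real \<times> (nat \<Rightarrow> real)) set" and y
  proof (rule continuous_on_coordinatewise_then_product)
    fix i
    have "continuous_on S (\<lambda>z. snd z i)"
      by (rule continuous_on_compose2 [OF continuous_on_product_coordinates continuous_on_snd [OF continuous_on_id]]) auto
    then show "continuous_on S (\<lambda>z. snd z i + fst z * y i)" by (intro continuous_intros)
  qed
  have loc: "homologous_rel n ?X (Rn n - {y}) b1 (chain_map n (\<lambda>v i. y i + v i) b)" if y: "y \<in> ?Q" for y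
  proof -
    let ?h = "\<lambda>(t::real) v i. v i + t * y i"
    have yR: "y \<in> Rn n" using y QR by blast
    have h1: "homologous_rel n ?X (Rn n - {y}) (chain_map n (?h 0) b1) (chain_map n (?h 1) b1)"
    proof (rule homotopy_imp_homologous_rel [OF b1 _ tr])
      show "?h t v \<in> Rn n" if "v \<in> Rn n" for t v using that yR by (simp add: Rn_def)
      show "?h t v \<in> Rn n - {y}" if "0 \<le> t" "t \<le> 1" "v \<in> Rn n - ?Q" for t v
      proof -
        have "?h t v \<noteq> y"
        proof
          assume e: "?h t v = y"
          have "v i = (1 - t) * y i" for i using fun_cong [OF e, of i] by (simp add: algebra_simps)
          then have "\<bar>v i\<bar> \<le> 1" if "i < n" for i
            using that y \<open>0 \<le> t\<close> \<open>t \<le> 1\<close> by (auto simp: abs_mult mem_sbox intro!: mult_le_one)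
          then show False using that by (auto simp: mem_sbox)
        qed
        then show ?thesis using that yR by (auto simp: Rn_def)
      qed
    qed auto
    have h0: "chain_map n (?h 0) b1 = b1"
      by (rule chain_map_id_gen [of _ ?X]) (use b1 in \<open>auto simp: singular_relcycle\<close>)
    have h2: "homologous_rel n ?X (Rn n - {y}) (chain_map n (?h 1) b1) (chain_map n (?h 1) b)"
    proof (rule homologous_rel_chain_map [OF bb1])
      have "continuous_on (Rn n) (\<lambda>v. (\<lambda>i. snd (1::real, v) i + fst (1::real, v) * y i))"
        by (rule continuous_on_compose2 [OF tr [of UNIV]]) (auto intro!: continuous_on_Pair continuous_on_const continuous_on_id)
      then show "continuous_map ?X ?X (?h 1)" using yR by (auto simp: Rn_def)
      show "?h 1 \<in> Rn n - {origin} \<rightarrow> Rn n - {y}"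
        using yR by (auto simp: Rn_def fun_eq_iff)
    qed
    have "homologous_rel n ?X (Rn n - {y}) b1 (chain_map n (?h 1) b)"
      using homologous_rel_trans [OF h2 h1] unfolding h0 .
    moreover have "?h 1 = (\<lambda>v i. y i + v i)" by (auto simp: add.commute)
    ultimately show ?thesis by simp
  qed
  define c where "c = chain_map n \<iota> b1"
  have avoid: "\<iota> \<in> Rn n - L \<rightarrow> topspace N - \<iota> ` L" if "L \<subseteq> Rn n" for L
    using that param_in [OF \<iota>] inj_onD [OF inj [OF \<iota>]] by blast
  have "singular_relcycle n N (topspace N - \<iota> ` ?Q) c"
    unfolding c_def by (rule singular_relcycle_chain_map [OF b1 cont [OF \<iota>] avoid [OF QR]])
  moreover have "represents b c (\<iota> y)" if y: "y \<in> ?Q" for y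
    unfolding represents_def
  proof (intro ballI impI)
    fix \<iota>' y' assume "\<iota>' \<in> J" "y' \<in> Rn n" "\<iota>' y' = \<iota> y"
    have yR: "y \<in> Rn n" using y QR by blast
    have "homologous_rel n N (topspace N - \<iota> ` {y}) c (chain_map n \<iota> (chain_map n (\<lambda>v i. y i + v i) b))"
      unfolding c_def by (rule homologous_rel_chain_map [OF loc [OF y] cont [OF \<iota>] avoid]) (use yR in auto)
    moreover have "chain_map n \<iota> (chain_map n (\<lambda>v i. y i + v i) b) = chain_map n (\<lambda>v. \<iota> (\<lambda>i. y i + v i)) b"
      using fun_cong [OF chain_map_compose [of n \<iota> "\<lambda>v i. y i + v i"], of b] by (simp add: o_def)
    ultimately have "homologous_rel n N (topspace N - {\<iota> y}) c (chain_map n (\<lambda>v. \<iota> (\<lambda>i. y i + v i)) b)"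
      by simp
    moreover have "homologous_rel n N (topspace N - {\<iota> y}) (chain_map n (\<lambda>v. \<iota> (\<lambda>i. y i + v i)) b)
        (chain_map n (\<lambda>v. \<iota>' (\<lambda>i. y' i + v i)) b)"
      by (rule compat) (use \<iota> \<open>\<iota>' \<in> J\<close> \<open>y' \<in> Rn n\<close> \<open>\<iota>' y' = \<iota> y\<close> yR b in auto)
    ultimately show "homologous_rel n N (topspace N - {\<iota> y}) c (chain_map n (\<lambda>v. \<iota>' (\<lambda>i. y' i + v i)) b)"
      by (metis homologous_rel_trans)
  qed
  ultimately show ?thesis unfolding fundamental_on_def by blast
qed

lemma cube_compact:
  assumes "\<iota> \<in> J" shows "compactin N (\<iota> ` sbox n origin 1)"
proof (rule image_compactin [OF _ cont [OF assms]])
  let ?B = "PiE UNIV (\<lambda>i. if i < n then {-1..1} else {0::real})"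
  have "x \<in> sbox n origin 1 \<longleftrightarrow> x \<in> ?B" for x
  proof -
    have "x \<in> ?B \<longleftrightarrow> (\<forall>i. if i < n then -1 \<le> x i \<and> x i \<le> 1 else x i = 0)"
      by (auto simp: PiE_iff split: if_splits)
    also have "\<dots> \<longleftrightarrow> x \<in> sbox n origin 1"
    proof -
      have "\<bar>r\<bar> \<le> 1 \<longleftrightarrow> -1 \<le> r \<and> r \<le> 1" for r :: real by linarith
      then show ?thesis by (auto simp: mem_sbox Rn_def not_less)
    qed
    finally show ?thesis by blast
  qed
  then have "sbox n origin 1 = ?B" by blast
  moreover have "compactin (powertop_real UNIV) ?B"
    by (subst compactin_PiE) auto
  ultimately show "compactin (top_of_set (Rn n)) (sbox n origin 1)"
    by (auto simp: compactin_subtopology mem_sbox euclidean_product_topology)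
qed

text \<open>The classes given on \<open>A\<close> and on the cube agree locally on the intersection, which lies in one chart, hence agree relative to
  the complement of the intersection. Splitting the difference glues them to a class on the union.\<close>

lemma fundamental_on_Un:
  assumes \<iota>: "\<iota> \<in> J" and b: "singular_relcycle n (top_of_set (Rn n)) (Rn n - {origin}) b"
    and A: "fundamental_on b A" "closedin N A"
  shows "fundamental_on b (A \<union> \<iota> ` sbox n origin 1)"
proof -
  let ?B = "\<iota> ` sbox n origin 1"
  obtain cA where cA: "singular_relcycle n N (topspace N - A) cA" "\<And>x. x \<in> A \<Longrightarrow> represents b cA x"
    using A by (auto simp: fundamental_on_def)
  obtain cB where cB: "singular_relcycle n N (topspace N - ?B) cB" "\<And>x. x \<in> ?B \<Longrightarrow> represents b cB x"
    using fundamental_on_cube [OF \<iota> b] by (auto simp: fundamental_on_def)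
  have Bcl: "closedin N ?B" using cube_compact [OF \<iota>] Hausdorff compactin_imp_closedin by blast
  have AN: "A \<subseteq> topspace N" "?B \<subseteq> topspace N" using A Bcl closedin_subset by blast+
  have "singular_relboundary n N (topspace N - A \<inter> ?B) (cA - cB)"
  proof (rule chart_detects [OF \<iota>])
    show "compactin N (A \<inter> ?B)" using cube_compact [OF \<iota>] A(2) closed_Int_compactin by blast
    show "A \<inter> ?B \<subseteq> \<iota> ` Rn n" by (auto simp: mem_sbox)
    show "singular_relcycle n N (topspace N - A \<inter> ?B) (cA - cB)"
      by (intro singular_relcycle_diff singular_relcycle_mono [OF cA(1)] singular_relcycle_mono [OF cB(1)]) auto
    show "singular_relboundary n N (topspace N - {x}) (cA - cB)" if "x \<in> A \<inter> ?B" for x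
      by (rule represents_unique) (use that cA(2) cB(2) AN in auto)
  qed auto
  then obtain e s where es: "singular_chain (Suc n) N e"
     "singular_chain n (subtopology N (topspace N - A \<inter> ?B)) s" "cA - cB = chain_boundary (Suc n) e + s"
    by (rule singular_relboundaryE)
  have bs: "chain_boundary n s = chain_boundary n cA + (- chain_boundary n cB)"
    using arg_cong [OF es(3), of "chain_boundary n"] chain_boundary_boundary_alt [OF es(1)]
    by (simp add: chain_boundary_add chain_boundary_diff)
  obtain sA sB w where w: "singular_chain n (subtopology N (topspace N - A)) sA"
     "singular_chain n (subtopology N (topspace N - ?B)) sB"
     "singular_chain (Suc n) (subtopology N (topspace N - A \<inter> ?B)) w"
     "s = sA + sB + chain_boundary (Suc n) w"
  proof (rule split_chain [OF A(2) Bcl _ es(2) bs])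
    show "1 \<le> n" using n_pos by simp
  qed (use cA(1) cB(1) in \<open>auto simp: singular_relcycle singular_chain_minus\<close>)
  define c where "c = cB + sB"
  have ew: "singular_chain (Suc n) N (e + w)"
    using es(1) w(3) singular_chain_sub by (blast intro: singular_chain_add)
  have c2: "c = cA - chain_boundary (Suc n) (e + w) - sA"
    using es(3) w(4) by (simp add: c_def chain_boundary_add algebra_simps)
  have hB: "homologous_rel n N (topspace N - ?B) c cB"
    unfolding homologous_rel_def c_def using w(2) by (simp add: singular_chain_imp_relboundary)
  have hA: "homologous_rel n N (topspace N - A) c cA"
    unfolding homologous_rel_def
  proof (rule singular_relboundaryI)
    show "singular_chain (Suc n) N (- (e + w))" using ew by (simp only: singular_chain_minus)
    show "singular_chain n (subtopology N (topspace N - A)) (- sA)" using w(1) by (simp only: singular_chain_minus)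
    show "c - cA = chain_boundary (Suc n) (- (e + w)) + - sA" unfolding c2 chain_boundary_minus by simp
  qed
  have "singular_relcycle n N (topspace N - (A \<union> ?B)) c"
  proof -
    have "singular_relcycle n N (topspace N - A) c" "singular_relcycle n N (topspace N - ?B) c"
      using hA hB cA(1) cB(1) homologous_rel_singular_relcycle by blast+
    then show ?thesis unfolding singular_relcycle singular_chain_subtopology by blast
  qed
  moreover have "represents b c x" if "x \<in> A \<union> ?B" for x
  proof (cases "x \<in> A")
    case True
    show ?thesis by (rule represents_homologous [OF cA(2) homologous_rel_mono [OF hA]]) (use True in auto)
  next
    case False
    then have "x \<in> ?B" using that by blast
    then show ?thesis by (intro represents_homologous [OF cB(2) homologous_rel_mono [OF hB]]) auto
  qed
  ultimately show ?thesis unfolding fundamental_on_def by blast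
qed

text \<open>By compactness finitely many unit cubes cover the manifold, and their local fundamental classes can be glued one
  after the other.\<close>

theorem fundamental_class:
  assumes \<iota>: "\<iota> \<in> J" and b: "singular_relcycle n (top_of_set (Rn n)) (Rn n - {origin}) b"
  obtains c where "singular_relcycle n N {} c" "homologous_rel n N (topspace N - {\<iota> origin}) c (chain_map n \<iota> b)"
proof -
  define O' where "O' = {v \<in> Rn n. \<forall>i<n. \<bar>v i\<bar> < 1}"
  have "openin (top_of_set (Rn n)) O'"
  proof -
    have "O' = Rn n \<inter> (\<Inter>i\<in>{..<n}. {v. \<bar>v i\<bar> < 1})" by (auto simp: O'_def)
    moreover have "open {v :: nat \<Rightarrow> real. \<bar>v i\<bar> < 1}" for i
      by (intro open_Collect_less continuous_intros continuous_on_product_coordinates)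
    ultimately show ?thesis by (simp only:) (intro openin_open_Int open_INT ballI finite_lessThan)
  qed
  then have op: "openin N (\<kappa> ` O')" if "\<kappa> \<in> J" for \<kappa>
    using open_map [OF that] by (auto simp: open_map_def)
  have z: "origin \<in> O'" by (auto simp: O'_def)
  have "\<exists>\<F>. finite \<F> \<and> \<F> \<subseteq> (\<lambda>\<kappa>. \<kappa> ` O') ` J \<and> topspace N \<subseteq> \<Union>\<F>"
  proof -
    have h: "Ball ((\<lambda>\<kappa>. \<kappa> ` O') ` J) (openin N) \<and> topspace N \<subseteq> \<Union>((\<lambda>\<kappa>. \<kappa> ` O') ` J)"
      using cover z op by blast
    show ?thesis by (rule mp [OF spec [OF compact [unfolded compact_space_alt]] h])
  qed
  then obtain \<F> where \<F>: "finite \<F>" "\<F> \<subseteq> (\<lambda>\<kappa>. \<kappa> ` O') ` J" "topspace N \<subseteq> \<Union>\<F>" by blast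
  obtain J0 where J0': "J0 \<subseteq> J" "finite J0" "\<F> = (\<lambda>\<kappa>. \<kappa> ` O') ` J0"
    using finite_subset_image [OF \<F>(1,2)] by blast
  then have J0: "finite J0" "J0 \<subseteq> J" "topspace N \<subseteq> (\<Union>\<kappa>\<in>J0. \<kappa> ` O')" using \<F>(3) by auto
  have "fundamental_on b (\<Union>\<kappa>\<in>F. \<kappa> ` sbox n origin 1) \<and> closedin N (\<Union>\<kappa>\<in>F. \<kappa> ` sbox n origin 1)"
    if "finite F" "F \<subseteq> J" for F
    using that
  proof (induction F rule: finite_induct)
    case empty
    show ?case by (auto simp: fundamental_on_def intro!: exI [of _ 0])
  next
    case (insert \<kappa> F)
    have \<kappa>: "\<kappa> \<in> J" using insert.prems by blast
    have IH: "fundamental_on b (\<Union>\<kappa>\<in>F. \<kappa> ` sbox n origin 1)"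
      "closedin N (\<Union>\<kappa>\<in>F. \<kappa> ` sbox n origin 1)" using insert.IH insert.prems by blast+
    have "closedin N (\<kappa> ` sbox n origin 1)" using cube_compact [OF \<kappa>] Hausdorff compactin_imp_closedin by blast
    then show ?case using fundamental_on_Un [OF \<kappa> b IH] IH by (simp add: Un_commute closedin_Un origin_def)
  qed
  then have f: "fundamental_on b (\<Union>\<kappa>\<in>J0. \<kappa> ` sbox n origin 1)" using J0 by blast
  have "(\<Union>\<kappa>\<in>J0. \<kappa> ` sbox n origin 1) = topspace N"
  proof
    show "(\<Union>\<kappa>\<in>J0. \<kappa> ` sbox n origin 1) \<subseteq> topspace N" using J0 param_in by (auto simp: mem_sbox)
    have "O' \<subseteq> sbox n origin 1" by (auto simp: O'_def mem_sbox less_imp_le)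
    then show "topspace N \<subseteq> (\<Union>\<kappa>\<in>J0. \<kappa> ` sbox n origin 1)" using J0(3) by blast
  qed
  then obtain c where c: "singular_relcycle n N {} c" "\<And>x. x \<in> topspace N \<Longrightarrow> represents b c x"
    using f by (auto simp: fundamental_on_def)
  have r: "represents b c (\<iota> origin)" using c(2) param_in [OF \<iota>] by simp
  have "homologous_rel n N (topspace N - {\<iota> origin}) c (chain_map n (\<lambda>v. \<iota> (\<lambda>i. origin i + v i)) b)"
    by (rule r [unfolded represents_def, rule_format, OF \<iota> origin_Rn refl])
  then show thesis using that c(1) by simp
qed

text \<open>Fill \<open>\<gamma>\<close> in \<open>\<real>\<^sup>n\<close> by a chain \<open>b\<close>. The fundamental class that agrees with \<open>b\<close> near the point differs from it by a chain that
  avoids the point, up to a boundary, so up to sign that chain has the image of \<open>\<gamma>\<close> as its boundary.\<close>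

corollary link_bounds:
  assumes \<iota>: "\<iota> \<in> J" and "n \<ge> 2" and \<gamma>: "singular_relcycle (n - 1) (top_of_set (Rn n - {origin})) {} \<gamma>"
  shows "singular_relboundary (n - 1) (subtopology N (topspace N - {\<iota> origin})) {} (chain_map (n - 1) \<iota> \<gamma>)"
proof -
  let ?X = "top_of_set (Rn n)"
  have "singular_relcycle (n - 1) ?X {} \<gamma>"
    using \<gamma> singular_chain_sub [of "n - 1" ?X "Rn n - {origin}"] by (simp add: singular_cycle)
  moreover have "contractible_space ?X"
    using contractible_Euclidean_space [of n] by (simp add: Euclidean_space_eq)
  ultimately have "singular_relboundary (n - 1) ?X {} \<gamma>"
    using \<open>n \<ge> 2\<close> by (intro trivial_reduced_imp_relboundary trivial_reduced_homology_group_contractible_space) auto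
  then obtain b where b: "singular_chain n ?X b" "chain_boundary n b = \<gamma>"
    using \<open>n \<ge> 2\<close> by (auto simp: singular_boundary)
  have "singular_relcycle n ?X (Rn n - {origin}) b"
    using b \<gamma> by (simp add: singular_relcycle singular_cycle)
  then obtain c where c: "singular_relcycle n N {} c" "homologous_rel n N (topspace N - {\<iota> origin}) c (chain_map n \<iota> b)"
    by (rule fundamental_class [OF \<iota>])
  from c(2) obtain d s where ds: "singular_chain (Suc n) N d"
      "singular_chain n (subtopology N (topspace N - {\<iota> origin})) s" "c - chain_map n \<iota> b = chain_boundary (Suc n) d + s"
    unfolding homologous_rel_def by (rule singular_relboundaryE)
  have "chain_boundary n (c - chain_map n \<iota> b) = chain_boundary n s"
    unfolding ds(3) using chain_boundary_boundary_alt [OF ds(1)] by (simp add: chain_boundary_add)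
  moreover have "chain_boundary n c = 0" using c(1) by (simp add: singular_cycle)
  ultimately have "- chain_boundary n (chain_map n \<iota> b) = chain_boundary n s"
    by (simp add: chain_boundary_diff)
  then have "chain_boundary n (chain_map n \<iota> b) = chain_boundary n (- s)"
    by (metis chain_boundary_minus minus_minus)
  moreover have "chain_boundary n (chain_map n \<iota> b) = chain_map (n - 1) \<iota> \<gamma>"
    using chain_boundary_chain_map [OF b(1), of \<iota>] b(2) by simp
  ultimately show ?thesis
    unfolding singular_boundary using ds(2) \<open>n \<ge> 2\<close>
    by (intro exI [of _ "- s"]) (simp add: singular_chain_minus)
qed

end

section \<open>Linear maps of positive determinant\<close>

abbreviation gl_path :: "real^'n^'n \<Rightarrow> real^'n^'n \<Rightarrow> bool" where
  "gl_path \<equiv> path_component {A. det A \<noteq> 0}"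

lemma continuous_on_matrix:
  fixes h :: "'t::topological_space \<Rightarrow> real^'n \<Rightarrow> real^'n"
  assumes "\<And>x. continuous_on S (\<lambda>t. h t x)"
  shows "continuous_on S (\<lambda>t. matrix (h t))"
  unfolding matrix_def by (intro continuous_on_vec_lambda continuous_on_component assms)

lemma continuous_on_det [continuous_intros]:
  fixes f :: "'t::topological_space \<Rightarrow> real^'n^'n"
  assumes "continuous_on S f" shows "continuous_on S (\<lambda>t. det (f t))"
  unfolding det_def
  by (intro continuous_intros continuous_on_component assms)

lemma gl_pathI:
  fixes h :: "real \<Rightarrow> real^'n \<Rightarrow> real^'n"
  assumes lin: "\<And>t. \<lbrakk>0 \<le> t; t \<le> 1\<rbrakk> \<Longrightarrow> linear (h t)"
    and inj: "\<And>t x. \<lbrakk>0 \<le> t; t \<le> 1; h t x = 0\<rbrakk> \<Longrightarrow> x = 0"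
    and cont: "\<And>x. continuous_on {0..1} (\<lambda>t. h t x)"
  shows "gl_path (matrix (h 0)) (matrix (h 1))"
  unfolding path_component_def
proof (intro exI conjI)
  show "path (\<lambda>t. matrix (h t))" unfolding path_def by (rule continuous_on_matrix [OF cont])
  have "det (matrix (h t)) \<noteq> 0" if "0 \<le> t" "t \<le> 1" for t
    using det_nz_iff_inj [OF lin [OF that]] inj [OF that] linear_injective_0 [OF lin [OF that]] by blast
  then show "path_image (\<lambda>t. matrix (h t)) \<subseteq> {A. det A \<noteq> 0}" by (auto simp: path_image_def)
qed (auto simp: pathstart_def pathfinish_def)

lemma gl_path_image:
  assumes "gl_path A B" "continuous_on UNIV f" "\<And>X. det X \<noteq> 0 \<Longrightarrow> det (f X) \<noteq> 0"
  shows "gl_path (f A) (f B)"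
proof -
  obtain g where g: "path g" "path_image g \<subseteq> {A. det A \<noteq> 0}" "pathstart g = A" "pathfinish g = B"
    using assms(1) unfolding path_component_def by blast
  have "path (f \<circ> g)" by (rule path_continuous_image [OF g(1) continuous_on_subset [OF assms(2)]]) auto
  then show ?thesis
    unfolding path_component_def
    by (intro exI [of _ "f \<circ> g"]) (use g assms(3) in \<open>auto simp: path_image_def pathstart_def pathfinish_def\<close>)
qed

lemma gl_path_mult:
  fixes A B :: "real^'n^'n"
  assumes A: "gl_path A A'" and B: "gl_path B B'"
  shows "gl_path (A ** B) (A' ** B')"
proof -
  have dets: "det A' \<noteq> 0" "det B \<noteq> 0" using A B path_component_mem by fastforce+
  have "gl_path (A ** B) (A' ** B)"
  proof (rule gl_path_image [OF A])
    show "continuous_on UNIV (\<lambda>X. X ** B)"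
      unfolding matrix_matrix_mult_def by (intro continuous_intros continuous_on_component)
  qed (use dets in \<open>simp add: det_mul\<close>)
  moreover have "gl_path (A' ** B) (A' ** B')"
  proof (rule gl_path_image [OF B])
    show "continuous_on UNIV (\<lambda>X. A' ** X)"
      unfolding matrix_matrix_mult_def by (intro continuous_intros continuous_on_component)
  qed (use dets in \<open>simp add: det_mul\<close>)
  ultimately show ?thesis by (rule path_component_trans)
qed

text \<open>Reflection in the hyperplane orthogonal to \<open>u\<close>.\<close>

definition householder :: "real^'n \<Rightarrow> real^'n \<Rightarrow> real^'n" where
  "householder u x = x - (2 * (u \<bullet> x) / (u \<bullet> u)) *\<^sub>R u"

lemma linear_householder: "linear (householder u)"
  by (rule linearI) (simp_all add: householder_def inner_add_right algebra_simps add_divide_distrib)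

lemma householder_invol: "u \<noteq> 0 \<Longrightarrow> householder u (householder u x) = x"
  by (simp add: householder_def inner_diff_right algebra_simps)

lemma householder_eq_0: "\<lbrakk>u \<noteq> 0; householder u x = 0\<rbrakk> \<Longrightarrow> x = 0"
  using householder_invol [of u x] by (simp add: householder_def)

lemma householder_axis: "householder (axis k 1) x = (\<chi> i. (if i = k then -1 else 1) * x $ i)"
proof -
  have "axis k 1 \<bullet> x = x $ k" by (simp add: inner_axis')
  moreover have "axis k (1::real) \<bullet> axis k 1 = 1" by (simp add: inner_axis_axis)
  ultimately show ?thesis by (simp add: householder_def vec_eq_iff) (simp add: axis_def)
qed

text \<open>In dimension at least two the nonzero vectors, which define the reflections, form a connected set.\<close>

lemma gl_path_householder:
  fixes u v :: "real^'n" and k m :: 'n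
  assumes "u \<noteq> 0" "v \<noteq> 0" "k \<noteq> m"
  shows "gl_path (matrix (householder u)) (matrix (householder v))"
proof -
  have "card {k, m} \<le> CARD('n)" by (rule card_mono) auto
  then have "2 \<le> DIM(real^'n)" using assms(3) by simp
  then have "path_connected (- {0 :: real^'n})" by (rule path_connected_punctured_universe)
  then obtain g where g: "path g" "path_image g \<subseteq> - {0}" "pathstart g = u" "pathfinish g = v"
    using assms unfolding path_connected_def by blast
  have nz: "g t \<noteq> 0" if "0 \<le> t" "t \<le> 1" for t
    using g(2) that by (auto simp: path_image_def)
  have cg: "continuous_on {0..1} g" using g(1) by (simp add: path_def)
  have "gl_path (matrix (householder (g 0))) (matrix (householder (g 1)))"
  proof (rule gl_pathI [of "\<lambda>t. householder (g t)"])
    show "continuous_on {0..1} (\<lambda>t. householder (g t) x)" for x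
      unfolding householder_def by (intro continuous_intros cg) (use nz in auto)
  qed (use linear_householder householder_eq_0 nz in auto)
  then show ?thesis using g by (simp add: pathstart_def pathfinish_def)
qed

text \<open>Invertible maps are products of elementary ones. A shear is joined to the identity, a diagonal map to a product of
  coordinate reflections, a transposition is itself a reflection, and all reflections are joined to each other.\<close>

lemma gl_two_components:
  fixes f :: "real^'n \<Rightarrow> real^'n" and k0 :: 'n
  assumes "linear f" "det (matrix f) \<noteq> 0"
  shows "gl_path (matrix f) (mat 1) \<or> gl_path (matrix f) (matrix (householder (axis k0 1)))"
proof -
  define D where "D = matrix (householder (axis k0 (1::real)))"
  define C where "C A \<longleftrightarrow> gl_path A (mat 1) \<or> gl_path A D" for A :: "real^'n^'n"
  have ax: "axis k (1::real) \<noteq> 0" for k :: 'n by (simp add: axis_eq_0_iff)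
  have DD: "D ** D = mat 1"
  proof -
    have "D ** D = matrix (householder (axis k0 1) \<circ> householder (axis k0 1))"
      unfolding D_def by (rule matrix_compose [OF linear_householder linear_householder, symmetric])
    also have "householder (axis k0 (1::real)) \<circ> householder (axis k0 1) = id" using householder_invol [OF ax] by auto
    finally show ?thesis by (simp only: matrix_id_mat_1)
  qed
  have Cmult: "C (A ** B)" if "C A" "C B" for A B
    using that gl_path_mult [of A "mat 1" B "mat 1"] gl_path_mult [of A "mat 1" B D]
      gl_path_mult [of A D B "mat 1"] gl_path_mult [of A D B D] DD
    by (auto simp: C_def)
  have Ctrans: "C A" if "gl_path A B" "C B" for A B
    using that path_component_trans unfolding C_def by blast
  have Chouse: "C (matrix (householder (axis k (1::real))))" for k
  proof (cases "k = k0")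
    case True
    have "det D \<noteq> 0"
      using det_nz_iff_inj [OF linear_householder] linear_injective_0 [OF linear_householder] householder_eq_0 [OF ax] unfolding D_def by blast
    then show ?thesis using True by (simp add: C_def path_component_refl flip: D_def)
  next
    case False
    then show ?thesis using gl_path_householder [OF ax ax False] by (auto simp: C_def D_def)
  qed
  have C1: "C (mat 1)" by (simp add: C_def path_component_refl det_I)
  have "linear f \<longrightarrow> det (matrix f) \<noteq> 0 \<longrightarrow> C (matrix f)"
  proof (rule induct_linear_elementary [OF assms(1)])
    fix f g :: "real^'n \<Rightarrow> real^'n"
    assume "linear f" "linear g" and *: "linear f \<longrightarrow> det (matrix f) \<noteq> 0 \<longrightarrow> C (matrix f)"
      "linear g \<longrightarrow> det (matrix g) \<noteq> 0 \<longrightarrow> C (matrix g)"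
    then have "matrix (f \<circ> g) = matrix f ** matrix g" by (intro matrix_compose)
    then show "linear (f \<circ> g) \<longrightarrow> det (matrix (f \<circ> g)) \<noteq> 0 \<longrightarrow> C (matrix (f \<circ> g))"
      using * \<open>linear f\<close> \<open>linear g\<close> Cmult by (auto simp: det_mul)
  next
    fix f :: "real^'n \<Rightarrow> real^'n" and i
    assume f: "linear f" and z: "\<And>x. f x $ i = 0"
    have "row i (matrix f) = 0" using z by (simp add: row_def matrix_def vec_eq_iff)
    then show "linear f \<longrightarrow> det (matrix f) \<noteq> 0 \<longrightarrow> C (matrix f)" by (simp add: det_zero_row)
  next
    fix c :: "'n \<Rightarrow> real"
    let ?f = "\<lambda>c x. \<chi> i. c i * x $ i"
    have lin: "linear (?f c :: real^'n \<Rightarrow> real^'n)" for c :: "'n \<Rightarrow> real"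
      by (rule linearI) (simp_all add: vec_eq_iff algebra_simps)
    have signs: "C (matrix (?f (\<lambda>i. if i \<in> S then -1 else 1)))" for S :: "'n set"
    proof (induction S rule: infinite_finite_induct)
      case empty
      have "?f (\<lambda>i. if i \<in> {} then -1 else 1) = (id :: real^'n \<Rightarrow> real^'n)" by (auto simp: vec_eq_iff)
      then show ?case using C1 by (simp add: matrix_id_mat_1)
    next
      case (insert k S)
      have "?f (\<lambda>i. if i \<in> insert k S then -1 else 1) = householder (axis k 1) \<circ> ?f (\<lambda>i. if i \<in> S then -1 else 1)"
        using insert(2) by (auto simp: vec_eq_iff householder_axis)
      then have "matrix (?f (\<lambda>i. if i \<in> insert k S then -1 else 1)) =
           matrix (householder (axis k 1)) ** matrix (?f (\<lambda>i. if i \<in> S then -1 else 1))"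
        by (simp only: matrix_compose [OF lin linear_householder])
      then show ?case using Cmult [OF Chouse insert.IH] by simp
    qed auto
    show "linear (?f c) \<longrightarrow> det (matrix (?f c)) \<noteq> 0 \<longrightarrow> C (matrix (?f c))"
    proof (intro impI)
      assume "det (matrix (?f c)) \<noteq> 0"
      then have inj: "inj (?f c :: real^'n \<Rightarrow> real^'n)" using det_nz_iff_inj [OF lin] by blast
      have c: "c i \<noteq> 0" for i
      proof
        assume "c i = 0"
        then have "?f c (axis i 1) = ?f c 0" by (auto simp: vec_eq_iff axis_def)
        then show False using injD [OF inj] ax by metis
      qed
      have "gl_path (matrix (?f (\<lambda>i. (1 - 0) * c i + 0 * sgn (c i)))) (matrix (?f (\<lambda>i. (1 - 1) * c i + 1 * sgn (c i))))"
      proof (rule gl_pathI [of "\<lambda>t. ?f (\<lambda>i. (1 - t) * c i + t * sgn (c i))"])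
        show "continuous_on {0..1} (\<lambda>t. ?f (\<lambda>i. (1 - t) * c i + t * sgn (c i)) x)" for x
          by (intro continuous_on_vec_lambda continuous_intros)
        fix t :: real and x :: "real^'n"
        assume t: "0 \<le> t" "t \<le> 1" and z: "?f (\<lambda>i. (1 - t) * c i + t * sgn (c i)) x = 0"
        have "(1 - t) * c i + t * sgn (c i) \<noteq> 0" for i
        proof (cases "c i > 0")
          case True
          then show ?thesis using t by (cases "t = 1") (auto intro!: less_imp_neq [symmetric] add_pos_nonneg)
        next
          case False
          then have "c i < 0" using c [of i] by linarith
          then have "(1 - t) * c i + t * (-1) < 0"
          proof (cases "t = 1")
            case False
            then have "(1 - t) * c i < 0" using t \<open>c i < 0\<close> by (intro mult_pos_neg) auto
            then show ?thesis using t by simp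
          qed simp
          then show ?thesis using \<open>c i < 0\<close> by simp
        qed
        then show "x = 0" using z by (simp add: vec_eq_iff)
      qed (rule lin)
      then have "gl_path (matrix (?f c)) (matrix (?f (\<lambda>i. sgn (c i))))" by simp
      moreover have "sgn (c i) = (if i \<in> {i. c i < 0} then -1 else 1)" for i
        using c [of i] by (simp add: sgn_if)
      ultimately have "gl_path (matrix (?f c)) (matrix (?f (\<lambda>i. if i \<in> {i. c i < 0} then -1 else 1)))"
        by (simp only:)
      then show "C (matrix (?f c))" by (rule Ctrans [OF _ signs])
    qed
  next
    fix m n :: 'n assume "m \<noteq> n"
    let ?s = "\<lambda>x :: real^'n. \<chi> i. x $ Transposition.transpose m n i"
    have e: "?s = householder (axis m 1 - axis n 1)"
    proof
      fix x :: "real^'n"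
      have "(axis m 1 - axis n (1::real)) \<bullet> x = x $ m - x $ n"
        by (simp add: inner_diff_left inner_axis')
      moreover have "(axis m 1 - axis n (1::real)) \<bullet> (axis m 1 - axis n 1) = 2"
        using \<open>m \<noteq> n\<close> by (simp add: inner_diff_left inner_diff_right inner_axis_axis)
      ultimately have "householder (axis m 1 - axis n 1) x = x - (x $ m - x $ n) *\<^sub>R (axis m 1 - axis n 1)"
        unfolding householder_def by (simp only:) simp
      then show "?s x = householder (axis m 1 - axis n 1) x"
        using \<open>m \<noteq> n\<close> by (auto simp: vec_eq_iff axis_def Transposition.transpose_def)
    qed
    have "axis m 1 - axis n (1::real) \<noteq> 0" using \<open>m \<noteq> n\<close> by (simp add: axis_eq_axis)
    then have "gl_path (matrix ?s) (matrix (householder (axis m 1)))"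
      unfolding e using ax \<open>m \<noteq> n\<close> by (intro gl_path_householder)
    then have "C (matrix ?s)" using Ctrans Chouse by blast
    then show "linear ?s \<longrightarrow> det (matrix ?s) \<noteq> 0 \<longrightarrow> C (matrix ?s)" by blast
  next
    fix m n :: 'n assume "m \<noteq> n"
    let ?s = "\<lambda>(t::real) (x :: real^'n). \<chi> i. if i = m then x $ m + (1 - t) * x $ n else x $ i"
    have "gl_path (matrix (?s 0)) (matrix (?s 1))"
    proof (rule gl_pathI)
      show "linear (?s t)" for t by (rule linearI) (simp_all add: vec_eq_iff algebra_simps)
      show "continuous_on {0..1} (\<lambda>t. ?s t x)" for x
      proof (intro continuous_on_vec_lambda)
        show "continuous_on {0..1} (\<lambda>t. if i = m then x $ m + (1 - t) * x $ n else x $ i)" for i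
          by (cases "i = m") (auto intro!: continuous_intros)
      qed
      fix t x assume "?s t x = 0"
      then have *: "\<And>i. (if i = m then x $ m + (1 - t) * x $ n else x $ i) = 0" by (simp add: vec_eq_iff)
      have "x $ n = 0" using *[of n] \<open>m \<noteq> n\<close> by simp
      then show "x = 0" using * by (auto simp: vec_eq_iff) (metis add.right_neutral mult_zero_right)
    qed
    moreover have "?s 1 = id" by (auto simp: vec_eq_iff)
    ultimately have "C (matrix (?s 0))" by (simp add: matrix_id_mat_1 C_def)
    moreover have "?s 0 = (\<lambda>x. \<chi> i. if i = m then x $ m + x $ n else x $ i)"
      by (rule ext) (simp add: vec_eq_iff)
    ultimately have "C (matrix (\<lambda>x :: real^'n. \<chi> i. if i = m then x $ m + x $ n else x $ i))" by (simp only:)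
    then show "linear (\<lambda>x :: real^'n. \<chi> i. if i = m then x $ m + x $ n else x $ i) \<longrightarrow>
         det (matrix (\<lambda>x :: real^'n. \<chi> i. if i = m then x $ m + x $ n else x $ i)) \<noteq> 0 \<longrightarrow>
         C (matrix (\<lambda>x :: real^'n. \<chi> i. if i = m then x $ m + x $ n else x $ i))" by (intro impI)
  qed
  then show ?thesis using assms by (simp add: C_def D_def)
qed

lemma gl_path_det_sign:
  assumes "gl_path A B" "det A > 0" shows "det B > 0"
proof -
  obtain g where g: "path g" "path_image g \<subseteq> {A. det A \<noteq> 0}" "pathstart g = A" "pathfinish g = B"
    using assms(1) unfolding path_component_def by blast
  have "connected (det ` path_image g)"
    by (intro connected_continuous_image continuous_intros connected_path_image g(1))
  then have "is_interval (det ` path_image g)" by (simp add: is_interval_connected_1)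
  moreover have "det A \<in> det ` path_image g" "det B \<in> det ` path_image g" "0 \<notin> det ` path_image g"
    using g by (auto simp: pathstart_in_path_image pathfinish_in_path_image)
  ultimately show ?thesis using assms(2) unfolding is_interval_1 by (metis less_imp_le not_le)
qed

text \<open>Of the two components only that of the identity has positive determinant.\<close>

lemma gl_path_identity:
  fixes f :: "real^'n \<Rightarrow> real^'n"
  assumes "linear f" "det (matrix f) > 0"
  shows "gl_path (matrix f) (mat 1)"
proof -
  fix k0 :: 'n
  let ?r = "householder (axis k0 (1::real))"
  have "matrix ?r = (\<chi> i j. if i = j then (if i = k0 then -1 else 1) else 0)"
    by (simp only: fun_eq_iff [THEN iffD2, OF allI, OF householder_axis]) (simp add: matrix_def vec_eq_iff axis_def)
  then have "det (matrix ?r) = (\<Prod>i\<in>UNIV. (if i = k0 then -1 else (1::real)))"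
    by (simp add: det_diagonal)
  also have "\<dots> = -1" by (simp add: prod.delta)
  finally have "\<not> gl_path (matrix f) (matrix ?r)" using gl_path_det_sign [OF _ assms(2)] by fastforce
  then show ?thesis using gl_two_components [OF assms(1), of k0] assms(2) by auto
qed

lemma homotopic_punctured:
  fixes h :: "real \<Rightarrow> 'a::real_normed_vector \<Rightarrow> 'b::real_normed_vector"
  assumes "continuous_on ({0..1} \<times> UNIV) (\<lambda>z. h (fst z) (snd z))"
    and "\<And>t x. \<lbrakk>0 \<le> t; t \<le> 1; h t x = 0\<rbrakk> \<Longrightarrow> x = 0"
  shows "homotopic_with (\<lambda>f. f \<in> - {0} \<rightarrow> - {0}) euclidean euclidean (h 0) (h 1)"
proof -
  have "homotopic_with (\<lambda>f. f \<in> - {0} \<rightarrow> - {0}) (top_of_set UNIV) (top_of_set UNIV) (h 0) (h 1)"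
    unfolding homotopic_with_def prod_topology_subtopology_eu
    by (rule exI [of _ "\<lambda>z. h (fst z) (snd z)"]) (use assms in auto)
  then show ?thesis by simp
qed

lemma homotopic_orientation_preserving:
  fixes f :: "real^'n \<Rightarrow> real^'n"
  assumes "linear f" "det (matrix f) > 0"
  shows "homotopic_with (\<lambda>f. f \<in> - {0} \<rightarrow> - {0}) euclidean euclidean f id"
proof -
  obtain g where g: "path g" "path_image g \<subseteq> {A. det A \<noteq> 0}" "pathstart g = matrix f" "pathfinish g = mat 1"
    using gl_path_identity [OF assms] unfolding path_component_def by blast
  have "homotopic_with (\<lambda>f. f \<in> - {0} \<rightarrow> - {0}) euclidean euclidean ((*v) (g 0)) ((*v) (g 1))"
  proof (rule homotopic_punctured)
    have cg: "continuous_on ({0..1} \<times> UNIV) (\<lambda>z :: real \<times> (real^'n). g (fst z))"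
      using g(1) unfolding path_def by (rule continuous_on_compose2) (auto intro!: continuous_intros)
    show "continuous_on ({0..1} \<times> UNIV) (\<lambda>z. g (fst z) *v snd z)"
      unfolding matrix_vector_mult_def
      by (intro continuous_on_vec_lambda continuous_intros continuous_on_component cg)
    show "x = 0" if "0 \<le> t" "t \<le> 1" "g t *v x = 0" for t x
    proof -
      have "det (g t) \<noteq> 0" using g(2) that by (auto simp: path_image_def image_subset_iff)
      then have "inj ((*v) (g t))" using invertible_det_nz inj_matrix_vector_mult by blast
      then show ?thesis using that(3) by (metis injD matrix_vector_mult_0_right)
    qed
  qed
  moreover have "(*v) (g 0) = f" using g(3) assms(1) by (simp add: pathstart_def)
  moreover have "(*v) (g 1) = id" using g(4) by (auto simp: pathfinish_def)
  ultimately show ?thesis by simp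
qed

section \<open>Cubes and germs of diffeomorphisms\<close>

lemma has_derivative_vec:
  fixes f :: "'a::real_normed_vector \<Rightarrow> real^'n"
  assumes "\<And>i. ((\<lambda>x. f x $ i) has_derivative (\<lambda>h. f' h $ i)) (at x within S)"
  shows "(f has_derivative f') (at x within S)"
  unfolding has_derivative_componentwise_within [of f]
  using assms by (auto simp: Basis_vec_def inner_axis)

text \<open>A diffeomorphism from all of \<open>\<real>\<^sup>n\<close> onto an open cube, increasing in each coordinate. It turns a small cube inside a
  chart into a parametrization by the whole of \<open>\<real>\<^sup>n\<close>.\<close>

definition squash :: "real^'n \<Rightarrow> real \<Rightarrow> real^'n \<Rightarrow> real^'n" where
  "squash a r v = (\<chi> i. a $ i + r * arctan (v $ i))"

definition unsquash :: "real^'n \<Rightarrow> real \<Rightarrow> real^'n \<Rightarrow> real^'n" where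
  "unsquash a r w = (\<chi> i. tan ((w $ i - a $ i) / r))"

definition cube :: "real^'n \<Rightarrow> real \<Rightarrow> (real^'n) set" where
  "cube a r = {w. \<forall>i. \<bar>w $ i - a $ i\<bar> < r * (pi / 2)}"

lemma squash_in_cube: "r > 0 \<Longrightarrow> squash a r v \<in> cube a r"
proof -
  assume "r > 0"
  have "\<bar>arctan (v $ i)\<bar> < pi / 2" for i using arctan_bounded [of "v $ i"] by linarith
  then show ?thesis using \<open>r > 0\<close> by (simp add: squash_def cube_def abs_mult)
qed

lemma unsquash_squash: "r > 0 \<Longrightarrow> unsquash a r (squash a r v) = v"
  by (simp add: squash_def unsquash_def vec_eq_iff tan_arctan)

lemma cube_bounds:
  assumes "w \<in> cube a r" "r > 0"
  shows "- (pi / 2) < (w $ i - a $ i) / r" "(w $ i - a $ i) / r < pi / 2"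
proof -
  have "\<bar>w $ i - a $ i\<bar> < r * (pi / 2)" using assms by (simp add: cube_def)
  then have "- (r * (pi / 2)) < w $ i - a $ i" "w $ i - a $ i < r * (pi / 2)" by linarith+
  then show "- (pi / 2) < (w $ i - a $ i) / r" "(w $ i - a $ i) / r < pi / 2"
    by (intro pos_less_divide_eq [OF assms(2), THEN iffD2] pos_divide_less_eq [OF assms(2), THEN iffD2];
        simp add: algebra_simps)+
qed

lemma squash_unsquash: "\<lbrakk>w \<in> cube a r; r > 0\<rbrakk> \<Longrightarrow> squash a r (unsquash a r w) = w"
  using cube_bounds [of w a r] by (simp add: squash_def unsquash_def vec_eq_iff arctan_tan)

lemma continuous_on_squash: "continuous_on S (squash a r)"
  unfolding squash_def by (intro continuous_on_vec_lambda continuous_intros continuous_on_component)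

lemma continuous_on_unsquash:
  assumes "r > 0" shows "continuous_on (cube a r) (unsquash a r)"
  unfolding unsquash_def
proof (rule continuous_on_vec_lambda)
  fix i
  have c1: "continuous_on (cube a r) (\<lambda>w. (w $ i - a $ i) / r)"
    using assms by (intro continuous_intros continuous_on_component) auto
  have "cos ((w $ i - a $ i) / r) \<noteq> 0" if "w \<in> cube a r" for w
    using cos_gt_zero_pi [OF cube_bounds [OF that assms, of i]] by simp
  then show "continuous_on (cube a r) (\<lambda>w. tan ((w $ i - a $ i) / r))"
    unfolding tan_def by (intro continuous_on_divide continuous_on_sin continuous_on_cos c1) blast
qed

lemma open_cube:
  fixes a :: "real^'n"
  shows "open (cube a r)"
proof -
  have "cube a r = (\<Inter>i. {w. \<bar>w $ i - a $ i\<bar> < r * (pi / 2)})" by (auto simp: cube_def)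
  moreover have "open {w :: real^'n. \<bar>w $ i - a $ i\<bar> < r * (pi / 2)}" for i
    by (intro open_Collect_less continuous_intros continuous_on_component)
  ultimately show ?thesis by (simp only:) (intro open_INT ballI, auto)
qed

lemma cube_in_open:
  assumes "open (S :: (real^'n) set)" "a \<in> S"
  obtains r where "r > 0" "cube a r \<subseteq> S"
proof -
  obtain e where e: "e > 0" "ball a e \<subseteq> S" using assms open_contains_ball by blast
  \<comment> \<open>The half edge \<open>r * pi / 2\<close> of the cube, summed over all coordinates, is then \<open>e / 2\<close>.\<close>
  define r where "r = e / (real CARD('n) * pi)"
  have r: "r > 0" using e by (simp add: r_def)
  have "w \<in> ball a e" if "w \<in> cube a r" for w
  proof -
    have "norm (w - a) \<le> (\<Sum>i\<in>UNIV. \<bar>(w - a) $ i\<bar>)" by (rule norm_le_l1_cart)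
    also have "\<dots> \<le> (\<Sum>i\<in>(UNIV :: 'n set). r * (pi / 2))"
      by (rule sum_mono) (use that in \<open>auto simp: cube_def less_imp_le\<close>)
    also have "\<dots> = e / 2" using e by (simp add: r_def)
    also have "\<dots> < e" using e by simp
    finally show ?thesis by (simp add: dist_norm norm_minus_commute)
  qed
  then show thesis using that r e by blast
qed

lemma squash_has_derivative:
  "(squash a r has_derivative (\<lambda>h. \<chi> i. r * inverse (1 + (v $ i)\<^sup>2) * h $ i)) (at v)"
proof (rule has_derivative_vec)
  fix i
  have "((\<lambda>t. a $ i + r * arctan t) has_field_derivative r * inverse (1 + (v $ i)\<^sup>2)) (at (v $ i))"
    by (auto intro!: derivative_eq_intros)
  then have "((\<lambda>t. a $ i + r * arctan t) has_derivative (*) (r * inverse (1 + (v $ i)\<^sup>2))) (at (v $ i))"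
    by (simp add: has_field_derivative_def)
  from has_derivative_compose [OF bounded_linear_imp_has_derivative [OF bounded_linear_vec_nth] this]
  show "((\<lambda>x. squash a r x $ i) has_derivative (\<lambda>h. (\<chi> i. r * inverse (1 + (v $ i)\<^sup>2) * h $ i) $ i)) (at v)"
    by (simp add: squash_def)
qed

lemma unsquash_has_derivative:
  assumes "w \<in> cube a r" "r > 0"
  shows "(unsquash a r has_derivative (\<lambda>h. \<chi> i. inverse ((cos ((w $ i - a $ i) / r))\<^sup>2) / r * h $ i)) (at w)"
proof (rule has_derivative_vec)
  fix i
  have "cos ((w $ i - a $ i) / r) \<noteq> 0"
    using cos_gt_zero_pi [OF cube_bounds [OF assms, of i]] by simp
  then have "((\<lambda>t. tan ((t - a $ i) / r)) has_field_derivative inverse ((cos ((w $ i - a $ i) / r))\<^sup>2) / r) (at (w $ i))"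
    using assms(2) by (auto intro!: derivative_eq_intros simp: divide_simps)
  then have "((\<lambda>t. tan ((t - a $ i) / r)) has_derivative (*) (inverse ((cos ((w $ i - a $ i) / r))\<^sup>2) / r)) (at (w $ i))"
    by (simp add: has_field_derivative_def)
  from has_derivative_compose [OF bounded_linear_imp_has_derivative [OF bounded_linear_vec_nth] this]
  show "((\<lambda>x. unsquash a r x $ i) has_derivative
     (\<lambda>h. (\<chi> i. inverse ((cos ((w $ i - a $ i) / r))\<^sup>2) / r * h $ i) $ i)) (at w)"
    by (simp add: unsquash_def)
qed

lemma diagonal_det:
  fixes c :: "'n::finite \<Rightarrow> real"
  assumes "\<And>i. c i > 0"
  shows "linear (\<lambda>h :: real^'n. \<chi> i. c i * h $ i)" "det (matrix (\<lambda>h :: real^'n. \<chi> i. c i * h $ i)) > 0"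
proof -
  show "linear (\<lambda>h :: real^'n. \<chi> i. c i * h $ i)"
    by (rule linearI) (simp_all add: vec_eq_iff algebra_simps)
  have "matrix (\<lambda>h :: real^'n. \<chi> i. c i * h $ i) = (\<chi> i j. if i = j then c i else 0)"
    by (simp add: matrix_def vec_eq_iff axis_def)
  then have "det (matrix (\<lambda>h :: real^'n. \<chi> i. c i * h $ i)) = (\<Prod>i\<in>UNIV. c i)"
    by (simp add: det_diagonal)
  also have "\<dots> > 0" using assms by (simp add: prod_pos)
  finally show "det (matrix (\<lambda>h :: real^'n. \<chi> i. c i * h $ i)) > 0" .
qed

text \<open>The map \<open>s\<close> shrinks \<open>\<real>\<^sup>n\<close> to a ball so small that there \<open>g\<close> stays closer to its derivative \<open>T\<close> than \<open>T\<close> is to zero. On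
  that ball the straight line from \<open>g\<close> to \<open>T\<close> avoids zero, and \<open>T\<close> is joined to the identity within invertible maps.\<close>

lemma homotopic_to_derivative:
  fixes g :: "real^'n \<Rightarrow> real^'n"
  assumes der: "(g has_derivative T) (at 0)" and g0: "g 0 = 0" and det: "det (matrix T) > 0"
    and W: "open W" "0 \<in> W" "continuous_on W g"
  obtains s where "continuous_on UNIV s" "range s \<subseteq> W" "s \<in> - {0} \<rightarrow> - {0}"
    "homotopic_with (\<lambda>f. f \<in> - {0} \<rightarrow> - {0}) euclidean euclidean s id"
    "homotopic_with (\<lambda>f. f \<in> - {0} \<rightarrow> - {0}) euclidean euclidean (g \<circ> s) id"
proof -
  have lin: "linear T" using der has_derivative_linear by blast
  have "inj T" using det_nz_iff_inj [OF lin] det by auto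
  then obtain B where B: "B > 0" "\<And>x. B * norm x \<le> norm (T x)"
    using linear_inj_bounded_below_pos [OF lin] by blast
  have "\<exists>d>0. \<forall>y. norm y < d \<longrightarrow> norm (g y - T y) \<le> B / 2 * norm y"
    using der B(1) g0 unfolding has_derivative_at_alt by (metis diff_zero half_gt_zero)
  then obtain d where d: "d > 0" "\<And>y. norm y < d \<Longrightarrow> norm (g y - T y) \<le> B / 2 * norm y" by blast
  obtain e where e: "e > 0" "ball 0 e \<subseteq> W" using W open_contains_ball by blast
  define \<delta> where "\<delta> = min d e / 2"
  have \<delta>: "\<delta> > 0" "\<delta> < d" "\<delta> < e" using d e by (auto simp: \<delta>_def)
  \<comment> \<open>Radial, and with image in the ball of radius \<open>\<delta>\<close>.\<close>
  define s where "s u = (\<delta> / (1 + norm u)) *\<^sub>R u" for u :: "real^'n"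
  have cs: "continuous_on S s" for S
    unfolding s_def by (intro continuous_intros) (smt (verit) norm_ge_zero)
  have ns: "norm (s u) < \<delta>" for u
  proof -
    have "norm (s u) = \<delta> * (norm u / (1 + norm u))" using \<delta> by (simp add: s_def)
    also have "\<dots> < \<delta> * 1" using \<delta> by (intro mult_strict_left_mono) (auto simp: divide_less_eq add_pos_nonneg)
    finally show ?thesis by simp
  qed
  have sW: "s u \<in> W" for u using ns [of u] \<delta> e by (auto simp: subset_iff)
  have s0: "u = 0" if "s u = 0" for u
    using that \<delta> norm_ge_zero [of u] by (auto simp: s_def)
  have fstsnd: "continuous_on S (\<lambda>z :: real \<times> (real^'n). f (snd z))" if "continuous_on UNIV f" for f :: "real^'n \<Rightarrow> real^'n" and S
    by (rule continuous_on_compose2 [OF that]) (auto intro!: continuous_intros)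
  have cT: "continuous_on S T" for S using lin by (simp add: linear_continuous_on linear_conv_bounded_linear)
  have cgs: "continuous_on UNIV (\<lambda>u. g (s u))"
    by (rule continuous_on_compose2 [OF W(3) cs]) (use sW in auto)
  have h1: "homotopic_with (\<lambda>f. f \<in> - {0} \<rightarrow> - {0}) euclidean euclidean
     (\<lambda>u. (1 - 0) *\<^sub>R s u + 0 *\<^sub>R u) (\<lambda>u. (1 - 1) *\<^sub>R s u + 1 *\<^sub>R u)"
  proof (rule homotopic_punctured [of "\<lambda>t u. (1 - t) *\<^sub>R s u + t *\<^sub>R u"])
    show "continuous_on ({0..1} \<times> UNIV) (\<lambda>z. (1 - fst z) *\<^sub>R s (snd z) + fst z *\<^sub>R snd z)"
      by (intro continuous_intros fstsnd cs)
    fix t u assume t: "0 \<le> t" "t \<le> (1::real)" and z: "(1 - t) *\<^sub>R s u + t *\<^sub>R u = 0"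
    have "((1 - t) * (\<delta> / (1 + norm u)) + t) *\<^sub>R u = 0" using z by (simp add: s_def scaleR_left_distrib)
    moreover have "(1 - t) * (\<delta> / (1 + norm u)) + t > 0"
    proof (cases "t = 0")
      case True
      then show ?thesis using \<delta> by (simp add: add_pos_nonneg)
    next
      case False
      then show ?thesis using \<delta> t by (intro add_nonneg_pos) auto
    qed
    ultimately show "u = 0" by simp
  qed
  have h2: "homotopic_with (\<lambda>f. f \<in> - {0} \<rightarrow> - {0}) euclidean euclidean
     (\<lambda>u. (1 - 0) *\<^sub>R g (s u) + 0 *\<^sub>R T (s u)) (\<lambda>u. (1 - 1) *\<^sub>R g (s u) + 1 *\<^sub>R T (s u))"
  proof (rule homotopic_punctured [of "\<lambda>t u. (1 - t) *\<^sub>R g (s u) + t *\<^sub>R T (s u)"])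
    show "continuous_on ({0..1} \<times> UNIV) (\<lambda>z. (1 - fst z) *\<^sub>R g (s (snd z)) + fst z *\<^sub>R T (s (snd z)))"
      by (intro continuous_intros fstsnd cgs continuous_on_compose2 [OF cT cs]) auto
    fix t u assume t: "0 \<le> t" "t \<le> (1::real)" and z: "(1 - t) *\<^sub>R g (s u) + t *\<^sub>R T (s u) = 0"
    have "T (s u) = - ((1 - t) *\<^sub>R (g (s u) - T (s u)))"
      using z by (simp add: algebra_simps add_eq_0_iff)
    then have "norm (T (s u)) = norm ((1 - t) *\<^sub>R (g (s u) - T (s u)))" by (metis norm_minus_cancel)
    also have "\<dots> = (1 - t) * norm (g (s u) - T (s u))" using t by simp
    also have "\<dots> \<le> 1 * (B / 2 * norm (s u))"
      using t d(2) [of "s u"] ns [of u] \<delta> B(1) by (intro mult_mono) auto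
    finally have "B * norm (s u) \<le> B / 2 * norm (s u)" using B(2) [of "s u"] by simp
    then have "norm (s u) = 0" using B(1) by (simp add: field_simps)
    then show "u = 0" using s0 by simp
  qed
  have h3: "homotopic_with (\<lambda>f. f \<in> - {0} \<rightarrow> - {0}) euclidean euclidean (T \<circ> s) (T \<circ> id)"
  proof (rule homotopic_with_compose_continuous_map_left)
    show "homotopic_with (\<lambda>f. f \<in> - {0} \<rightarrow> - {0}) euclidean euclidean s id" using h1 by (simp add: id_def)
    show "continuous_map euclidean euclidean T" using cT by simp
    show "T \<circ> f \<in> - {0} \<rightarrow> - {0}" if "f \<in> - {0} \<rightarrow> - {0}" for f :: "real^'n \<Rightarrow> real^'n"
      using that \<open>inj T\<close> linear_injective_0 [OF lin] by auto
  qed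
  have h4: "homotopic_with (\<lambda>f. f \<in> - {0} \<rightarrow> - {0}) euclidean euclidean T id"
    by (rule homotopic_orientation_preserving [OF lin det])
  show thesis
  proof
    show "continuous_on UNIV s" by (rule cs)
    show "range s \<subseteq> W" using sW by blast
    show "s \<in> - {0} \<rightarrow> - {0}" using s0 by auto
    show "homotopic_with (\<lambda>f. f \<in> - {0} \<rightarrow> - {0}) euclidean euclidean s id" using h1 by (simp add: id_def)
    have gT: "homotopic_with (\<lambda>f. f \<in> - {0} \<rightarrow> - {0}) euclidean euclidean (g \<circ> s) (T \<circ> s)" using h2 by (simp add: o_def)
    show "homotopic_with (\<lambda>f. f \<in> - {0} \<rightarrow> - {0}) euclidean euclidean (g \<circ> s) id"
      by (rule homotopic_with_trans [OF homotopic_with_trans [OF gT h3 [unfolded comp_id]] h4])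
  qed
qed

section \<open>Parametrizations of an oriented manifold\<close>

definition param :: "('a, 'n::finite) chart \<Rightarrow> real^'n \<Rightarrow> real \<Rightarrow> real^'n \<Rightarrow> 'a" where
  "param c a r v = inv_into (fst c) (snd c) (squash a r v)"

context smooth_manifold
begin

definition params :: "(real^'n \<Rightarrow> 'a) set" where
  "params = {param c a r |c a r. c \<in> A \<and> r > 0 \<and> cube a r \<subseteq> snd c ` fst c}"

lemma chart_facts:
  assumes "c \<in> A"
  shows "openin M (fst c)" "inj_on (snd c) (fst c)"
    "continuous_map (subtopology M (fst c)) (top_of_set (snd c ` fst c)) (snd c)"
    "continuous_map (top_of_set (snd c ` fst c)) (subtopology M (fst c)) (inv_into (fst c) (snd c))"
proof -
  have c: "openin M (fst c)" "open (snd c ` fst c)"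
    "homeomorphic_map (subtopology M (fst c)) (top_of_set (snd c ` fst c)) (snd c)"
    using charts [OF assms] by (auto simp: is_chart_def split: prod.splits)
  have UM: "topspace (subtopology M (fst c)) = fst c" using c(1) openin_subset by auto
  show "openin M (fst c)" by (rule c(1))
  show inj: "inj_on (snd c) (fst c)" using c(3) UM homeomorphic_imp_injective_map by metis
  show "continuous_map (subtopology M (fst c)) (top_of_set (snd c ` fst c)) (snd c)"
    by (rule homeomorphic_imp_continuous_map [OF c(3)])
  obtain g where g: "homeomorphic_maps (subtopology M (fst c)) (top_of_set (snd c ` fst c)) (snd c) g"
    using c(3) homeomorphic_map_maps by blast
  have "g w = inv_into (fst c) (snd c) w" if "w \<in> snd c ` fst c" for w
  proof -
    from that obtain x where x: "x \<in> fst c" "w = snd c x" by blast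
    then have "g w = x" using g UM by (auto simp: homeomorphic_maps_def)
    then show ?thesis using x inj by simp
  qed
  then show "continuous_map (top_of_set (snd c ` fst c)) (subtopology M (fst c)) (inv_into (fst c) (snd c))"
    using g continuous_map_eq [of "top_of_set (snd c ` fst c)" "subtopology M (fst c)" g]
    by (auto simp: homeomorphic_maps_def)
qed

lemma param_facts:
  assumes "c \<in> A" "r > 0" "cube a r \<subseteq> snd c ` fst c"
  shows "param c a r v \<in> fst c" "snd c (param c a r v) = squash a r v"
    "continuous_map euclidean M (param c a r)" "inj (param c a r)"
    "open_map euclidean M (param c a r)"
proof -
  have sq: "squash a r v \<in> snd c ` fst c" for v using squash_in_cube assms by blast
  show in1: "param c a r v \<in> fst c" for v unfolding param_def by (rule inv_into_into [OF sq])
  show eq: "snd c (param c a r v) = squash a r v" for v unfolding param_def by (rule f_inv_into_f [OF sq])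
  have "continuous_map euclidean (top_of_set (snd c ` fst c)) (squash a r)"
    using continuous_on_squash sq by (simp add: continuous_map_in_subtopology image_subset_iff)
  from continuous_map_compose [OF this chart_facts(4) [OF assms(1)]]
  have "continuous_map euclidean (subtopology M (fst c)) (param c a r)"
    by (simp add: o_def param_def [abs_def])
  then show "continuous_map euclidean M (param c a r)" by (simp add: continuous_map_in_subtopology)
  show "inj (param c a r)"
    by (rule injI) (metis eq unsquash_squash assms(2))
  have rt: "param c a r (unsquash a r (snd c x)) = x" if "x \<in> fst c" "snd c x \<in> cube a r" for x
    unfolding param_def using squash_unsquash [OF that(2) assms(2)] that(1) chart_facts(2) [OF assms(1)] by simp
  have UM: "fst c \<subseteq> topspace M" using chart_facts(1) [OF assms(1)] openin_subset by blast
  have pre: "openin M {x \<in> fst c. snd c x \<in> S}" if "open S" for S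
  proof -
    have "openin (top_of_set (snd c ` fst c)) (snd c ` fst c \<inter> S)" using that by (simp add: openin_open_Int)
    then have "openin (subtopology M (fst c)) {x \<in> topspace (subtopology M (fst c)). snd c x \<in> snd c ` fst c \<inter> S}"
      by (rule openin_continuous_map_preimage [OF chart_facts(3) [OF assms(1)]])
    moreover have "{x \<in> topspace (subtopology M (fst c)). snd c x \<in> snd c ` fst c \<inter> S} = {x \<in> fst c. snd c x \<in> S}"
      using UM by auto
    ultimately show ?thesis using openin_trans_full chart_facts(1) [OF assms(1)] by metis
  qed
  show "open_map euclidean M (param c a r)"
    unfolding open_map_def
  proof (intro allI impI)
    fix V :: "(real^'n) set" assume "openin euclidean V"
    then have "open V" by simp
    have "open (squash a r ` V)"
    proof -
      have "squash a r ` V = cube a r \<inter> unsquash a r -` V"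
      proof
        show "squash a r ` V \<subseteq> cube a r \<inter> unsquash a r -` V"
          by (auto simp: squash_in_cube [OF assms(2)] unsquash_squash [OF assms(2)])
        show "cube a r \<inter> unsquash a r -` V \<subseteq> squash a r ` V"
        proof
          fix w assume w: "w \<in> cube a r \<inter> unsquash a r -` V"
          then have "squash a r (unsquash a r w) = w" by (intro squash_unsquash assms(2)) auto
          from image_eqI [where f = "squash a r", OF this [symmetric]] show "w \<in> squash a r ` V" using w by simp
        qed
      qed
      then show ?thesis
        using continuous_on_unsquash [OF assms(2), of a] open_cube \<open>open V\<close>
        by (metis continuous_on_open_vimage inf_commute)
    qed
    moreover have "param c a r ` V = {x \<in> fst c. snd c x \<in> squash a r ` V}"
    proof
      show "param c a r ` V \<subseteq> {x \<in> fst c. snd c x \<in> squash a r ` V}" using in1 eq by auto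
      show "{x \<in> fst c. snd c x \<in> squash a r ` V} \<subseteq> param c a r ` V"
      proof
        fix x assume x: "x \<in> {x \<in> fst c. snd c x \<in> squash a r ` V}"
        then obtain v where v: "v \<in> V" "snd c x = squash a r v" by blast
        have "param c a r v = x"
          using rt [of x] x v squash_in_cube [OF assms(2), of a v] unsquash_squash [OF assms(2), of a v] by auto
        then show "x \<in> param c a r ` V" using v by blast
      qed
    qed
    ultimately show "openin M (param c a r ` V)" using pre by simp
  qed
qed

lemma params_facts:
  assumes "j \<in> params"
  shows "continuous_map euclidean M j" "inj j" "open_map euclidean M j"
proof -
  obtain c a r where c: "c \<in> A" "r > 0" "cube a r \<subseteq> snd c ` fst c" and j: "j = param c a r"
    using assms unfolding params_def by blast
  show "continuous_map euclidean M j" "inj j" "open_map euclidean M j"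
    unfolding j by (rule param_facts [OF c])+
qed

lemma params_cover:
  assumes "x \<in> topspace M"
  obtains j where "j \<in> params" "j 0 = x"
proof -
  obtain c where c: "c \<in> A" "x \<in> fst c" using cover assms by blast
  have "open (snd c ` fst c)" using charts [OF c(1)] by (auto simp: is_chart_def split: prod.splits)
  then obtain r where r: "r > 0" "cube (snd c x) r \<subseteq> snd c ` fst c"
    using cube_in_open [of "snd c ` fst c" "snd c x"] c by blast
  have "squash (snd c x) r 0 = snd c x" by (simp add: squash_def)
  then have "param c (snd c x) r 0 = x"
    using c chart_facts(2) by (simp add: param_def)
  then show thesis using that r c(1) unfolding params_def by blast
qed

end

context oriented_smooth_manifold
begin

lemma transition_derivative:
  assumes "c \<in> A" "c' \<in> A" "x \<in> fst c" "x \<in> fst c'"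
  obtains D where "(transition c c' has_derivative D) (at (snd c x))" "det (matrix D) > 0"
proof -
  let ?D = "frechet_derivative (transition c c') (at (snd c x))"
  have x: "snd c x \<in> transition_domain c c'" using assms by (auto simp: transition_domain_def)
  have "C_k_on (Suc 0) (transition c c') (transition_domain c c')"
    using smooth_transition [OF assms(1,2)] unfolding smooth_on_def by blast
  then have "transition c c' differentiable (at (snd c x))" using x by simp
  then have "(transition c c' has_derivative ?D) (at (snd c x))" using frechet_derivative_works by blast
  moreover have "det (matrix ?D) > 0" using positive_Jacobian [OF assms(1,2) x] .
  ultimately show thesis by (rule that)
qed

text \<open>Near \<open>y\<close> the two parametrizations differ by the germ \<open>g\<close> of a diffeomorphism whose derivative has positive determinant, as the
  Jacobian of the transition map has. Shrinking to the domain of \<open>g\<close> and deforming \<open>g\<close> to the identity, without passing through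
  zero, yields the homotopy. Defined on all of \<open>\<real>\<^sup>n\<close>, it compares local homology classes.\<close>

lemma params_homotopic:
  assumes "j \<in> params" "j' \<in> params" "j y = j' y'"
  shows "homotopic_with (\<lambda>h. h \<in> - {0} \<rightarrow> topspace M - {j y}) euclidean M (\<lambda>u. j (y + u)) (\<lambda>u. j' (y' + u))"
proof -
  obtain c a r where c: "c \<in> A" "r > 0" "cube a r \<subseteq> snd c ` fst c" and j: "j = param c a r"
    using assms unfolding params_def by blast
  obtain c' a' r' where c': "c' \<in> A" "r' > 0" "cube a' r' \<subseteq> snd c' ` fst c'" and j': "j' = param c' a' r'"
    using assms unfolding params_def by blast
  note pf = param_facts [OF c, folded j] and pf' = param_facts [OF c', folded j']
  define g where "g u = unsquash a' r' (transition c c' (squash a r (y + u))) - y'" for u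
  define W where "W = {u. j (y + u) \<in> range j'}"
  have tr: "transition c c' (squash a r v) = snd c' (j v)" for v
    by (simp add: transition_def j param_def)
  have gW: "j' (y' + g u) = j (y + u)" if u: "u \<in> W" for u
  proof -
    obtain v where v: "j (y + u) = j' v" using u unfolding W_def by auto
    have "g u = v - y'" unfolding g_def tr v using pf'(2) unsquash_squash [OF c'(2)] by simp
    then show ?thesis using v by simp
  qed
  have j0: "j (y + 0) = j' y'" using assms by simp
  have g0: "g 0 = 0" unfolding g_def tr j0 using pf'(2) unsquash_squash [OF c'(2)] by simp
  have W0: "0 \<in> W" unfolding W_def using assms(3) by auto
  have ctr: "continuous_map euclidean M (\<lambda>u. j (y + u))"
  proof -
    have "continuous_map euclidean euclidean (\<lambda>u. y + u)" by (simp add: continuous_intros)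
    from continuous_map_compose [OF this pf(3)] show ?thesis by (simp add: o_def)
  qed
  have ctr': "continuous_map euclidean M (\<lambda>u. j' (y' + u))"
  proof -
    have "continuous_map euclidean euclidean (\<lambda>u. y' + u)" by (simp add: continuous_intros)
    from continuous_map_compose [OF this pf'(3)] show ?thesis by (simp add: o_def)
  qed
  have opr: "openin M (range j')" using pf'(5) by (auto simp: open_map_def)
  have W_open: "open W"
    using openin_continuous_map_preimage [OF ctr opr] by (simp add: W_def)
  have Wc: "j (y + u) \<in> fst c' \<and> snd c' (j (y + u)) \<in> cube a' r'" if "u \<in> W" for u
    using that pf'(1,2) squash_in_cube [OF c'(2)] unfolding W_def by auto
  have cg: "continuous_on W g"
  proof -
    have "continuous_map (top_of_set W) (subtopology M (fst c')) (\<lambda>u. j (y + u))"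
      using ctr Wc by (auto simp: continuous_map_in_subtopology intro: continuous_map_from_subtopology)
    from continuous_map_compose [OF this chart_facts(3) [OF c'(1)]]
    have "continuous_on W (\<lambda>u. snd c' (j (y + u)))"
      by (simp add: o_def continuous_map_in_subtopology)
    then have "continuous_on W (\<lambda>u. unsquash a' r' (snd c' (j (y + u))))"
      by (rule continuous_on_compose2 [OF continuous_on_unsquash [OF c'(2)]]) (use Wc in auto)
    then show ?thesis unfolding g_def tr by (intro continuous_intros)
  qed
  obtain T where T: "(g has_derivative T) (at 0)" "det (matrix T) > 0"
  proof -
    define x where "x = j y"
    have xc: "x \<in> fst c" "snd c x = squash a r y" using pf(1,2) by (auto simp: x_def)
    have xc': "x \<in> fst c'" "snd c' x = squash a' r' y'" using pf'(1,2) assms(3) by (auto simp: x_def)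
    obtain D where D: "(transition c c' has_derivative D) (at (squash a r y))" "det (matrix D) > 0"
      using transition_derivative [OF c(1) c'(1) xc(1) xc'(1)] xc(2) by metis
    let ?d1 = "\<lambda>h :: real^'n. \<chi> i. (r * inverse (1 + (y $ i)\<^sup>2)) * h $ i"
    let ?w = "squash a' r' y'"
    let ?d2 = "\<lambda>h :: real^'n. \<chi> i. (inverse ((cos ((?w $ i - a' $ i) / r'))\<^sup>2) / r') * h $ i"
    have wc: "?w \<in> cube a' r'" by (rule squash_in_cube [OF c'(2)])
    have t1: "transition c c' (squash a r y) = ?w" using tr xc'(2) by (simp add: x_def)
    have "((\<lambda>u. y + u) has_derivative (\<lambda>h. h)) (at 0)" by (auto intro!: derivative_eq_intros)
    from has_derivative_compose [OF this, of "squash a r" ?d1]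
    have "((\<lambda>u. squash a r (y + u)) has_derivative ?d1) (at 0)"
      using squash_has_derivative [of a r y] by simp
    from has_derivative_compose [OF this, of "transition c c'" D]
    have "((\<lambda>u. transition c c' (squash a r (y + u))) has_derivative (\<lambda>h. D (?d1 h))) (at 0)"
      using D(1) by simp
    from has_derivative_compose [OF this, of "unsquash a' r'" ?d2]
    have "((\<lambda>u. unsquash a' r' (transition c c' (squash a r (y + u)))) has_derivative (\<lambda>h. ?d2 (D (?d1 h)))) (at 0)"
      using unsquash_has_derivative [OF wc c'(2)] t1 by simp
    then have der: "(g has_derivative (\<lambda>h. ?d2 (D (?d1 h)))) (at 0)"
      unfolding g_def by (auto intro!: derivative_eq_intros)
    have pos1: "r * inverse (1 + (y $ i)\<^sup>2) > 0" for i
      using c(2) by (simp add: add_pos_nonneg)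
    have pos2: "inverse ((cos ((?w $ i - a' $ i) / r'))\<^sup>2) / r' > 0" for i
      using c'(2) cos_gt_zero_pi [OF cube_bounds [OF wc c'(2), of i]] by simp
    have linD: "linear D" using D(1) has_derivative_linear by blast
    note d1 = diagonal_det [of "\<lambda>i. r * inverse (1 + (y $ i)\<^sup>2)", OF pos1]
    note d2 = diagonal_det [of "\<lambda>i. inverse ((cos ((?w $ i - a' $ i) / r'))\<^sup>2) / r'", OF pos2]
    have "(\<lambda>h. ?d2 (D (?d1 h))) = ?d2 \<circ> (D \<circ> ?d1)" by (simp add: o_def)
    then have "matrix (\<lambda>h. ?d2 (D (?d1 h))) = matrix ?d2 ** (matrix D ** matrix ?d1)"
      by (simp only: matrix_compose [OF linear_compose [OF d1(1) linD] d2(1)] matrix_compose [OF d1(1) linD])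
    then have "det (matrix (\<lambda>h. ?d2 (D (?d1 h)))) > 0"
      using d1(2) d2(2) D(2) by (simp only: det_mul) simp
    then show thesis using that der by blast
  qed
  obtain s where s: "continuous_on UNIV s" "range s \<subseteq> W" "s \<in> - {0} \<rightarrow> - {0}"
    "homotopic_with (\<lambda>f. f \<in> - {0} \<rightarrow> - {0}) euclidean euclidean s id"
    "homotopic_with (\<lambda>f. f \<in> - {0} \<rightarrow> - {0}) euclidean euclidean (g \<circ> s) id"
    by (rule homotopic_to_derivative [OF T(1) g0 T(2) W_open W0 cg])
  let ?P = "\<lambda>h. h \<in> - {0} \<rightarrow> topspace M - {j y}"
  have M_in: "j v \<in> topspace M" "j' v \<in> topspace M" for v
    using pf(3) pf'(3) by (auto simp: continuous_map_def)
  have h1: "homotopic_with ?P euclidean M ((\<lambda>u. j (y + u)) \<circ> s) ((\<lambda>u. j (y + u)) \<circ> id)"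
  proof (rule homotopic_with_compose_continuous_map_left [OF s(4) ctr])
    show "?P ((\<lambda>u. j (y + u)) \<circ> f)" if "f \<in> - {0} \<rightarrow> - {0}" for f :: "real^'n \<Rightarrow> real^'n"
      using that M_in injD [OF pf(4)] by fastforce
  qed
  have h2: "homotopic_with ?P euclidean M ((\<lambda>u. j' (y' + u)) \<circ> (g \<circ> s)) ((\<lambda>u. j' (y' + u)) \<circ> id)"
  proof (rule homotopic_with_compose_continuous_map_left [OF s(5) ctr'])
    show "?P ((\<lambda>u. j' (y' + u)) \<circ> f)" if "f \<in> - {0} \<rightarrow> - {0}" for f :: "real^'n \<Rightarrow> real^'n"
      using that M_in injD [OF pf'(4)] assms(3) by fastforce
  qed
  have eq: "(\<lambda>u. j' (y' + u)) \<circ> (g \<circ> s) = (\<lambda>u. j (y + u)) \<circ> s"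
    using gW s(2) by (auto simp: fun_eq_iff)
  show ?thesis
    using homotopic_with_trans [OF homotopic_with_symD [OF h1] h2 [unfolded eq]] unfolding comp_id .
qed

end

section \<open>Powers of an oriented closed manifold\<close>

definition idx :: "'n::finite \<Rightarrow> nat" where "idx = to_nat_on (UNIV :: 'n set)"

lemma bij_idx: "bij_betw (idx :: 'n::finite \<Rightarrow> nat) UNIV {..<CARD('n)}"
  unfolding idx_def by (rule to_nat_on_finite) simp

lemma idx_less: "idx (i :: 'n::finite) < CARD('n)"
  using bij_idx by (auto simp: bij_betw_def)

lemma inv_idx [simp]: "inv_into UNIV idx (idx (i :: 'n::finite)) = i"
  using bij_idx [where 'n = 'n] by (simp add: bij_betw_def inv_f_f)

lemma idx_inv: "i < CARD('n) \<Longrightarrow> idx (inv_into UNIV idx i :: 'n::finite) = i"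
  using bij_idx [where 'n = 'n] by (auto simp: bij_betw_def intro!: f_inv_into_f)

text \<open>The spaces \<open>(\<real>\<^sup>d)\<^sup>q\<close> and \<open>\<real>\<^sup>q\<^sup>d\<close> are identified by cutting a sequence into \<open>q\<close> blocks of length \<open>d\<close>.\<close>

definition block :: "nat \<Rightarrow> (nat \<Rightarrow> real) \<Rightarrow> real^'n::finite" where
  "block k y = (\<chi> i. y (k * CARD('n) + idx i))"

definition unblock :: "nat \<Rightarrow> (nat \<Rightarrow> real^'n::finite) \<Rightarrow> nat \<Rightarrow> real" where
  "unblock q v = (\<lambda>i. if i < q * CARD('n) then v (i div CARD('n)) $ inv_into UNIV idx (i mod CARD('n)) else 0)"

lemma unblock_Rn: "unblock q (v :: nat \<Rightarrow> real^'n::finite) \<in> Rn (q * CARD('n))"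
  by (simp add: unblock_def Rn_def)

lemma block_unblock: "k < q \<Longrightarrow> block k (unblock q v) = (v k :: real^'n::finite)"
proof -
  assume "k < q"
  have "k * CARD('n) + idx (i :: 'n) < q * CARD('n)" for i
  proof -
    have "k * CARD('n) + idx i < Suc k * CARD('n)" using idx_less [of i] by simp
    also have "\<dots> \<le> q * CARD('n)" using \<open>k < q\<close> by (intro mult_le_mono1) simp
    finally show ?thesis .
  qed
  moreover have "(k * CARD('n) + idx (i :: 'n)) div CARD('n) = k" "(k * CARD('n) + idx i) mod CARD('n) = idx i" for i
    using idx_less [of i] by simp_all
  ultimately show ?thesis by (simp add: block_def unblock_def vec_eq_iff)
qed

lemma unblock_block: "y \<in> Rn (q * CARD('n)) \<Longrightarrow> unblock q (\<lambda>k. block k y :: real^'n::finite) = y"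
proof
  fix i assume y: "y \<in> Rn (q * CARD('n))"
  have "idx (inv_into UNIV idx (i mod CARD('n)) :: 'n) = i mod CARD('n)" by (rule idx_inv) simp
  then show "unblock q (\<lambda>k. block k y :: real^'n) i = y i"
    using y by (simp add: unblock_def block_def Rn_def)
qed

lemma unblock_cong: "(\<And>k. k < q \<Longrightarrow> v k = w k) \<Longrightarrow> unblock q v = unblock q (w :: nat \<Rightarrow> real^'n::finite)"
  by (auto simp: unblock_def fun_eq_iff less_mult_imp_div_less)

lemma block_eqD:
  assumes "y \<in> Rn (q * CARD('n))" "z \<in> Rn (q * CARD('n))" "\<And>k. k < q \<Longrightarrow> block k y = (block k z :: real^'n::finite)"
  shows "y = z"
proof -
  have "unblock q (\<lambda>k. block k y :: real^'n) = unblock q (\<lambda>k. block k z :: real^'n)" by (rule unblock_cong) (rule assms(3))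
  then show ?thesis by (simp only: unblock_block [OF assms(1)] unblock_block [OF assms(2)])
qed

lemma block_add: "block k (\<lambda>i. y i + v i) = block k y + block k v"
  by (simp add: block_def vec_eq_iff)

lemma block_origin [simp]: "block k origin = 0"
  by (simp add: block_def vec_eq_iff)

lemma continuous_on_block: "continuous_on S (block k :: _ \<Rightarrow> real^'n::finite)"
  unfolding block_def
  by (intro continuous_on_vec_lambda continuous_on_subset [OF continuous_on_product_coordinates]) auto

lemma unblock_zero_iff: "unblock q (v :: nat \<Rightarrow> real^'n::finite) = origin \<longleftrightarrow> (\<forall>k<q. v k = 0)"
proof
  assume "unblock q v = origin"
  then show "\<forall>k<q. v k = 0" using block_unblock [of _ q v] by (metis block_origin)
next
  assume "\<forall>k<q. v k = 0"
  then show "unblock q v = origin" by (auto simp: unblock_def fun_eq_iff less_mult_imp_div_less)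
qed

lemma continuous_map_unblock:
  fixes f :: "'x \<Rightarrow> nat \<Rightarrow> real^'n::finite"
  assumes "\<And>k. k < q \<Longrightarrow> continuous_map X euclidean (\<lambda>x. f x k)"
  shows "continuous_map X (top_of_set (Rn (q * CARD('n)))) (\<lambda>x. unblock q (f x))"
proof -
  have "continuous_map X euclideanreal (\<lambda>x. unblock q (f x) i)" for i
  proof (cases "i < q * CARD('n)")
    case True
    then have "continuous_map X euclidean (\<lambda>x. f x (i div CARD('n)))"
      by (intro assms) (simp add: less_mult_imp_div_less)
    from continuous_map_compose [OF this, of euclidean "\<lambda>v. v $ inv_into UNIV idx (i mod CARD('n))"]
    show ?thesis using True by (simp add: unblock_def o_def continuous_on_component)
  qed (simp add: unblock_def)
  then have "continuous_map X (powertop_real UNIV) (\<lambda>x. unblock q (f x))"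
    by (simp add: continuous_map_componentwise_UNIV)
  then show ?thesis
    using unblock_Rn by (auto simp: continuous_map_in_subtopology euclidean_product_topology)
qed

context oriented_closed_smooth_manifold
begin

definition prodmap :: "nat \<Rightarrow> (nat \<Rightarrow> real^'n \<Rightarrow> 'a) \<Rightarrow> (nat \<Rightarrow> real) \<Rightarrow> nat \<Rightarrow> 'a" where
  "prodmap q J y = (\<lambda>k\<in>{..<q}. J k (block k y))"

abbreviation power_top :: "nat \<Rightarrow> (nat \<Rightarrow> 'a) topology" where
  "power_top q \<equiv> product_topology (\<lambda>_. M) {..<q}"

text \<open>Everything is checked factor by factor. For the orientation, homotopies between parametrizations of the factors combine to one
  of the product: a nonzero vector has a nonzero block, and in that factor the homotopy stays away from the point.\<close>

lemma oriented_power: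
  assumes "q > 0"
  shows "oriented_parametrizations (power_top q) (q * CARD('n)) {prodmap q J |J. \<forall>k<q. J k \<in> params}"
proof
  let ?n = "q * CARD('n)" and ?N = "power_top q"
  show "?n > 0" using assms by simp
  show "compact_space ?N" using compact by (simp add: compact_space_product_topology)
  show "Hausdorff_space ?N" using Hausdorff by (simp add: Hausdorff_space_product_topology)
  show "continuous_map (top_of_set (Rn ?n)) ?N \<iota>" if "\<iota> \<in> {prodmap q J |J. \<forall>k<q. J k \<in> params}" for \<iota>
  proof -
    from that obtain J where J: "\<iota> = prodmap q J" "\<And>k. k < q \<Longrightarrow> J k \<in> params" by blast
    have "continuous_map (top_of_set (Rn ?n)) M (\<lambda>y. J k (block k y))" if "k < q" for k
    proof -
      have "continuous_map (top_of_set (Rn ?n)) euclidean (block k :: _ \<Rightarrow> real^'n)" using continuous_on_block by simp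
      from continuous_map_compose [OF this params_facts(1) [OF J(2) [OF that]]] show ?thesis by (simp add: o_def)
    qed
    then show ?thesis unfolding J(1) prodmap_def by (auto simp: continuous_map_componentwise)
  qed
  show "inj_on \<iota> (Rn ?n)" if "\<iota> \<in> {prodmap q J |J. \<forall>k<q. J k \<in> params}" for \<iota>
  proof (rule inj_onI)
    fix y z assume yz: "y \<in> Rn ?n" "z \<in> Rn ?n" "\<iota> y = \<iota> z"
    from that obtain J where J: "\<iota> = prodmap q J" "\<And>k. k < q \<Longrightarrow> J k \<in> params" by blast
    have "block k y = (block k z :: real^'n)" if "k < q" for k
    proof -
      have "J k (block k y) = J k (block k z)"
        using fun_cong [OF yz(3), of k] that by (simp add: J(1) prodmap_def)
      then show ?thesis using injD [OF params_facts(2) [OF J(2) [OF that]]] by blast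
    qed
    then show "y = z" by (rule block_eqD [OF yz(1,2)])
  qed
  show "open_map (top_of_set (Rn ?n)) ?N \<iota>" if "\<iota> \<in> {prodmap q J |J. \<forall>k<q. J k \<in> params}" for \<iota>
    unfolding open_map_def
  proof (intro allI impI)
    fix U assume U: "openin (top_of_set (Rn ?n)) U"
    from that obtain J where J: "\<iota> = prodmap q J" "\<And>k. k < q \<Longrightarrow> J k \<in> params" by blast
    let ?V = "product_topology (\<lambda>_. euclidean :: (real^'n) topology) {..<q}"
    define O' where "O' = {v \<in> topspace ?V. unblock q v \<in> U}"
    have "continuous_map ?V (top_of_set (Rn ?n)) (unblock q)"
      by (rule continuous_map_unblock) (auto intro: continuous_map_product_projection)
    then have O': "openin ?V O'" unfolding O'_def using U by (rule openin_continuous_map_preimage)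
    show "openin ?N (\<iota> ` U)"
    proof (subst openin_subopen, intro ballI)
      fix x assume "x \<in> \<iota> ` U"
      then obtain y where y: "y \<in> U" "x = \<iota> y" by blast
      have yR: "y \<in> Rn ?n" using y U openin_subset by fastforce
      define v where "v = (\<lambda>k\<in>{..<q}. block k y :: real^'n)"
      have uv: "unblock q v = y"
        using unblock_block [OF yR] unblock_cong [of q v "\<lambda>k. block k y"] by (simp add: v_def)
      have "v \<in> O'" using uv y by (auto simp: O'_def v_def)
      from product_topology_open_contains_basis [OF O' this]
      obtain X where X: "v \<in> Pi\<^sub>E {..<q} X" "\<And>k. open (X k)" "Pi\<^sub>E {..<q} X \<subseteq> O'" by auto
      show "\<exists>T. openin ?N T \<and> x \<in> T \<and> T \<subseteq> \<iota> ` U"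
      proof (intro exI conjI)
        show "openin ?N (Pi\<^sub>E {..<q} (\<lambda>k. J k ` X k))"
        proof (subst openin_PiE, simp)
          have "openin M (J k ` X k)" if "k < q" for k
            using params_facts(3) [OF J(2) [OF that]] X(2) [of k] by (auto simp: open_map_def)
          then show "Pi\<^sub>E {..<q} (\<lambda>k. J k ` X k) = {} \<or> (\<forall>k\<in>{..<q}. openin M (J k ` X k))" by blast
        qed
        show "x \<in> Pi\<^sub>E {..<q} (\<lambda>k. J k ` X k)"
          using X(1) by (auto simp: y(2) J(1) prodmap_def v_def PiE_iff)
        show "Pi\<^sub>E {..<q} (\<lambda>k. J k ` X k) \<subseteq> \<iota> ` U"
        proof
          fix z assume z: "z \<in> Pi\<^sub>E {..<q} (\<lambda>k. J k ` X k)"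
          then have "\<forall>k\<in>{..<q}. \<exists>w. w \<in> X k \<and> z k = J k w" by (auto simp: PiE_iff)
          then obtain w where w: "\<And>k. k \<in> {..<q} \<Longrightarrow> w k \<in> X k \<and> z k = J k (w k)" by metis
          have "restrict w {..<q} \<in> Pi\<^sub>E {..<q} X" using w by simp
          then have "restrict w {..<q} \<in> O'" using X(3) by blast
          then have "unblock q (restrict w {..<q}) \<in> U" by (simp add: O'_def)
          moreover have "\<iota> (unblock q (restrict w {..<q})) = z"
          proof
            fix k show "\<iota> (unblock q (restrict w {..<q})) k = z k"
              using w z by (cases "k < q") (auto simp: J(1) prodmap_def block_unblock PiE_iff extensional_def)
          qed
          ultimately show "z \<in> \<iota> ` U" by blast
        qed
      qed
    qed
  qed
  show "\<exists>\<iota>\<in>{prodmap q J |J. \<forall>k<q. J k \<in> params}. \<iota> origin = x" if x: "x \<in> topspace ?N" for x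
  proof -
    have "\<forall>k\<in>{..<q}. \<exists>j. j \<in> params \<and> j 0 = x k"
    proof
      fix k assume "k \<in> {..<q}"
      then have "x k \<in> topspace M" using x by (auto simp: PiE_iff)
      then show "\<exists>j. j \<in> params \<and> j 0 = x k" by (rule params_cover) blast
    qed
    then obtain J where J: "\<And>k. k \<in> {..<q} \<Longrightarrow> J k \<in> params \<and> J k 0 = x k" by metis
    have "prodmap q J origin = x"
    proof
      fix k show "prodmap q J origin k = x k"
        using J x by (cases "k < q") (auto simp: prodmap_def PiE_iff extensional_def)
    qed
    then show ?thesis using J by blast
  qed
  show "homologous_rel ?n ?N (topspace ?N - {\<iota> y}) (chain_map ?n (\<lambda>v. \<iota> (\<lambda>i. y i + v i)) b)
        (chain_map ?n (\<lambda>v. \<iota>' (\<lambda>i. y' i + v i)) b)"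
    if i: "\<iota> \<in> {prodmap q J |J. \<forall>k<q. J k \<in> params}" "\<iota>' \<in> {prodmap q J |J. \<forall>k<q. J k \<in> params}"
      and y: "y \<in> Rn ?n" "y' \<in> Rn ?n" "\<iota> y = \<iota>' y'"
      and b: "singular_relcycle ?n (top_of_set (Rn ?n)) (Rn ?n - {origin}) b" for \<iota> \<iota>' y y' b
  proof (rule homotopic_imp_homologous_rel_chain_maps [OF _ b])
    from i obtain J J' where J: "\<iota> = prodmap q J" "\<And>k. k < q \<Longrightarrow> J k \<in> params"
      and J': "\<iota>' = prodmap q J'" "\<And>k. k < q \<Longrightarrow> J' k \<in> params" by blast
    have eq: "J k (block k y) = J' k (block k y')" if "k < q" for k
      using fun_cong [OF y(3), of k] that by (simp add: J(1) J'(1) prodmap_def)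
    have "\<forall>k\<in>{..<q}. \<exists>h. continuous_map (prod_topology (top_of_set {0..1::real}) euclidean) M h \<and>
        (\<forall>u. h (0, u) = J k (block k y + u)) \<and> (\<forall>u. h (1, u) = J' k (block k y' + u)) \<and>
        (\<forall>t\<in>{0..1}. \<forall>u. u \<noteq> 0 \<longrightarrow> h (t, u) \<noteq> J k (block k y))"
    proof
      fix k assume "k \<in> {..<q}"
      then have k: "k < q" by simp
      from params_homotopic [OF J(2) [OF k] J'(2) [OF k] eq [OF k]]
      show "\<exists>h. continuous_map (prod_topology (top_of_set {0..1::real}) euclidean) M h \<and>
        (\<forall>u. h (0, u) = J k (block k y + u)) \<and> (\<forall>u. h (1, u) = J' k (block k y' + u)) \<and>
        (\<forall>t\<in>{0..1}. \<forall>u. u \<noteq> 0 \<longrightarrow> h (t, u) \<noteq> J k (block k y))"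
        unfolding homotopic_with_def by (elim exE conjE, intro exI conjI) (assumption | fastforce)+
    qed
    then obtain h where h: "\<And>k. k < q \<Longrightarrow> continuous_map (prod_topology (top_of_set {0..1::real}) euclidean) M (h k)"
      "\<And>k u. k < q \<Longrightarrow> h k (0, u) = J k (block k y + u)" "\<And>k u. k < q \<Longrightarrow> h k (1, u) = J' k (block k y' + u)"
      "\<And>k t u. \<lbrakk>k < q; 0 \<le> t; t \<le> 1; u \<noteq> 0\<rbrakk> \<Longrightarrow> h k (t, u) \<noteq> J k (block k y)"
      unfolding bchoice_iff by (metis atLeastAtMost_iff lessThan_iff)
    define H where "H z = (\<lambda>k\<in>{..<q}. h k (fst z, block k (snd z)))" for z
    have cH: "continuous_map (prod_topology (top_of_set {0..1}) (top_of_set (Rn ?n))) ?N H"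
    proof -
      have "continuous_map (prod_topology (top_of_set {0..1}) (top_of_set (Rn ?n))) M (\<lambda>z. h k (fst z, block k (snd z)))"
        if k: "k < q" for k
      proof -
        have b: "continuous_map (top_of_set (Rn ?n)) euclidean (block k :: _ \<Rightarrow> real^'n)" using continuous_on_block by simp
        have "continuous_map (prod_topology (top_of_set {0..1}) (top_of_set (Rn ?n)))
            (prod_topology (top_of_set {0..1::real}) euclidean) (\<lambda>z. (fst z, block k (snd z) :: real^'n))"
          by (rule continuous_map_pairedI [OF continuous_map_fst continuous_map_compose [OF continuous_map_snd b, unfolded o_def]])
        from continuous_map_compose [OF this h(1) [OF k]] show ?thesis by (simp add: o_def)
      qed
      then show ?thesis unfolding H_def by (auto simp: continuous_map_componentwise)
    qed
    show "homotopic_with (\<lambda>f. f \<in> Rn ?n - {origin} \<rightarrow> topspace ?N - {\<iota> y}) (top_of_set (Rn ?n)) ?N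
       (\<lambda>v. \<iota> (\<lambda>i. y i + v i)) (\<lambda>v. \<iota>' (\<lambda>i. y' i + v i))"
      unfolding homotopic_with_def
    proof (intro exI conjI allI ballI)
      show "continuous_map (prod_topology (top_of_set {0..1}) (top_of_set (Rn ?n))) ?N H" by (rule cH)
      show "H (0, v) = \<iota> (\<lambda>i. y i + v i)" "H (1, v) = \<iota>' (\<lambda>i. y' i + v i)" for v
        by (auto simp: H_def J(1) J'(1) prodmap_def h(2,3) block_add)
      fix t :: real assume t: "t \<in> {0..1}"
      show "(\<lambda>v. H (t, v)) \<in> Rn ?n - {origin} \<rightarrow> topspace ?N - {\<iota> y}"
      proof
        fix v assume v: "v \<in> Rn ?n - {origin}"
        have "H (t, v) \<in> topspace ?N"
          using cH t v by (force simp: continuous_map_def)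
        moreover have "H (t, v) \<noteq> \<iota> y"
        proof
          assume e: "H (t, v) = \<iota> y"
          have "block k v = (0 :: real^'n)" if "k < q" for k
          proof (rule ccontr)
            assume "block k v \<noteq> (0 :: real^'n)"
            then have "h k (t, block k v) \<noteq> J k (block k y)" using h(4) [OF that, of t "block k v"] t by simp
            then show False using fun_cong [OF e, of k] that by (simp add: H_def J(1) prodmap_def)
          qed
          then have "v = origin" using v by (intro block_eqD [of v q origin]) auto
          then show False using v by blast
        qed
        ultimately show "H (t, v) \<in> topspace ?N - {\<iota> y}" by blast
      qed
    qed
  qed
qed

end

section \<open>Spaces of nonconstant maps\<close>

lemma homologous_rel_imp_relboundary:
  assumes "homologous_rel k X S a b" "singular_relboundary k X S b"
  shows "singular_relboundary k X S a"
  using singular_relboundary_add [of k X S "a - b" b] assms by (simp add: homologous_rel_def)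

definition nonconst :: "nat \<Rightarrow> (nat \<Rightarrow> 'a) set" where
  "nonconst p = {\<phi>. \<exists>k<p. \<phi> k \<noteq> \<phi> 0}"

lemma not_nonconstD: "\<lbrakk>\<phi> \<notin> nonconst p; k < p\<rbrakk> \<Longrightarrow> \<phi> k = \<phi> 0"
  unfolding nonconst_def by blast

lemma nonconstI: "\<lbrakk>\<phi> k \<noteq> \<phi> 0; k < p\<rbrakk> \<Longrightarrow> \<phi> \<in> nonconst p"
  unfolding nonconst_def by blast

lemma nonconstE:
  assumes "\<phi> \<in> nonconst p"
  obtains k where "k < p" "\<phi> k \<noteq> \<phi> 0"
  using assms unfolding nonconst_def by blast

text \<open>Maps defined on \<open>{..<p}\<close> are represented by extensional functions on all of \<open>nat\<close>, as in product topologies.\<close>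

definition conf :: "'a topology \<Rightarrow> nat \<Rightarrow> (nat \<Rightarrow> 'a) topology" where
  "conf X p = subtopology (product_topology (\<lambda>_. X) {..<p}) (nonconst p)"

definition rot :: "nat \<Rightarrow> (nat \<Rightarrow> 'a) \<Rightarrow> nat \<Rightarrow> 'a" where
  "rot p \<phi> = (\<lambda>k\<in>{..<p}. \<phi> (Suc k mod p))"

definition pointwise :: "nat \<Rightarrow> ('a \<Rightarrow> 'b) \<Rightarrow> (nat \<Rightarrow> 'a) \<Rightarrow> nat \<Rightarrow> 'b" where
  "pointwise p f \<phi> = (\<lambda>k\<in>{..<p}. f (\<phi> k))"

lemma topspace_conf: "topspace (conf X p) = ({..<p} \<rightarrow>\<^sub>E topspace X) \<inter> nonconst p"
  by (simp add: conf_def)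

lemma continuous_map_conf:
  "continuous_map Y (conf X p) f \<longleftrightarrow> (\<forall>k<p. continuous_map Y X (\<lambda>y. f y k)) \<and>
     (\<forall>y\<in>topspace Y. f y \<in> extensional {..<p} \<and> f y \<in> nonconst p)"
  by (auto simp: conf_def continuous_map_in_subtopology continuous_map_componentwise image_subset_iff Pi_iff)

lemma continuous_map_conf_proj: "k < p \<Longrightarrow> continuous_map (conf X p) X (\<lambda>\<phi>. \<phi> k)"
  unfolding conf_def
  by (intro continuous_map_from_subtopology continuous_map_product_projection) simp

lemma rot_funpow:
  assumes "k < p" shows "(rot p ^^ m) \<phi> k = \<phi> ((k + m) mod p)"
  using assms
proof (induction m arbitrary: k)
  case (Suc m)
  have "(rot p ^^ Suc m) \<phi> k = (rot p ^^ m) \<phi> (Suc k mod p)" using Suc.prems by (simp add: rot_def)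
  also have "\<dots> = \<phi> ((Suc k mod p + m) mod p)" using Suc.prems by (intro Suc.IH) simp
  also have "(Suc k mod p + m) mod p = (k + Suc m) mod p" by (simp add: mod_add_left_eq)
  finally show ?case .
qed simp

lemma rot_ext: "rot p \<phi> \<in> extensional {..<p}"
  by (simp add: rot_def)

lemma rot_period:
  assumes "\<phi> \<in> extensional {..<p}" shows "(rot p ^^ p) \<phi> = \<phi>"
proof
  fix k
  have ext: "(rot p ^^ m) \<phi> \<in> extensional {..<p}" for m
    using assms by (cases m) (auto simp: rot_ext)
  show "(rot p ^^ p) \<phi> k = \<phi> k"
  proof (cases "k < p")
    case True
    then show ?thesis by (simp add: rot_funpow)
  next
    case False
    then show ?thesis using ext [of p] assms by (simp add: extensional_def)
  qed
qed

lemma rot_nonconst: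
  assumes "\<phi> \<in> nonconst p" shows "rot p \<phi> \<in> nonconst p"
proof (rule ccontr)
  assume n: "rot p \<phi> \<notin> nonconst p"
  obtain k where k: "k < p" "\<phi> k \<noteq> \<phi> 0" using assms by (auto elim: nonconstE)
  have c: "rot p \<phi> i = rot p \<phi> 0" if "i < p" for i by (rule not_nonconstD [OF n that])
  have "\<phi> i = \<phi> (Suc 0 mod p)" if "i < p" for i
  proof -
    have "rot p \<phi> ((i + (p - 1)) mod p) = \<phi> i"
      using that by (simp add: rot_def mod_Suc_eq)
    moreover have "rot p \<phi> ((i + (p - 1)) mod p) = rot p \<phi> 0" using that by (intro c) simp
    ultimately show ?thesis using that by (simp add: rot_def)
  qed
  then show False using k by (metis less_nat_zero_code neq0_conv)
qed

lemma continuous_map_rot: "continuous_map (conf X p) (conf X p) (rot p)"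
  unfolding continuous_map_conf
proof (intro conjI allI impI ballI)
  fix k assume "k < p"
  then show "continuous_map (conf X p) X (\<lambda>\<phi>. rot p \<phi> k)"
    by (simp add: rot_def continuous_map_conf_proj)
qed (auto simp: rot_ext rot_nonconst topspace_conf)

text \<open>A map fixed by the shift by \<open>m\<close> is constant along multiples of \<open>m\<close>, hence constant, as \<open>m\<close> is invertible modulo \<open>p\<close>.\<close>

lemma rot_free:
  assumes "prime p" "\<phi> \<in> nonconst p" "0 < m" "m < p"
  shows "(rot p ^^ m) \<phi> \<noteq> \<phi>"
proof
  assume e: "(rot p ^^ m) \<phi> = \<phi>"
  have step: "\<phi> ((k + m) mod p) = \<phi> k" if "k < p" for k
    using rot_funpow [OF that, of m \<phi>] e by simp
  have p0: "p > 0" using assms by simp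
  have mult: "\<phi> ((i * m) mod p) = \<phi> 0" for i
  proof (induction i)
    case (Suc i)
    have "\<phi> ((Suc i * m) mod p) = \<phi> (((i * m) mod p + m) mod p)"
      by (simp add: mod_add_left_eq mod_add_right_eq add.commute)
    then show ?case using step [of "(i * m) mod p"] p0 Suc by simp
  qed simp
  have "coprime m p"
    using assms by (metis coprime_commute nat_dvd_not_less prime_imp_coprime)
  then obtain x y where x: "m * x = p * y + 1"
    using bezout_nat [of m p] assms by auto
  obtain k where k: "k < p" "\<phi> k \<noteq> \<phi> 0" using assms by (auto elim: nonconstE)
  have "((k * x) * m) mod p = (k * ((m * x) mod p)) mod p" by (simp add: mod_mult_right_eq ac_simps)
  also have "(m * x) mod p = 1"
    using mod_mult_self2 [of 1 p y] prime_gt_1_nat [OF assms(1)] by (simp add: x add.commute)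
  also have "(k * 1) mod p = k mod p" by simp
  also have "\<dots> = k" using k by simp
  finally show False using mult [of "k * x"] k by simp
qed

lemma pointwise_rot: "p > 0 \<Longrightarrow> pointwise p f (rot p \<phi>) = rot p (pointwise p f \<phi>)"
  by (auto simp: pointwise_def rot_def fun_eq_iff)

lemma continuous_map_pointwise:
  assumes "continuous_map X Y f" "inj_on f (topspace X)"
  shows "continuous_map (conf X p) (conf Y p) (pointwise p f)"
  unfolding continuous_map_conf
proof (intro conjI allI impI ballI)
  fix k assume "k < p"
  from continuous_map_compose [OF continuous_map_conf_proj [OF this] assms(1)]
  show "continuous_map (conf X p) Y (\<lambda>\<phi>. pointwise p f \<phi> k)"
    using \<open>k < p\<close> by (simp add: pointwise_def o_def)
next
  fix \<phi> assume \<phi>: "\<phi> \<in> topspace (conf X p)"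
  show "pointwise p f \<phi> \<in> extensional {..<p}" by (simp add: pointwise_def)
  obtain k where k: "k < p" "\<phi> k \<noteq> \<phi> 0" using \<phi> by (auto simp: topspace_conf elim: nonconstE)
  have "\<phi> k \<in> topspace X" "\<phi> 0 \<in> topspace X" using \<phi> k by (auto simp: topspace_conf PiE_iff)
  then have "f (\<phi> k) \<noteq> f (\<phi> 0)" using assms(2) k(2) by (auto dest: inj_onD)
  then show "pointwise p f \<phi> \<in> nonconst p" using k by (intro nonconstI [of _ k]) (auto simp: pointwise_def)
qed

text \<open>Subtracting the value at \<open>0\<close> deforms the nonconstant maps into \<open>\<real>\<^sup>d\<close> to those that vanish at \<open>0\<close>. The other \<open>p - 1\<close> values of
  such a map form a nonzero vector, so \<open>diffs\<close> and \<open>based\<close> are mutually inverse homotopy equivalences with \<open>\<real>\<^sup>n - {0}\<close>.\<close>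

definition diffs :: "nat \<Rightarrow> (nat \<Rightarrow> real^'n::finite) \<Rightarrow> nat \<Rightarrow> real" where
  "diffs p y = unblock (p - 1) (\<lambda>k. y (Suc k) - y 0)"

definition based :: "nat \<Rightarrow> (nat \<Rightarrow> real) \<Rightarrow> nat \<Rightarrow> real^'n::finite" where
  "based p z = (\<lambda>k\<in>{..<p}. if k = 0 then 0 else block (k - 1) z)"

lemma continuous_map_diffs:
  "continuous_map (conf (euclidean :: (real^'n::finite) topology) p)
     (top_of_set (Rn ((p - 1) * CARD('n)) - {origin})) (diffs p)"
proof -
  let ?C = "conf (euclidean :: (real^'n) topology) p"
  have "continuous_map ?C (top_of_set (Rn ((p - 1) * CARD('n)))) (\<lambda>y. unblock (p - 1) (\<lambda>k. y (Suc k) - y 0))"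
  proof (rule continuous_map_unblock)
    fix k assume "k < p - 1"
    then show "continuous_map ?C euclidean (\<lambda>y. y (Suc k) - y 0)"
      by (intro continuous_map_diff continuous_map_conf_proj) auto
  qed
  then have c: "continuous_map ?C (top_of_set (Rn ((p - 1) * CARD('n)))) (diffs p)"
    by (simp add: diffs_def [abs_def])
  moreover have "diffs p y \<noteq> origin" if y: "y \<in> topspace ?C" for y
  proof -
    from y obtain k where k: "k < p" "y k \<noteq> y 0" by (auto simp: topspace_conf elim: nonconstE)
    then obtain i where "k = Suc i" by (cases k) auto
    then show ?thesis using k unfolding diffs_def unblock_zero_iff by (intro notI) auto
  qed
  ultimately show ?thesis
    by (auto simp: continuous_map_in_subtopology image_subset_iff Pi_iff)
qed

lemma based_nonconst:
  assumes "z \<in> Rn ((p - 1) * CARD('n))" "z \<noteq> origin"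
  shows "(based p z :: nat \<Rightarrow> real^'n::finite) \<in> nonconst p"
proof (rule ccontr)
  assume n: "(based p z :: nat \<Rightarrow> real^'n) \<notin> nonconst p"
  have "block k z = (0 :: real^'n)" if "k < p - 1" for k
  proof -
    have "(based p z :: nat \<Rightarrow> real^'n) (Suc k) = based p z 0"
      by (rule not_nonconstD [OF n]) (use that in simp)
    moreover have "Suc k < p" "0 < p" using that by auto
    ultimately show ?thesis by (simp add: based_def)
  qed
  then have "z = origin" using assms(1) by (intro block_eqD [of z "p - 1" origin]) auto
  then show False using assms by simp
qed

lemma continuous_map_based:
  "continuous_map (top_of_set (Rn ((p - 1) * CARD('n)) - {origin}))
     (conf (euclidean :: (real^'n::finite) topology) p) (based p)"
  unfolding continuous_map_conf
proof (intro conjI allI impI ballI)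
  fix k assume "k < p"
  then show "continuous_map (top_of_set (Rn ((p - 1) * CARD('n)) - {origin})) euclidean (\<lambda>z. based p z k :: real^'n)"
    by (cases k) (auto simp: based_def continuous_on_block)
qed (auto simp: based_nonconst, simp add: based_def)

lemma diffs_based:
  assumes "z \<in> Rn ((p - 1) * CARD('n::finite))"
  shows "diffs p (based p z :: nat \<Rightarrow> real^'n) = z"
proof -
  have "diffs p (based p z :: nat \<Rightarrow> real^'n) = unblock (p - 1) (\<lambda>k. block k z :: real^'n)"
    unfolding diffs_def by (rule unblock_cong) (auto simp: based_def)
  then show ?thesis using unblock_block [OF assms] by simp
qed

lemma based_diffs: "based p (diffs p y) = (\<lambda>k\<in>{..<p}. y k - y 0 :: real^'n::finite)"
proof
  fix k show "based p (diffs p y) k = (\<lambda>k\<in>{..<p}. y k - y 0) k"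
    by (cases k) (auto simp: based_def diffs_def block_unblock)
qed

lemma homotopic_based_diffs:
  "homotopic_with (\<lambda>x. True) (conf (euclidean :: (real^'n::finite) topology) p)
     (conf (euclidean :: (real^'n) topology) p) id (based p \<circ> diffs p)"
proof -
  let ?C = "conf (euclidean :: (real^'n) topology) p"
  let ?H = "\<lambda>z. (\<lambda>k\<in>{..<p}. snd z k - fst z *\<^sub>R snd z 0)"
  have c: "continuous_map (prod_topology (top_of_set {0..1::real}) ?C) ?C ?H"
    unfolding continuous_map_conf
  proof (intro conjI allI impI ballI)
    fix k assume k: "k < p"
    have pr: "continuous_map (prod_topology (top_of_set {0..1::real}) ?C) euclidean (\<lambda>z. snd z i)" if "i < p" for i
      using continuous_map_compose [OF continuous_map_snd continuous_map_conf_proj [OF that]] by (simp add: o_def)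
    have fs: "continuous_map (prod_topology (top_of_set {0..1::real}) ?C) euclidean fst"
      using continuous_map_fst by (metis continuous_map_into_fulltopology)
    show "continuous_map (prod_topology (top_of_set {0..1::real}) ?C) euclidean (\<lambda>z. ?H z k)"
    proof -
      have 0: "0 < p" using k by simp
      have "continuous_map (prod_topology (top_of_set {0..1::real}) ?C) euclidean (\<lambda>z. fst z *\<^sub>R snd z 0)"
      proof -
        have a: "continuous_map (prod_topology (top_of_set {0..1::real}) ?C) (prod_topology euclidean euclidean) (\<lambda>z. (fst z, snd z 0))"
          by (rule continuous_map_pairedI [OF fs pr [OF 0]])
        have b: "continuous_map (prod_topology euclidean euclidean) euclidean (\<lambda>w :: real \<times> (real^'n). fst w *\<^sub>R snd w)"
          by simp (intro continuous_intros)
        show ?thesis using continuous_map_compose [OF a b] by (simp add: o_def)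
      qed
      from continuous_map_diff [OF pr [OF k] this] show ?thesis using k by simp
    qed
  next
    fix z :: "real \<times> (nat \<Rightarrow> real^'n)" assume "z \<in> topspace (prod_topology (top_of_set {0..1}) ?C)"
    then have "snd z \<in> topspace ?C" by (simp only: topspace_prod_topology mem_Times_iff)
    then have "snd z \<in> nonconst p" unfolding topspace_conf by blast
    then obtain k where "k < p" "snd z k \<noteq> snd z 0" by (rule nonconstE)
    then show "?H z \<in> nonconst p" by (intro nonconstI [of _ k]) auto
  qed auto
  show ?thesis
  proof (subst homotopic_with, simp, intro exI conjI ballI)
    show "continuous_map (prod_topology (top_of_set {0..1::real}) ?C) ?C ?H" by (rule c)
    show "?H (0, y) = id y" if "y \<in> topspace ?C" for y
      using that by (auto simp: topspace_conf PiE_iff fun_eq_iff extensional_def)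
    show "?H (1, y) = (based p \<circ> diffs p) y" for y by (simp add: based_diffs)
  qed auto
qed

lemma conf_homotopy_equivalent:
  "conf (euclidean :: (real^'n::finite) topology) p homotopy_equivalent_space
     top_of_set (Rn ((p - 1) * CARD('n)) - {origin})"
  unfolding homotopy_equivalent_space_def
proof (intro exI conjI)
  let ?C = "conf (euclidean :: (real^'n) topology) p" and ?P = "top_of_set (Rn ((p - 1) * CARD('n)) - {origin})"
  show "continuous_map ?C ?P (diffs p)" by (rule continuous_map_diffs)
  show "continuous_map ?P ?C (based p)" by (rule continuous_map_based)
  show "homotopic_with (\<lambda>x. True) ?C ?C (based p \<circ> diffs p) id"
    by (rule homotopic_with_symD [OF homotopic_based_diffs])
  show "homotopic_with (\<lambda>x. True) ?P ?P (diffs p \<circ> (based p :: _ \<Rightarrow> nat \<Rightarrow> real^'n)) id"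
  proof (rule homotopic_with_equal)
    show "continuous_map ?P ?P (diffs p \<circ> (based p :: _ \<Rightarrow> nat \<Rightarrow> real^'n))"
      by (rule continuous_map_compose [OF continuous_map_based continuous_map_diffs])
  qed (auto simp: diffs_based)
qed

lemma trivial_reduced_homology_conf:
  assumes "p \<ge> 2" "j \<noteq> int ((p - 1) * CARD('n)) - 1"
  shows "trivial_group (reduced_homology_group j (conf (euclidean :: (real^'n::finite) topology) p))"
proof -
  have "trivial_group (reduced_homology_group j (top_of_set (Rn ((p - 1) * CARD('n)) - {origin})))"
    by (rule trivial_reduced_homology_punctured) (use assms in auto)
  then show ?thesis
    using homotopy_equivalent_space_imp_isomorphic_reduced_homology_groups [OF conf_homotopy_equivalent [of p, where 'n = 'n], of j]
    by (metis group_reduced_homology_group isomorphic_group_triviality)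
qed

context oriented_closed_smooth_manifold
begin

text \<open>In the configurations of \<open>\<real>\<^sup>d\<close> the cycle is homologous to one that consists of maps vanishing at \<open>0\<close>. Its image under the
  parametrization \<open>j\<close> then factors through the complement of the point \<open>(j 0, ..., j 0)\<close> in \<open>M\<^sup>p\<^sup>-\<^sup>1\<close>, by leaving out the first
  value, and becomes a link cycle of that point, which bounds there.\<close>

lemma local_cycles_bound:
  assumes j: "j \<in> params" and "p \<ge> 2" and n: "n = (p - 1) * CARD('n)" "n \<ge> 2"
    and c: "singular_relcycle (n - 1) (conf euclidean p) {} c"
  shows "singular_relboundary (n - 1) (conf M p) {} (chain_map (n - 1) (pointwise p j) c)"
proof -
  let ?C = "conf (euclidean :: (real^'n) topology) p" and ?P = "top_of_set (Rn n - {origin})"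
  let ?q = "p - 1"
  define \<iota> where "\<iota> = prodmap ?q (\<lambda>_. j)"
  interpret N: oriented_parametrizations "power_top ?q" n "{prodmap ?q J |J. \<forall>k<?q. J k \<in> params}"
    unfolding n(1) by (rule oriented_power) (use \<open>p \<ge> 2\<close> in simp)
  have cj: "continuous_map ?C (conf M p) (pointwise p j)"
    by (rule continuous_map_pointwise) (use params_facts [OF j] in \<open>auto simp: inj_on_def inj_def\<close>)
  have "homologous_rel (n - 1) ?C {} (chain_map (n - 1) id c) (chain_map (n - 1) (based p \<circ> diffs p) c)"
    by (rule homotopic_imp_homologous_rel_chain_maps [OF _ c])
       (use homotopic_based_diffs in \<open>auto simp: homotopic_with_def\<close>)
  moreover have "chain_map (n - 1) id c = c"
    by (rule chain_map_ident [of _ ?C]) (use c in \<open>simp add: singular_cycle\<close>)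
  ultimately have 1: "homologous_rel (n - 1) ?C {} c (chain_map (n - 1) (based p \<circ> diffs p) c)" by simp
  have 2: "homologous_rel (n - 1) (conf M p) {} (chain_map (n - 1) (pointwise p j) c)
     (chain_map (n - 1) (pointwise p j) (chain_map (n - 1) (based p \<circ> diffs p) c))"
    by (rule homologous_rel_chain_map [OF 1 cj]) auto
  define \<gamma> where "\<gamma> = chain_map (n - 1) (diffs p) c"
  have \<gamma>: "singular_relcycle (n - 1) ?P {} \<gamma>"
    unfolding \<gamma>_def n(1) by (rule singular_relcycle_chain_map [OF c [unfolded n(1)] continuous_map_diffs]) auto
  define mm where "mm \<psi> = (\<lambda>k\<in>{..<p}. if k = 0 then j 0 else \<psi> (k - 1))" for \<psi>
  have link: "singular_relboundary (n - 1) (subtopology (power_top ?q) (topspace (power_top ?q) - {\<iota> origin})) {}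
      (chain_map (n - 1) \<iota> \<gamma>)"
    by (rule N.link_bounds [OF _ n(2) \<gamma>]) (use j in \<open>auto simp: \<iota>_def\<close>)
  have cm: "continuous_map (subtopology (power_top ?q) (topspace (power_top ?q) - {\<iota> origin})) (conf M p) mm"
    unfolding continuous_map_conf
  proof (intro conjI allI impI ballI)
    fix k assume "k < p"
    have "j 0 \<in> topspace M" using params_facts(1) [OF j] by (auto simp: continuous_map_def)
    then show "continuous_map (subtopology (power_top ?q) (topspace (power_top ?q) - {\<iota> origin})) M (\<lambda>\<psi>. mm \<psi> k)"
      using \<open>k < p\<close>
      by (cases k) (auto simp: mm_def intro!: continuous_map_from_subtopology continuous_map_product_projection)
  next
    fix \<psi> assume \<psi>: "\<psi> \<in> topspace (subtopology (power_top ?q) (topspace (power_top ?q) - {\<iota> origin}))"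
    show "mm \<psi> \<in> extensional {..<p}" by (simp add: mm_def)
    show "mm \<psi> \<in> nonconst p"
    proof (rule ccontr)
      assume nc: "mm \<psi> \<notin> nonconst p"
      have "\<psi> k = \<iota> origin k" for k
      proof (cases "k < ?q")
        case True
        then have "mm \<psi> (Suc k) = mm \<psi> 0" by (intro not_nonconstD [OF nc]) simp
        moreover have "Suc k < p" "0 < p" using True by auto
        ultimately show ?thesis using True by (simp add: mm_def \<iota>_def prodmap_def)
      next
        case False
        then show ?thesis using \<psi> by (auto simp: \<iota>_def prodmap_def PiE_iff extensional_def)
      qed
      then show False using \<psi> by auto
    qed
  qed
  have 3: "singular_relboundary (n - 1) (conf M p) {} (chain_map (n - 1) mm (chain_map (n - 1) \<iota> \<gamma>))"
    by (rule singular_relboundary_chain_map [OF link cm]) auto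
  have "pointwise p j (based p (diffs p y)) = mm (\<iota> (diffs p y))" for y
    by (auto simp: pointwise_def based_def mm_def \<iota>_def prodmap_def fun_eq_iff)
  then have "pointwise p j \<circ> (based p \<circ> diffs p) = mm \<circ> \<iota> \<circ> diffs p" by (auto simp: fun_eq_iff)
  from arg_cong [OF this, of "\<lambda>f. chain_map (n - 1) f c"]
  have "chain_map (n - 1) (pointwise p j) (chain_map (n - 1) (based p \<circ> diffs p) c) =
      chain_map (n - 1) mm (chain_map (n - 1) \<iota> \<gamma>)"
    unfolding \<gamma>_def by (simp only: chain_map_compose comp_apply)
  then have "singular_relboundary (n - 1) (conf M p) {}
      (chain_map (n - 1) (pointwise p j) (chain_map (n - 1) (based p \<circ> diffs p) c))" using 3 by simp
  with 2 show ?thesis by (rule homologous_rel_imp_relboundary)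
qed

end

section \<open>Equivariant resolutions by singular chains\<close>

lemma additive_funpow:
  fixes T :: "'a \<Rightarrow> 'a::ab_group_add"
  shows "Modules.additive T \<Longrightarrow> Modules.additive (T ^^ k)"
  by (induction k) (auto simp: Modules.additive_def)

lemma alt_op_natural:
  fixes \<Phi> :: "'a::ab_group_add \<Rightarrow> 'b::ab_group_add"
  assumes add: "Modules.additive \<Phi>" and S: "\<And>a. a \<in> S \<Longrightarrow> T a \<in> S"
    and nat: "\<And>a. a \<in> S \<Longrightarrow> \<Phi> (T a) = T' (\<Phi> a)" and c: "c \<in> S"
  shows "\<Phi> (alt_op p T i c) = alt_op p T' i (\<Phi> c)"
proof -
  have "(T ^^ k) c \<in> S \<and> \<Phi> ((T ^^ k) c) = (T' ^^ k) (\<Phi> c)" for k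
    by (induction k) (use c S nat in auto)
  then show ?thesis
    by (simp add: alt_op_def norm_op_def Modules.additive.diff [OF add] Modules.additive.sum [OF add] nat [OF c])
qed

lemma alt_op_alt_op:
  fixes T :: "'a \<Rightarrow> 'a::ab_group_add"
  assumes add: "Modules.additive T" and per: "(T ^^ p) c = c"
  shows "alt_op p T (Suc i) (alt_op p T i c) = 0"
proof -
  have tel: "(\<Sum>k<p. (T ^^ Suc k) c - (T ^^ k) c) = 0"
    using per sum_lessThan_telescope [of "\<lambda>k. (T ^^ k) c" p] by simp
  show ?thesis
  proof (cases "even i")
    case True
    have "(T ^^ k) (T c - c) = (T ^^ Suc k) c - (T ^^ k) c" for k
      using Modules.additive.diff [OF additive_funpow [OF add]] by (simp add: funpow_swap1)
    then show ?thesis using tel True by (simp add: alt_op_def norm_op_def)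
  next
    case False
    then show ?thesis using tel
      by (simp add: alt_op_def norm_op_def Modules.additive.sum [OF add] sum_subtractf)
  qed
qed

lemma additive_chain_map: "Modules.additive (chain_map j f)"
  by (simp add: Modules.additive_def chain_map_add)

lemma additive_chain_boundary: "Modules.additive (chain_boundary j)"
  by (simp add: Modules.additive_def chain_boundary_add)

lemma chain_map_funpow:
  fixes \<sigma> :: "'a \<Rightarrow> 'a"
  assumes "singular_chain j X c" "continuous_map X X \<sigma>"
  shows "(chain_map j \<sigma> ^^ k) c = chain_map j (\<sigma> ^^ k) c"
proof (induction k)
  case 0
  then show ?case using chain_map_ident [OF assms(1)] by (simp add: id_def)
next
  case (Suc k)
  then show ?case unfolding funpow.simps chain_map_compose by simp
qed

lemma singular_chain_alt_op:
  assumes c: "singular_chain j X c" and \<sigma>: "continuous_map X X \<sigma>"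
  shows "singular_chain j X (alt_op p (chain_map j \<sigma>) i c)"
proof -
  have "singular_chain j X ((chain_map j \<sigma> ^^ k) c)" for k
    by (induction k) (use c \<sigma> singular_chain_chain_map in auto)
  then show ?thesis
    using c \<sigma> by (auto simp: alt_op_def norm_op_def intro!: singular_chain_diff singular_chain_sum singular_chain_chain_map)
qed

lemma chain_boundary_alt_op:
  assumes c: "singular_chain j X c" and \<sigma>: "continuous_map X X \<sigma>"
  shows "chain_boundary j (alt_op p (chain_map j \<sigma>) i c) = alt_op p (chain_map (j - 1) \<sigma>) i (chain_boundary j c)"
  by (rule alt_op_natural [OF additive_chain_boundary, of "{c. singular_chain j X c}"])
     (use c \<sigma> in \<open>auto simp: chain_boundary_chain_map intro: singular_chain_chain_map\<close>)

text \<open>Applying the next operator to a chain already chosen gives a cycle, because consecutive operators annihilate each other.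
  In degrees with trivial homology it can be filled, and the filling is the next chain. The last cycle, in degree \<open>n - 1\<close>, is left
  unfilled.\<close>

lemma equivariant_resolution:
  fixes X :: "'a topology"
  assumes \<sigma>: "continuous_map X X \<sigma>" and per: "\<And>x. x \<in> topspace X \<Longrightarrow> (\<sigma> ^^ p) x = x"
    and triv: "\<And>j. Suc j < n \<Longrightarrow> trivial_group (reduced_homology_group (int j) X)"
    and x0: "x0 \<in> topspace X"
  obtains a where "\<And>j. j < n \<Longrightarrow> singular_chain j X (a j)"
    "\<And>j. Suc j < n \<Longrightarrow> chain_boundary (Suc j) (a (Suc j)) = alt_op p (chain_map j \<sigma>) j (a j)"
    "a 0 = frag_of (restrict (\<lambda>_. x0) (standard_simplex 0))"
    "\<And>j. j < n \<Longrightarrow> singular_relcycle j X {} (alt_op p (chain_map j \<sigma>) j (a j))"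
proof -
  define T where "T j = chain_map j \<sigma>" for j
  define a0 where "a0 = frag_of (restrict (\<lambda>_. x0) (standard_simplex 0))"
  define P where "P j c \<longleftrightarrow> (j < n \<longrightarrow> singular_chain j X c \<and> singular_relcycle j X {} (alt_op p (T j) j c))
      \<and> (j = 0 \<longrightarrow> c = a0)" for j and c :: "'a chain"
  have perT: "(T j ^^ p) c = c" if "singular_chain j X c" for j c
    unfolding T_def chain_map_funpow [OF that \<sigma>]
    by (rule chain_map_id_gen [OF that per])
  have sa0: "singular_chain 0 X a0"
    unfolding a0_def singular_chain_of using x0 by (simp add: singular_simplex_def)
  have "\<exists>f. \<forall>j. P j (f j) \<and> (Suc j < n \<longrightarrow> chain_boundary (Suc j) (f (Suc j)) = alt_op p (T j) j (f j))"
  proof (rule dependent_nat_choice)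
    have "singular_relcycle 0 X {} (alt_op p (T 0) 0 a0)"
      using singular_chain_alt_op [OF sa0 \<sigma>] unfolding T_def by (simp add: singular_cycle chain_boundary_def)
    then show "\<exists>x. P 0 x" using sa0 by (auto simp: P_def)
  next
    fix c j assume c: "P j c"
    show "\<exists>y. P (Suc j) y \<and> (Suc j < n \<longrightarrow> chain_boundary (Suc j) y = alt_op p (T j) j c)"
    proof (cases "Suc j < n")
      case True
      let ?z = "alt_op p (T j) j c"
      have z: "singular_relcycle j X {} ?z" "singular_chain j X c" using c True by (auto simp: P_def)
      have "chain_map 0 (\<lambda>x. ()) ?z = 0" if "j = 0"
      proof -
        have "c = a0" using c that by (auto simp: P_def)
        then show ?thesis using that
          by (simp add: alt_op_def T_def a0_def chain_map_diff simplex_map_def o_def cong: restrict_cong)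
      qed
      then have "singular_relboundary j X {} ?z"
        by (intro trivial_reduced_imp_relboundary [OF triv [OF True] z(1)]) auto
      then obtain y where y: "singular_chain (Suc j) X y" "chain_boundary (Suc j) y = ?z"
        by (auto simp: singular_boundary)
      have "chain_boundary (Suc j) (alt_op p (T (Suc j)) (Suc j) y) = alt_op p (T j) (Suc j) ?z"
        using chain_boundary_alt_op [OF y(1) \<sigma>, of p "Suc j"] y(2) by (simp add: T_def)
      also have "\<dots> = 0" by (rule alt_op_alt_op [OF _ perT [OF z(2)]]) (simp add: T_def additive_chain_map)
      finally have "singular_relcycle (Suc j) X {} (alt_op p (T (Suc j)) (Suc j) y)"
        using singular_chain_alt_op [OF y(1) \<sigma>] by (simp add: singular_cycle T_def)
      then show ?thesis using y by (auto simp: P_def)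
    qed (auto simp: P_def)
  qed
  then obtain a where a: "\<And>j. P j (a j)"
    "\<And>j. Suc j < n \<Longrightarrow> chain_boundary (Suc j) (a (Suc j)) = alt_op p (T j) j (a j)" by blast
  show thesis
  proof (rule that [of a])
    show "singular_chain j X (a j)" if "j < n" for j using a(1) [of j] that by (simp add: P_def)
    show "chain_boundary (Suc j) (a (Suc j)) = alt_op p (chain_map j \<sigma>) j (a j)" if "Suc j < n" for j
      using a(2) [OF that] by (simp add: T_def)
    show "a 0 = frag_of (restrict (\<lambda>_. x0) (standard_simplex 0))" using a(1) [of 0] by (simp add: P_def a0_def)
    show "singular_relcycle j X {} (alt_op p (chain_map j \<sigma>) j (a j))" if "j < n" for j
      using a(1) [of j] that by (simp add: P_def T_def)
  qed
qed

section \<open>Equivariant labellings\<close>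

definition vertex :: "nat \<Rightarrow> nat \<Rightarrow> real" where "vertex i = (\<lambda>k. if k = i then 1 else 0)"

lemma vertex_in_simplex: "i \<le> j \<Longrightarrow> vertex i \<in> standard_simplex j"
  using basis_in_standard_simplex [of i j] by (simp add: vertex_def)

text \<open>A labelling of points turns a singular simplex into the list of labels of its vertices.\<close>

definition vertex_labels :: "('a \<Rightarrow> 'l) \<Rightarrow> nat \<Rightarrow> ((nat \<Rightarrow> real) \<Rightarrow> 'a) \<Rightarrow> 'l list" where
  "vertex_labels lab j s = map (\<lambda>i. lab (s (vertex i))) [0..<Suc j]"

lemma faces_eq_sum:
  "faces xs = (\<Sum>k<length xs. frag_cmul ((-1) ^ k) (frag_of (take k xs @ drop (Suc k) xs)))"
proof (induction xs)
  case (Cons x xs)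
  have p: "prepend x (frag_cmul m c) = frag_cmul m (prepend x c)" for m c
    by (simp add: prepend_def push_def frag_extend_cmul)
  have "prepend x (faces xs) = (\<Sum>k<length xs. frag_cmul ((-1) ^ k) (frag_of (x # take k xs @ drop (Suc k) xs)))"
    unfolding Cons.IH by (simp add: prepend_def push_sum) (simp add: push_def frag_extend_cmul)
  then show ?case
    by (simp add: sum.lessThan_Suc_shift sum_negf del: sum.lessThan_Suc) (simp add: minus_frag_cmul flip: sum_negf)
qed simp

lemma vertex_labels_face:
  assumes "k \<le> Suc j"
  shows "vertex_labels lab j (singular_face (Suc j) k s) =
         take k (vertex_labels lab (Suc j) s) @ drop (Suc k) (vertex_labels lab (Suc j) s)"
proof (rule nth_equalityI)
  show "length (vertex_labels lab j (singular_face (Suc j) k s)) =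
      length (take k (vertex_labels lab (Suc j) s) @ drop (Suc k) (vertex_labels lab (Suc j) s))"
    using assms by (simp add: vertex_labels_def)
  fix i assume "i < length (vertex_labels lab j (singular_face (Suc j) k s))"
  then have i: "i \<le> j" by (simp add: vertex_labels_def)
  have "simplical_face k (vertex i) = vertex (if i < k then i else Suc i)"
    by (auto simp: simplical_face_def vertex_def fun_eq_iff)
  then have "singular_face (Suc j) k s (vertex i) = s (vertex (if i < k then i else Suc i))"
    using vertex_in_simplex [OF i] by (simp add: singular_face_def)
  then show "vertex_labels lab j (singular_face (Suc j) k s) ! i =
      (take k (vertex_labels lab (Suc j) s) @ drop (Suc k) (vertex_labels lab (Suc j) s)) ! i"
    using i assms by (auto simp: vertex_labels_def nth_append simp del: upt_Suc)
qed

text \<open>Reading off labels is a chain map, provided the degree is positive; compatibility in degree \<open>0\<close> concerns the augmentation.\<close>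

lemma bd_push_vertex_labels:
  "bd (push (vertex_labels lab (Suc j)) c) = push (vertex_labels lab j) (chain_boundary (Suc j) c)"
proof (induction c rule: frag_all_induct)
  case (one s)
  have len: "length (vertex_labels lab (Suc j) s) = Suc (Suc j)" by (simp add: vertex_labels_def)
  have "bd (push (vertex_labels lab (Suc j)) (frag_of s)) = faces (vertex_labels lab (Suc j) s)" by simp
  also have "\<dots> = (\<Sum>k<Suc (Suc j). frag_cmul ((-1) ^ k) (frag_of (vertex_labels lab j (singular_face (Suc j) k s))))"
    unfolding faces_eq_sum len by (rule sum.cong) (simp_all add: vertex_labels_face)
  also have "\<dots> = (\<Sum>k\<le>Suc j. push (vertex_labels lab j) (frag_cmul ((-1) ^ k) (frag_of (singular_face (Suc j) k s))))"
    unfolding lessThan_Suc_atMost by (rule sum.cong) (simp_all add: push_def frag_extend_cmul)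
  also have "\<dots> = push (vertex_labels lab j) (chain_boundary (Suc j) (frag_of s))"
    by (simp add: chain_boundary_of push_sum del: sum.atMost_Suc)
  finally show ?case .
qed (auto simp: chain_boundary_diff)

lemma vertex_labels_chain_map:
  assumes "singular_chain j X c" and "\<And>x. x \<in> topspace X \<Longrightarrow> lab (\<sigma> x) = g (lab x)"
  shows "push (vertex_labels lab j) (chain_map j \<sigma> c) = push (map g) (push (vertex_labels lab j) c)"
  using assms(1) unfolding singular_chain_def
proof (induction c rule: frag_induction)
  case (one s)
  then have "s (vertex i) \<in> topspace X" if "i \<le> j" for i
    using vertex_in_simplex [OF that] by (auto simp: singular_simplex_def continuous_map_def topspace_standard_simplex Pi_iff)
  then have "vertex_labels lab j (simplex_map j \<sigma> s) = map g (vertex_labels lab j s)"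
    using vertex_in_simplex assms(2) by (simp add: vertex_labels_def simplex_map_def)
  then show ?case by simp
qed (auto simp: chain_map_diff)

lemma singular_subdivision_power:
  assumes "singular_chain j X c"
  shows "singular_chain j X ((singular_subdivision j ^^ m) c)"
    "chain_boundary j ((singular_subdivision j ^^ m) c) = (singular_subdivision (j - 1) ^^ m) (chain_boundary j c)"
    "(singular_subdivision j ^^ m) (chain_map j \<sigma> c) = chain_map j \<sigma> ((singular_subdivision j ^^ m) c)"
proof -
  have 1: "singular_chain j X ((singular_subdivision j ^^ m) c)" for m
    by (induction m) (use assms singular_chain_singular_subdivision in auto)
  show "singular_chain j X ((singular_subdivision j ^^ m) c)" by (rule 1)
  show "chain_boundary j ((singular_subdivision j ^^ m) c) = (singular_subdivision (j - 1) ^^ m) (chain_boundary j c)"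
    by (induction m) (simp_all add: chain_boundary_singular_subdivision [OF 1])
  show "(singular_subdivision j ^^ m) (chain_map j \<sigma> c) = chain_map j \<sigma> ((singular_subdivision j ^^ m) c)"
    by (induction m) (simp_all add: naturality_singular_subdivision [OF 1])
qed

lemma singular_subdivision_power_0: "singular_chain 0 X c \<Longrightarrow> (singular_subdivision 0 ^^ m) c = c"
  by (induction m) (auto simp: singular_subdivision_zero)

lemma frag_extend_flag_chain_push:
  assumes "inj_on g V" "Poly_Mapping.keys c \<subseteq> {xs. length xs = k \<and> set xs \<subseteq> V}"
  shows "frag_extend (flag_chain k) (push (map g) c) = push (map (image g)) (frag_extend (flag_chain k) c)"
  using assms(2)
  by (induction c rule: frag_induction) (use assms(1) in \<open>auto simp: frag_extend_diff flag_chain_map\<close>)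

lemma bd_frag_extend_flag_chain:
  assumes "Poly_Mapping.keys c \<subseteq> {xs. length xs = Suc k}"
  shows "bd (frag_extend (flag_chain (Suc k)) c) = frag_extend (flag_chain k) (bd c)"
  using assms
  by (induction c rule: frag_induction) (auto simp: frag_extend_diff bd_flag_chain simp del: flag_chain.simps)

text \<open>Subdivide the chains \<open>\<alpha> j\<close> until each simplex lies in a member of the cover \<open>\<C>\<close>, so that the labels of its vertices lie in a common
  member of \<open>\<K>\<close>. The flags of these label sets form chains to which \<open>no_short_resolution\<close> applies: the action on flags is free by \<open>free\<close>, and in
  degree \<open>n\<close> there are no flags, since these would need more than \<open>n\<close> labels.\<close>

lemma no_equivariant_labelling:
  fixes X :: "'a topology" and lab :: "'a \<Rightarrow> 'l" and \<K> :: "'l set set"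
  assumes p: "p > 1"
    and \<sigma>: "continuous_map X X \<sigma>"
    and ch: "\<And>j. j \<le> n \<Longrightarrow> singular_chain j X (\<alpha> j)"
    and bS: "\<And>j. j < n \<Longrightarrow> chain_boundary (Suc j) (\<alpha> (Suc j)) = alt_op p (chain_map j \<sigma>) j (\<alpha> j)"
    and b0: "\<alpha> 0 = frag_of s0"
    and labL: "\<And>x. x \<in> topspace X \<Longrightarrow> lab x \<in> L"
    and equi: "\<And>x. x \<in> topspace X \<Longrightarrow> lab (\<sigma> x) = g (lab x)"
    and gper: "\<And>l. l \<in> L \<Longrightarrow> (g ^^ p) l = l" and gL: "\<And>l. l \<in> L \<Longrightarrow> g l \<in> L"
    and \<K>: "\<And>V. V \<in> \<K> \<Longrightarrow> V \<subseteq> L \<and> finite V \<and> card V \<le> n"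
    and gK: "\<And>V. V \<in> \<K> \<Longrightarrow> g ` V \<in> \<K>"
    and free: "\<And>V s k. \<lbrakk>V \<in> \<K>; s \<subseteq> V; s \<noteq> {}; 0 < k; k < p\<rbrakk> \<Longrightarrow> (g ^^ k) ` s \<noteq> s"
    and op: "\<And>U. U \<in> \<C> \<Longrightarrow> openin X U" and cov: "topspace X \<subseteq> \<Union>\<C>"
    and small: "\<And>U. U \<in> \<C> \<Longrightarrow> \<exists>V\<in>\<K>. lab ` U \<subseteq> V"
  shows False
proof -
  have "\<forall>j. \<exists>m. j \<le> n \<longrightarrow> (\<forall>m' f. m \<le> m' \<longrightarrow> f \<in> Poly_Mapping.keys ((singular_subdivision j ^^ m') (\<alpha> j)) \<longrightarrow>
      (\<exists>V\<in>\<C>. f \<in> standard_simplex j \<rightarrow> V))"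
  proof
    fix j
    show "\<exists>m. j \<le> n \<longrightarrow> (\<forall>m' f. m \<le> m' \<longrightarrow> f \<in> Poly_Mapping.keys ((singular_subdivision j ^^ m') (\<alpha> j)) \<longrightarrow>
      (\<exists>V\<in>\<C>. f \<in> standard_simplex j \<rightarrow> V))"
    proof (cases "j \<le> n")
      case True
      show ?thesis
        by (rule sufficient_iterated_singular_subdivision_exists [OF op cov ch [OF True]]) (assumption, blast)
    qed simp
  qed
  then obtain mf where mf: "\<And>j m' f. \<lbrakk>j \<le> n; mf j \<le> m'; f \<in> Poly_Mapping.keys ((singular_subdivision j ^^ m') (\<alpha> j))\<rbrakk>
     \<Longrightarrow> \<exists>V\<in>\<C>. f \<in> standard_simplex j \<rightarrow> V" by metis
  define m where "m = Max (mf ` {..n})"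
  have mm: "mf j \<le> m" if "j \<le> n" for j using that by (simp add: m_def)
  define sd where "sd j c = (singular_subdivision j ^^ m) c" for j and c :: "'a chain"
  define \<Phi> where "\<Phi> j c = frag_extend (flag_chain (Suc j)) (push (vertex_labels lab j) (sd j c))" for j c
  define F where "F j = \<Phi> j (\<alpha> j)" for j
  have add\<Phi>: "Modules.additive (\<Phi> j)" for j
  proof -
    have "sd j (a + b) = sd j a + sd j b" for a b
      unfolding sd_def by (induction m) (auto simp: singular_subdivision_add)
    then show ?thesis by (simp add: Modules.additive_def \<Phi>_def frag_extend_add)
  qed
  have injg: "inj_on g L"
  proof (rule inj_onI)
    fix x y assume xy: "x \<in> L" "y \<in> L" "g x = g y"
    have "(g ^^ p) x = (g ^^ (p - 1)) (g x)" "(g ^^ p) y = (g ^^ (p - 1)) (g y)"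
      using p by (metis Suc_diff_1 funpow_Suc_right o_apply order.strict_trans zero_less_one)+
    then show "x = y" using gper xy by simp
  qed
  have vtop: "f (vertex i) \<in> topspace X" if "singular_simplex j X f" "i \<le> j" for f i j
    using that vertex_in_simplex [of i j]
    by (auto simp: singular_simplex_def continuous_map_def topspace_standard_simplex Pi_iff)
  have keysL: "Poly_Mapping.keys (push (vertex_labels lab j) c) \<subseteq> {xs. length xs = Suc j \<and> set xs \<subseteq> L}"
    if "singular_chain j X c" for j c
  proof -
    have "vertex_labels lab j f \<in> {xs. length xs = Suc j \<and> set xs \<subseteq> L}" if "singular_simplex j X f" for f
      using vtop [OF that] labL by (auto simp: vertex_labels_def simp del: upt_Suc)
    then show ?thesis using keys_push [of "vertex_labels lab j" c] that unfolding singular_chain_def by blast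
  qed
  have \<Phi>\<sigma>: "\<Phi> j (chain_map j \<sigma> c) = push (map (image g)) (\<Phi> j c)" if c: "singular_chain j X c" for j c
  proof -
    have s: "singular_chain j X (sd j c)" unfolding sd_def by (rule singular_subdivision_power(1) [OF c])
    have "push (vertex_labels lab j) (sd j (chain_map j \<sigma> c)) = push (map g) (push (vertex_labels lab j) (sd j c))"
      using vertex_labels_chain_map [where lab = lab and \<sigma> = \<sigma> and g = g, OF s equi] singular_subdivision_power(3) [OF c, where \<sigma> = \<sigma>] by (simp add: sd_def)
    then show ?thesis
      unfolding \<Phi>_def using frag_extend_flag_chain_push [OF injg keysL [OF s]] by simp
  qed
  define \<Omega> where "\<Omega> j = (\<Union>V\<in>\<K>. flags (Suc j) V)" for j
  have keysF: "Poly_Mapping.keys (F j) \<subseteq> \<Omega> j" if "j \<le> n" for j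
  proof -
    have s: "singular_chain j X (sd j (\<alpha> j))" unfolding sd_def by (rule singular_subdivision_power(1) [OF ch [OF that]])
    have "Poly_Mapping.keys (flag_chain (Suc j) xs) \<subseteq> \<Omega> j"
      if xs: "xs \<in> Poly_Mapping.keys (push (vertex_labels lab j) (sd j (\<alpha> j)))" for xs
    proof -
      obtain f where f: "f \<in> Poly_Mapping.keys (sd j (\<alpha> j))" "xs = vertex_labels lab j f"
        using xs keys_push by fastforce
      obtain U where U: "U \<in> \<C>" "f \<in> standard_simplex j \<rightarrow> U"
        using mf [OF \<open>j \<le> n\<close> mm [OF \<open>j \<le> n\<close>]] f(1) unfolding sd_def by blast
      obtain V where V: "V \<in> \<K>" "lab ` U \<subseteq> V" using small U(1) by blast
      have "set xs \<subseteq> V"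
      proof
        fix l assume "l \<in> set xs"
        then obtain i where i: "i < Suc j" "l = lab (f (vertex i))"
          using f(2) by (auto simp: vertex_labels_def simp del: upt_Suc)
        have "f (vertex i) \<in> U" using i(1) by (intro funcset_mem [OF U(2)] vertex_in_simplex) simp
        then show "l \<in> V" using V(2) i(2) by blast
      qed
      moreover have "length xs = Suc j" using f(2) by (simp add: vertex_labels_def)
      ultimately show ?thesis
        using keys_flag_chain [of xs "Suc j"] flags_mono [of "set xs" V "Suc j"] V(1) unfolding \<Omega>_def by (meson UN_upper order.trans)
    qed
    then show ?thesis unfolding F_def \<Phi>_def by (intro order.trans [OF keys_frag_extend] UN_least)
  qed
  have mapk: "(map (image g) ^^ k) xs = map (image (g ^^ k)) xs" for k and xs :: "'l set list"
    by (induction k arbitrary: xs) (auto simp: image_comp)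
  show False
  proof (rule no_short_resolution [OF p, where act = "image g" and \<Omega> = \<Omega> and a = F and n = n])
    show "map (image g) xs \<in> \<Omega> j" if "xs \<in> \<Omega> j" for j xs
    proof -
      from that obtain V where V: "V \<in> \<K>" "xs \<in> flags (Suc j) V" by (auto simp: \<Omega>_def)
      have sub: "s \<subseteq> L" if "s \<in> set xs" for s using V \<K> [OF V(1)] that by (auto simp: flags_def)
      have "sorted_wrt (\<lambda>s t. g ` t \<subset> g ` s) xs"
      proof (rule sorted_wrt_mono_rel)
        show "sorted_wrt (\<lambda>s t. t \<subset> s) xs" using V(2) by (simp add: flags_def)
        fix s t assume "s \<in> set xs" "t \<in> set xs" "t \<subset> s"
        then show "g ` t \<subset> g ` s"
          using sub inj_on_image_eq_iff [OF injg] by (metis image_mono psubset_eq)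
      qed
      then have "map (image g) xs \<in> flags (Suc j) (g ` V)"
        using V(2) by (auto simp: flags_def sorted_wrt_map)
      then show ?thesis using gK [OF V(1)] by (auto simp: \<Omega>_def)
    qed
    show "(map (image g) ^^ p) xs = xs" if "xs \<in> \<Omega> j" for j xs
    proof -
      from that obtain V where V: "V \<in> \<K>" "xs \<in> flags (Suc j) V" by (auto simp: \<Omega>_def)
      have "(g ^^ p) ` s = s" if "s \<in> set xs" for s
      proof -
        have "s \<subseteq> L" using V \<K> [OF V(1)] that by (auto simp: flags_def)
        then have "\<And>l. l \<in> s \<Longrightarrow> (g ^^ p) l = l" using gper by blast
        then show ?thesis by force
      qed
      then show ?thesis unfolding mapk by (simp add: map_idI)
    qed
    show "(map (image g) ^^ k) xs \<noteq> xs" if "xs \<in> \<Omega> j" "0 < k" "k < p" for j xs k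
    proof -
      from that obtain V where V: "V \<in> \<K>" "xs \<in> flags (Suc j) V" by (auto simp: \<Omega>_def)
      then obtain s ys where xs: "xs = s # ys" by (cases xs) (auto simp: flags_def)
      then have "(g ^^ k) ` s \<noteq> s" using V that by (intro free [OF V(1)]) (auto simp: flags_def)
      then show ?thesis unfolding mapk xs by simp
    qed
    show "Poly_Mapping.keys (faces xs) \<subseteq> \<Omega> j" if "xs \<in> \<Omega> (Suc j)" for j xs
    proof
      fix ys assume ys: "ys \<in> Poly_Mapping.keys (faces xs)"
      from that obtain V where V: "V \<in> \<K>" "xs \<in> flags (Suc (Suc j)) V" by (auto simp: \<Omega>_def)
      have "ys \<in> flags (Suc j) V"
        using keys_faces [OF ys, of "\<lambda>s t. t \<subset> s"] V(2) by (auto simp: flags_def)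
      then show "ys \<in> \<Omega> j" using V(1) by (auto simp: \<Omega>_def)
    qed
    show "Poly_Mapping.keys (F j) \<subseteq> \<Omega> j" if "j \<le> n" for j by (rule keysF [OF that])
    show "bd (F 0) = frag_of []"
    proof -
      have "sd 0 (\<alpha> 0) = \<alpha> 0" unfolding sd_def by (rule singular_subdivision_power_0 [OF ch]) simp
      then show ?thesis by (simp add: F_def \<Phi>_def b0 vertex_labels_def prepend_0)
    qed
    show "bd (F (Suc j)) = alt_op p (push (map (image g))) j (F j)" if "j < n" for j
    proof -
      have c: "singular_chain (Suc j) X (\<alpha> (Suc j))" using that by (intro ch) simp
      have cj: "singular_chain j X (\<alpha> j)" using that by (intro ch) simp
      have s: "singular_chain (Suc j) X (sd (Suc j) (\<alpha> (Suc j)))" unfolding sd_def by (rule singular_subdivision_power(1) [OF c])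
      have "bd (F (Suc j)) = frag_extend (flag_chain (Suc j)) (bd (push (vertex_labels lab (Suc j)) (sd (Suc j) (\<alpha> (Suc j)))))"
        unfolding F_def \<Phi>_def by (rule bd_frag_extend_flag_chain) (use keysL [OF s] in blast)
      also have "\<dots> = \<Phi> j (chain_boundary (Suc j) (\<alpha> (Suc j)))"
        using singular_subdivision_power(2) [OF c, of m] by (simp add: \<Phi>_def bd_push_vertex_labels sd_def del: flag_chain.simps)
      also have "\<dots> = \<Phi> j (alt_op p (chain_map j \<sigma>) j (\<alpha> j))" by (simp add: bS [OF that])
      also have "\<dots> = alt_op p (push (map (image g))) j (\<Phi> j (\<alpha> j))"
        by (rule alt_op_natural [OF add\<Phi>, of "{c. singular_chain j X c}"])
           (use cj \<sigma> \<Phi>\<sigma> in \<open>auto intro: singular_chain_chain_map\<close>)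
      finally show ?thesis by (simp add: F_def)
    qed
    show "F n = 0"
    proof -
      have "flags (Suc n) V = {}" if "V \<in> \<K>" for V by (rule flags_empty) (use \<K> [OF that] in auto)
      then have "\<Omega> n = {}" by (auto simp: \<Omega>_def)
      then show ?thesis using keysF [of n] by simp
    qed
  qed
qed

section \<open>Zeros of equivariant maps\<close>

context oriented_closed_smooth_manifold
begin

text \<open>Up to degree \<open>n - 1\<close> the chains are the images of chains of configurations in \<open>\<real>\<^sup>d\<close>, which is as far as the homology there is trivial. One
  more chain exists in \<open>M\<close> by \<open>local_cycles_bound\<close>.\<close>

lemma equivariant_chains_conf:
  assumes p: "prime p" "p > 2" and ne: "topspace M \<noteq> {}" and n: "n = (p - 1) * CARD('n)"
  obtains \<alpha> s where "\<And>j. j \<le> n \<Longrightarrow> singular_chain j (conf M p) (\<alpha> j)"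
    "\<And>j. j < n \<Longrightarrow> chain_boundary (Suc j) (\<alpha> (Suc j)) = alt_op p (chain_map j (rot p)) j (\<alpha> j)"
    "\<alpha> 0 = frag_of s"
proof -
  define X where "X = conf (euclidean :: (real^'n) topology) p"
  have "2 * 1 \<le> (p - 1) * CARD('n)" using p by (intro mult_mono) auto
  then have n2: "n \<ge> 2" using n by simp
  obtain j where j: "j \<in> params" using ne params_cover by blast
  let ?P = "pointwise p j"
  have P: "continuous_map X (conf M p) ?P"
    unfolding X_def using params_facts [OF j] by (intro continuous_map_pointwise) auto
  have \<sigma>: "continuous_map X X (rot p)" unfolding X_def by (rule continuous_map_rot)
  have "(\<lambda>k\<in>{..<p}. if k = 0 then 0 else axis undefined 1) \<in> topspace X"
    using p by (auto simp: X_def topspace_conf axis_eq_0_iff intro!: nonconstI [where k = 1])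
  then obtain x0 where x0: "x0 \<in> topspace X" by blast
  have per: "(rot p ^^ p) x = x" if "x \<in> topspace X" for x
    using that by (intro rot_period) (auto simp: X_def topspace_conf PiE_iff)
  have triv: "trivial_group (reduced_homology_group (int i) X)" if "Suc i < n" for i
  proof -
    have "int i \<noteq> int ((p - 1) * CARD('n)) - 1" using that n by linarith
    then show ?thesis unfolding X_def using p by (intro trivial_reduced_homology_conf) auto
  qed
  obtain a where a: "\<And>j. j < n \<Longrightarrow> singular_chain j X (a j)"
    "\<And>j. Suc j < n \<Longrightarrow> chain_boundary (Suc j) (a (Suc j)) = alt_op p (chain_map j (rot p)) j (a j)"
    "a 0 = frag_of (restrict (\<lambda>_. x0) (standard_simplex 0))"
    "\<And>j. j < n \<Longrightarrow> singular_relcycle j X {} (alt_op p (chain_map j (rot p)) j (a j))"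
    using equivariant_resolution [OF \<sigma> per triv x0] by blast
  have "singular_relboundary (n - 1) (conf M p) {}
      (chain_map (n - 1) ?P (alt_op p (chain_map (n - 1) (rot p)) (n - 1) (a (n - 1))))"
    using a(4) [of "n - 1"] n2 p by (intro local_cycles_bound [OF j _ n]) (auto simp: X_def)
  then obtain \<beta> where \<beta>: "singular_chain n (conf M p) \<beta>"
    "chain_boundary n \<beta> = chain_map (n - 1) ?P (alt_op p (chain_map (n - 1) (rot p)) (n - 1) (a (n - 1)))"
    using n2 by (auto simp: singular_boundary)
  have nat: "chain_map i ?P (alt_op p (chain_map i (rot p)) i c) = alt_op p (chain_map i (rot p)) i (chain_map i ?P c)"
    if c: "singular_chain i X c" for i c
  proof (rule alt_op_natural [OF additive_chain_map, where S = "{c. singular_chain i X c}"])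
    fix b assume b: "b \<in> {c. singular_chain i X c}"
    show "chain_map i (rot p) b \<in> {c. singular_chain i X c}"
      using b \<sigma> by (simp add: singular_chain_chain_map)
    have "?P \<circ> rot p = rot p \<circ> ?P" using p by (intro ext) (simp add: pointwise_rot)
    then show "chain_map i ?P (chain_map i (rot p) b) = chain_map i (rot p) (chain_map i ?P b)"
      by (metis chain_map_compose comp_apply)
  qed (use c in simp)
  define \<alpha> where "\<alpha> i = (if i = n then \<beta> else chain_map i ?P (a i))" for i
  show thesis
  proof (rule that [of \<alpha>])
    show "singular_chain i (conf M p) (\<alpha> i)" if "i \<le> n" for i
      using that \<beta>(1) singular_chain_chain_map [OF a(1) P] by (auto simp: \<alpha>_def)
    show "chain_boundary (Suc i) (\<alpha> (Suc i)) = alt_op p (chain_map i (rot p)) i (\<alpha> i)" if i: "i < n" for i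
    proof (cases "Suc i = n")
      case True
      then show ?thesis using \<beta>(2) nat [OF a(1) [OF i]] by (auto simp: \<alpha>_def)
    next
      case False
      then have "Suc i < n" using i by simp
      then show ?thesis
        using a(1) [of "Suc i"] a(2) [of i] nat [OF a(1) [OF i]] i
        by (simp add: \<alpha>_def chain_boundary_chain_map [of "Suc i" X])
    qed
    show "\<alpha> 0 = frag_of (simplex_map 0 ?P (restrict (\<lambda>_. x0) (standard_simplex 0)))"
      using n2 a(3) by (simp add: \<alpha>_def)
  qed
qed

end

text \<open>The action on indices matching \<open>rot\<close> on maps. A shift of the map by one step forward moves the position of a
  largest value one step back, and going back one step is adding \<open>p - 1\<close>.\<close>

definition back_label :: "nat \<Rightarrow> nat \<times> nat \<Rightarrow> nat \<times> nat" where
  "back_label p = (\<lambda>(h, i). ((h + (p - 1)) mod p, i))"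

lemma back_label_funpow: "h < p \<Longrightarrow> (back_label p ^^ k) (h, i) = ((h + k * (p - 1)) mod p, i)"
proof (induction k)
  case (Suc k)
  have "((h + k * (p - 1)) mod p + (p - 1)) mod p = (h + Suc k * (p - 1)) mod p"
    unfolding mod_add_left_eq by (simp only: mult_Suc add.assoc add.commute add.left_commute)
  then show ?case using Suc by (simp only: funpow.simps comp_apply back_label_def prod.case)
qed simp

lemma Suc_pred_mod: "h < p \<Longrightarrow> Suc ((h + (p - 1)) mod p) mod p = h" for h p :: nat
  by (simp add: mod_Suc_eq)

text \<open>A nontrivial shift generates \<open>\<int>\<^sub>p\<close>, so a set that it leaves invariant contains the whole orbit of each of its elements.\<close>

lemma back_label_invariant_contains_fibre:
  assumes p: "prime p" and k: "0 < k" "k < p" and inv: "(back_label p ^^ k) ` s = s"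
    and hi: "(h, i) \<in> s" "h < p"
  shows "{..<p} \<times> {i} \<subseteq> s"
proof -
  have p1: "p > 1" using p prime_gt_1_nat by blast
  have cop: "coprime m p" if "0 < m" "m < p" for m
    using that p by (metis coprime_commute nat_dvd_not_less prime_imp_coprime)
  have "coprime (k * (p - 1)) p" using cop [OF k] cop [of "p - 1"] p1 by simp
  then obtain x y where x: "k * (p - 1) * x = p * y + 1"
    using bezout_nat [of "k * (p - 1)" p] k p1 by auto
  have orbit: "((h + m * (k * (p - 1))) mod p, i) \<in> s" for m
  proof (induction m)
    case (Suc m)
    have "(back_label p ^^ k) ((h + m * (k * (p - 1))) mod p, i) \<in> s"
      using inv Suc by blast
    moreover have "(h + m * (k * (p - 1))) mod p < p" using p1 by simp
    moreover have "((h + m * K) mod p + K) mod p = (h + Suc m * K) mod p" for K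
      unfolding mod_add_left_eq by (simp only: mult_Suc add.assoc add.commute add.left_commute)
    ultimately show ?case by (simp only: back_label_funpow)
  qed (use hi in simp)
  have "(h', i) \<in> s" if "h' < p" for h'
  proof -
    let ?t = "h' + p - h"
    have "h + (x * ?t) * (k * (p - 1)) = h + ?t * (k * (p - 1) * x)" by (simp add: ac_simps)
    also have "\<dots> = h + ?t + p * (?t * y)" unfolding x by (simp add: distrib_left ac_simps)
    also have "h + ?t = h' + p" using hi that by simp
    finally have "(h + (x * ?t) * (k * (p - 1))) mod p = h'" using that by simp
    then show ?thesis using orbit [of "x * ?t"] by simp
  qed
  then show ?thesis by auto
qed

lemma openin_strict_dominance:
  assumes "finite S" "\<And>l. l \<in> S \<Longrightarrow> continuous_map X euclideanreal (f l)" "continuous_map X euclideanreal f0"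
  shows "openin X {x \<in> topspace X. \<forall>l\<in>S. f l x < f0 x}"
  using assms(1,2)
proof (induction S rule: finite_induct)
  case (insert l S)
  have "continuous_map X euclideanreal (\<lambda>x. f0 x - f l x)"
    using insert.prems assms(3) by (intro continuous_map_diff) auto
  then have "openin X {x \<in> topspace X. f0 x - f l x \<in> {0<..}}"
    by (rule openin_continuous_map_preimage) simp
  then have "openin X ({x \<in> topspace X. f0 x - f l x \<in> {0<..}} \<inter> {x \<in> topspace X. \<forall>l\<in>S. f l x < f0 x})"
    using insert by (intro openin_Int) auto
  also have "\<dots> = {x \<in> topspace X. \<forall>l\<in>insert l S. f l x < f0 x}" by auto
  finally show ?case .
qed simp

text \<open>A Borsuk-Ulam theorem for functions whose values over each \<open>i\<close> add up to zero. Without a zero, the largest value of each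
  \<open>F \<phi>\<close> is positive; labelling \<open>\<phi>\<close> by an index where it is attained contradicts \<open>no_equivariant_labelling\<close>.\<close>

lemma (in oriented_closed_smooth_manifold) equivariant_zero:
  fixes F :: "(nat \<Rightarrow> 'a) \<Rightarrow> nat \<times> nat \<Rightarrow> real"
  assumes p: "prime p" "p > 2" and ne: "topspace M \<noteq> {}" and I: "finite I" "card I = CARD('n)"
    and cont: "\<And>h i. \<lbrakk>h < p; i \<in> I\<rbrakk> \<Longrightarrow> continuous_map (conf M p) euclideanreal (\<lambda>\<phi>. F \<phi> (h, i))"
    and sum0: "\<And>\<phi> i. \<lbrakk>\<phi> \<in> topspace (conf M p); i \<in> I\<rbrakk> \<Longrightarrow> (\<Sum>h<p. F \<phi> (h, i)) = 0"
    and equi: "\<And>\<phi> h i. \<lbrakk>\<phi> \<in> topspace (conf M p); h < p; i \<in> I\<rbrakk> \<Longrightarrow> F (rot p \<phi>) (h, i) = F \<phi> (Suc h mod p, i)"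
  shows "\<exists>\<phi>\<in>topspace (conf M p). \<forall>h<p. \<forall>i\<in>I. F \<phi> (h, i) = 0"
proof (rule ccontr)
  assume contra: "\<not> ?thesis"
  define Y where "Y = conf M p"
  define L where "L = {..<p} \<times> I"
  define n where "n = (p - 1) * CARD('n)"
  let ?g = "back_label p"
  define A where "A \<phi> = {l \<in> L. \<forall>l'\<in>L. F \<phi> l' \<le> F \<phi> l}" for \<phi>
  have p1: "p > 1" using p by simp
  have finL: "finite L" using I by (simp add: L_def)
  have rotY: "rot p \<phi> \<in> topspace Y" if "\<phi> \<in> topspace Y" for \<phi>
    using continuous_map_rot [of M p] that unfolding Y_def by (auto simp: continuous_map_def)
  have gL: "?g l \<in> L" if "l \<in> L" for l using that p1 by (auto simp: back_label_def L_def)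
  have gper: "(?g ^^ p) l = l" if "l \<in> L" for l
    using that by (auto simp: L_def back_label_funpow)
  have Frot: "F (rot p \<phi>) (?g l) = F \<phi> l" if \<phi>: "\<phi> \<in> topspace Y" and l: "l \<in> L" for \<phi> l
  proof -
    obtain h i where hi: "l = (h, i)" "h < p" "i \<in> I" using l by (auto simp: L_def)
    have "F (rot p \<phi>) ((h + (p - 1)) mod p, i) = F \<phi> (Suc ((h + (p - 1)) mod p) mod p, i)"
      using \<phi> hi p1 by (intro equi) (auto simp: Y_def)
    then show ?thesis unfolding Suc_pred_mod [OF hi(2)] by (simp add: hi back_label_def)
  qed
  have gsurj: "\<exists>l\<in>L. l' = ?g l" if "l' \<in> L" for l'
  proof -
    have "?g ((?g ^^ (p - 1)) l') = (?g ^^ p) l'"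
      using p1 by (metis Suc_diff_1 funpow.simps(2) comp_apply less_trans zero_less_one)
    moreover have "(?g ^^ k) l' \<in> L" for k by (induction k) (use that gL in auto)
    ultimately show ?thesis using gper [OF that] by metis
  qed
  have pos: "F \<phi> l > 0" if \<phi>: "\<phi> \<in> topspace Y" and l: "l \<in> A \<phi>" for \<phi> l
  proof (rule ccontr)
    assume "\<not> F \<phi> l > 0"
    moreover have "F \<phi> (h, i) \<le> F \<phi> l" if "h < p" "i \<in> I" for h i
      using l that by (auto simp: A_def L_def)
    ultimately have le: "F \<phi> (h, i) \<le> 0" if "h < p" "i \<in> I" for h i
      using that by (meson linorder_not_less order.trans)
    have "F \<phi> (h, i) = 0" if hi: "h < p" "i \<in> I" for h i
    proof -
      have "(\<Sum>h<p. - F \<phi> (h, i)) = 0" using sum0 [of \<phi> i] \<phi> hi by (simp add: Y_def sum_negf)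
      then have "\<forall>h\<in>{..<p}. - F \<phi> (h, i) = 0" using le hi by (subst (asm) sum_nonneg_eq_0_iff) auto
      then show ?thesis using hi by simp
    qed
    then show False using contra \<phi> unfolding Y_def by blast
  qed
  have "L \<noteq> {}"
    using p1 I by (auto simp: L_def)
  then have Ane: "A \<phi> \<noteq> {}" for \<phi>
  proof -
    have "Max (F \<phi> ` L) \<in> F \<phi> ` L" using finL \<open>L \<noteq> {}\<close> by simp
    then obtain l where "l \<in> L" "F \<phi> l = Max (F \<phi> ` L)" by auto
    then have "l \<in> A \<phi>" using finL by (auto simp: A_def)
    then show ?thesis by blast
  qed
  obtain lab where lab: "\<And>\<phi>. \<phi> \<in> topspace Y \<Longrightarrow> lab \<phi> \<in> A \<phi>" "\<And>\<phi>. \<phi> \<in> topspace Y \<Longrightarrow> lab (rot p \<phi>) = ?g (lab \<phi>)"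
  proof (rule equivariant_selection [where p = p and \<Omega> = "topspace Y" and \<tau> = "rot p" and g = ?g and A = A])
    fix \<phi> assume \<phi>: "\<phi> \<in> topspace Y"
    show "(rot p ^^ p) \<phi> = \<phi>" using \<phi> by (intro rot_period) (auto simp: Y_def topspace_conf PiE_iff)
    show "(rot p ^^ k) \<phi> \<noteq> \<phi>" if "0 < k" "k < p" for k
      using \<phi> that p by (intro rot_free) (auto simp: Y_def topspace_conf)
    show "?g l \<in> A (rot p \<phi>)" if l: "l \<in> A \<phi>" for l
      unfolding A_def
    proof (intro CollectI conjI ballI)
      have lL: "l \<in> L" using l by (simp add: A_def)
      show "?g l \<in> L" using lL by (rule gL)
      fix l' assume "l' \<in> L"
      then obtain l'' where "l'' \<in> L" "l' = ?g l''" using gsurj by blast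
      then show "F (rot p \<phi>) l' \<le> F (rot p \<phi>) (?g l)"
        using Frot [OF \<phi>] lL l by (simp add: A_def)
    qed
    show "(?g ^^ p) l = l" if "l \<in> A \<phi>" for l using that gper by (simp add: A_def)
  qed (use p1 rotY Ane in auto)
  \<comment> \<open>On \<open>U \<phi>\<close> an index with \<open>F \<phi> l \<le> 0\<close> is beaten by the label of \<open>\<phi>\<close>, so no point of \<open>U \<phi>\<close> is labelled by it.\<close>
  define U where "U \<phi> = {\<psi> \<in> topspace Y. \<forall>l\<in>{l\<in>L. F \<phi> l \<le> 0}. F \<psi> l < F \<psi> (lab \<phi>)}" for \<phi>
  \<comment> \<open>Admissible label sets miss at least one index over each \<open>i\<close>.\<close>
  define \<K> where "\<K> = {V. V \<subseteq> L \<and> (\<forall>i\<in>I. \<not> {..<p} \<times> {i} \<subseteq> V)}"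
  have labL: "lab \<phi> \<in> L" if "\<phi> \<in> topspace Y" for \<phi> using lab(1) [OF that] by (simp add: A_def)
  have contL: "continuous_map Y euclideanreal (\<lambda>\<phi>. F \<phi> l)" if "l \<in> L" for l
    using that cont by (auto simp: L_def Y_def)
  obtain \<alpha> s where \<alpha>: "\<And>j. j \<le> n \<Longrightarrow> singular_chain j Y (\<alpha> j)"
    "\<And>j. j < n \<Longrightarrow> chain_boundary (Suc j) (\<alpha> (Suc j)) = alt_op p (chain_map j (rot p)) j (\<alpha> j)"
    "\<alpha> 0 = frag_of s"
    unfolding Y_def by (rule equivariant_chains_conf [OF p ne n_def]) blast
  show False
  proof (rule no_equivariant_labelling [where X = Y and \<sigma> = "rot p" and \<alpha> = \<alpha> and n = n and lab = lab
        and L = L and g = ?g and \<K> = \<K> and \<C> = "U ` topspace Y", OF p1 _ \<alpha>(1) \<alpha>(2) \<alpha>(3) labL lab(2) gper gL])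
    show "continuous_map Y Y (rot p)" unfolding Y_def by (rule continuous_map_rot)
    show "V \<subseteq> L \<and> finite V \<and> card V \<le> n" if V: "V \<in> \<K>" for V
    proof (intro conjI)
      show VL: "V \<subseteq> L" using V by (simp add: \<K>_def)
      show "finite V" by (rule finite_subset [OF VL finL])
      have "card (V \<inter> {..<p} \<times> {i}) \<le> p - 1" if "i \<in> I" for i
      proof -
        have "V \<inter> {..<p} \<times> {i} \<subset> {..<p} \<times> {i}" using V that by (auto simp: \<K>_def)
        from psubset_card_mono [OF _ this] show ?thesis by simp
      qed
      then have "(\<Sum>i\<in>I. card (V \<inter> {..<p} \<times> {i})) \<le> card I * (p - 1)"
        using sum_bounded_above [of I "\<lambda>i. card (V \<inter> {..<p} \<times> {i})" "p - 1"] by simp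
      moreover have "V = (\<Union>i\<in>I. V \<inter> {..<p} \<times> {i})" using VL by (auto simp: L_def)
      then have "card V \<le> (\<Sum>i\<in>I. card (V \<inter> {..<p} \<times> {i}))" using card_UN_le [OF I(1)] by metis
      moreover have "card I * (p - 1) \<le> n" using I(2) by (simp add: n_def)
      ultimately show "card V \<le> n" by linarith
    qed
    show "?g ` V \<in> \<K>" if V: "V \<in> \<K>" for V
    proof -
      have VL: "V \<subseteq> L" using V by (simp add: \<K>_def)
      have "\<not> {..<p} \<times> {i} \<subseteq> ?g ` V" if i: "i \<in> I" for i
      proof
        assume sub: "{..<p} \<times> {i} \<subseteq> ?g ` V"
        have "(h, i) \<in> V" if h: "h < p" for h
        proof -
          have "?g (h, i) \<in> ?g ` V" using sub p1 by (force simp: back_label_def)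
          then obtain h' where h': "(h', i) \<in> V" "(h + (p - 1)) mod p = (h' + (p - 1)) mod p"
            by (auto simp: back_label_def)
          then have "h' < p" using VL by (auto simp: L_def)
          then show ?thesis using h' Suc_pred_mod [OF h] Suc_pred_mod [of h' p] by simp
        qed
        then show False using V i by (auto simp: \<K>_def)
      qed
      then show ?thesis using VL gL by (auto simp: \<K>_def)
    qed
    show "(?g ^^ k) ` t \<noteq> t" if "V \<in> \<K>" "t \<subseteq> V" "t \<noteq> {}" "0 < k" "k < p" for V t k
    proof
      assume inv: "(?g ^^ k) ` t = t"
      obtain h i where hi: "(h, i) \<in> t" using \<open>t \<noteq> {}\<close> by fastforce
      then have "h < p" "i \<in> I" using that by (auto simp: \<K>_def L_def)
      then have "{..<p} \<times> {i} \<subseteq> V"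
        using order.trans [OF back_label_invariant_contains_fibre [OF p(1) that(4,5) inv hi] that(2)] by simp
      then show False using \<open>i \<in> I\<close> \<open>V \<in> \<K>\<close> by (simp add: \<K>_def)
    qed
    show "openin Y W" if "W \<in> U ` topspace Y" for W
    proof -
      from that obtain \<phi> where \<phi>: "\<phi> \<in> topspace Y" "W = U \<phi>" by auto
      show ?thesis unfolding \<phi>(2) U_def
        using finL by (intro openin_strict_dominance contL labL \<phi>) auto
    qed
    show "topspace Y \<subseteq> \<Union> (U ` topspace Y)"
    proof
      fix \<phi> assume \<phi>: "\<phi> \<in> topspace Y"
      have "\<phi> \<in> U \<phi>" using pos [OF \<phi> lab(1) [OF \<phi>]] \<phi> by (auto simp: U_def)
      then show "\<phi> \<in> \<Union> (U ` topspace Y)" using \<phi> by blast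
    qed
    show "\<exists>V\<in>\<K>. lab ` W \<subseteq> V" if "W \<in> U ` topspace Y" for W
    proof -
      from that obtain \<phi> where \<phi>: "\<phi> \<in> topspace Y" "W = U \<phi>" by auto
      let ?V = "{l \<in> L. F \<phi> l > 0}"
      have "lab \<psi> \<in> ?V" if \<psi>: "\<psi> \<in> W" for \<psi>
      proof (rule ccontr)
        assume n: "lab \<psi> \<notin> ?V"
        have \<psi>Y: "\<psi> \<in> topspace Y" using \<psi> \<phi> by (simp add: U_def)
        have "lab \<psi> \<in> {l \<in> L. F \<phi> l \<le> 0}" using n labL [OF \<psi>Y] by simp
        then have "F \<psi> (lab \<psi>) < F \<psi> (lab \<phi>)" using \<psi> unfolding \<phi>(2) U_def by blast
        then show False using lab(1) [OF \<psi>Y] labL [OF \<phi>(1)] by (force simp: A_def)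
      qed
      moreover have "\<not> {..<p} \<times> {i} \<subseteq> ?V" if "i \<in> I" for i
      proof
        assume "{..<p} \<times> {i} \<subseteq> ?V"
        then have "(\<Sum>h<p. F \<phi> (h, i)) > 0" using p1 by (intro sum_pos) auto
        then show False using sum0 [of \<phi> i] \<phi> that by (simp add: Y_def)
      qed
      then have "?V \<in> \<K>" by (auto simp: \<K>_def)
      ultimately show ?thesis by blast
    qed
  qed
qed

lemma sum_rotate: "(\<Sum>h<p. f (Suc h mod p)) = (\<Sum>h<p. f h)" for f :: "nat \<Rightarrow> real"
proof (cases p)
  case (Suc q)
  have "(\<Sum>h<Suc q. f (Suc h mod Suc q)) = (\<Sum>h<q. f (Suc h)) + f 0" by simp
  also have "\<dots> = (\<Sum>h<Suc q. f h)" by (subst sum.lessThan_Suc_shift) simp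
  finally show ?thesis using Suc by simp
qed simp

text \<open>Subtracting means turns the conclusion into the vanishing of an equivariant map. At a zero, all values of
  \<open>\<rho> (\<phi> h, \<phi> (h + g\<^sub>i))\<close> equal their mean, so in particular the value at \<open>h = 0\<close>.\<close>

theorem theorem2:
  fixes p d :: nat
    and M :: "'a topology"
    and A :: "('a, 'n::finite) chart set"
    and \<rho> :: "'a \<times> 'a \<Rightarrow> real"
    and g :: "nat \<Rightarrow> int"
  assumes "prime p" and "p > 2"
    and "oriented_closed_smooth_manifold M A"
    and "topspace M \<noteq> {}"
    and "CARD('n) = d"
    and "continuous_map (prod_topology M M) euclideanreal \<rho>"
    and "\<And>i. i \<in> {1..d} \<Longrightarrow> g i \<in> carrier (integer_mod_group p)"
  shows "\<exists>\<phi> \<in> carrier (integer_mod_group p) \<rightarrow> topspace M.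
           \<not> \<phi> constant_on carrier (integer_mod_group p) \<and>
           (\<forall>h \<in> carrier (integer_mod_group p). \<forall>i \<in> {1..d}.
              \<rho> (\<phi> h, \<phi> (h \<otimes>\<^bsub>integer_mod_group p\<^esub> g i)) =
              \<rho> (\<phi> \<one>\<^bsub>integer_mod_group p\<^esub>, \<phi> (g i)))"
proof -
  interpret oriented_closed_smooth_manifold M A by fact
  have p0: "p > 0" using \<open>p > 2\<close> by simp
  define R where "R \<phi> h i = \<rho> (\<phi> h, \<phi> ((h + nat (g i)) mod p))" for \<phi> h i
  define F where "F \<phi> = (\<lambda>(h, i). R \<phi> h i - (\<Sum>k<p. R \<phi> k i) / p)" for \<phi>
  have contR: "continuous_map (conf M p) euclideanreal (\<lambda>\<phi>. R \<phi> h i)" if "h < p" for h i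
  proof -
    have "continuous_map (conf M p) (prod_topology M M) (\<lambda>\<phi>. (\<phi> h, \<phi> ((h + nat (g i)) mod p)))"
      using that p0 by (intro continuous_map_pairedI continuous_map_conf_proj) auto
    from continuous_map_compose [OF this assms(6)] show ?thesis by (simp add: R_def o_def)
  qed
  have Rrot: "R (rot p \<phi>) h i = R \<phi> (Suc h mod p) i" if "h < p" for \<phi> h i
    using that p0 by (simp add: R_def rot_def mod_Suc_eq mod_add_left_eq)
  have "\<exists>\<phi>\<in>topspace (conf M p). \<forall>h<p. \<forall>i\<in>{1..d}. F \<phi> (h, i) = 0"
  proof (rule equivariant_zero [OF assms(1,2,4)])
    show "continuous_map (conf M p) euclideanreal (\<lambda>\<phi>. F \<phi> (h, i))" if "h < p" for h i
      unfolding F_def using that p0 by (auto intro!: continuous_map_diff continuous_map_sum contR continuous_map_real_divide)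
    show "(\<Sum>h<p. F \<phi> (h, i)) = 0" for \<phi> i
      using p0 by (simp add: F_def sum_subtractf)
    show "F (rot p \<phi>) (h, i) = F \<phi> (Suc h mod p, i)" if "h < p" for \<phi> h i
      using that sum_rotate [of "\<lambda>k. R \<phi> k i" p] by (simp add: F_def Rrot)
  qed (use assms(5) in auto)
  then obtain \<phi> where \<phi>: "\<phi> \<in> topspace (conf M p)" "\<And>h i. \<lbrakk>h < p; i \<in> {1..d}\<rbrakk> \<Longrightarrow> F \<phi> (h, i) = 0" by blast
  have carr: "carrier (integer_mod_group p) = {0..<int p}" using p0 by (simp add: carrier_integer_mod_group)
  define \<psi> where "\<psi> x = \<phi> (nat x)" for x
  obtain k where k: "k < p" "\<phi> k \<noteq> \<phi> 0" using \<phi>(1) by (auto simp: topspace_conf elim: nonconstE)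
  show ?thesis
  proof (intro bexI [of _ \<psi>] conjI ballI)
    show "\<psi> \<in> carrier (integer_mod_group p) \<rightarrow> topspace M"
      using \<phi>(1) by (auto simp: carr \<psi>_def topspace_conf PiE_iff)
    have "\<psi> (int k) \<noteq> \<psi> 0" using k by (simp add: \<psi>_def)
    moreover have "int k \<in> {0..<int p}" "0 \<in> {0..<int p}" using k by auto
    ultimately show "\<not> \<psi> constant_on carrier (integer_mod_group p)"
      unfolding carr constant_on_def by metis
    fix h i assume h: "h \<in> carrier (integer_mod_group p)" and i: "i \<in> {1..d}"
    have h': "0 \<le> h" "nat h < p" using h by (auto simp: carr)
    have gi: "0 \<le> g i" "nat (g i) < p" using assms(7) [OF i] by (auto simp: carr)
    have "R \<phi> (nat h) i = R \<phi> 0 i" using \<phi>(2) [OF h'(2) i] \<phi>(2) [OF p0 i] by (simp add: F_def)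
    moreover have "nat ((h + g i) mod int p) = (nat h + nat (g i)) mod p"
      using h' gi by (simp add: nat_mod_distrib nat_add_distrib)
    ultimately show "\<rho> (\<psi> h, \<psi> (h \<otimes>\<^bsub>integer_mod_group p\<^esub> g i)) =
              \<rho> (\<psi> \<one>\<^bsub>integer_mod_group p\<^esub>, \<psi> (g i))"
      using p0 gi by (simp add: R_def \<psi>_def mult_integer_mod_group)
  qed
qed

end
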